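(* Let $G=G_1\ast\cdots\ast G_n$ be a free product of finitely many nontrivial finite groups and let $L(G)$ be the complex defined in the context. Then $L(G)$ is contractible.
   Context: A basis of $G$ is a set $\mathcal{H}=\{H_1,\dots,H_n\}$ of subgroups with $H_i$ conjugate to $G_i$ and $G=H_1\ast\cdots\ast H_n$; $H_i$ has label $i$. A pointed labelled tree is a finite bipartite tree whose vertices are labelled (labels $\ast,1,\dots,n$, each used once) or unlabelled, each edge joining a labelled and an unlabelled vertex, unlabelled vertices of valence at least 2, and $\ast$ of valence 1. For a labelled vertex $k$, the petals at $k$ are the label sets of the components of $T-\{k\}$, forming a partition $\underline{\underline{A}}(k)$; the tree is identified with the family $\underline{\underline{A}}$ of these partitions. $\underline{\underline{A}}\le\underline{\underline{B}}$ means every petal of each $\underline{\underline{A}}(k)$ is a union of petals of $\underline{\underline{B}}(k)$. For a basis $\mathcal{H}$, $k\in\{1,\dots,n\}$ and $x_j\in H_k$ ($x_k=1$), the symmetric Whitehead automorphism $(\mathcal{H},x)$ acts on $H_j$ by $h\mapsto x_jhx_j^{-1}$ and trivially on $H_k$; it is carried by $(\mathcal{H},\underline{\underline{A}})$ if $x$ is constant on petals of $\underline{\underline{A}}(k)$ and trivial on the petal containing $\ast$. Pairs $(\mathcal{H},\underline{\underline{A}})$ and $(\rho(\mathcal{H}),\underline{\underline{A}})$, with $\rho$ a product of symmetric Whitehead automorphisms carried by $(\mathcal{H},\underline{\underline{A}})$, are identified; the classes $[\mathcal{H},\underline{\underline{A}}]$ are ordered by $[\mathcal{H},\underline{\underline{A}}]\le[\mathcal{K},\underline{\underline{B}}]$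 iff they have representatives with a common basis whose trees satisfy $\underline{\underline{A}}\le\underline{\underline{B}}$. $L(G)$ is the geometric realization of this poset. *)

theory Defs
  imports "HOL-Analysis.Analysis" "HOL-Algebra.Group"
begin

definition reduced_word :: "('a, 'b) monoid_scheme \<Rightarrow> (nat \<Rightarrow> 'a set) \<Rightarrow> nat \<Rightarrow> (nat \<times> 'a) list \<Rightarrow> bool" where
  "reduced_word G Hs n ws \<longleftrightarrow>
     (\<forall>i<length ws. fst (ws ! i) \<in> {1..n} \<and> snd (ws ! i) \<in> Hs (fst (ws ! i)) - {\<one>\<^bsub>G\<^esub>}) \<and>
     (\<forall>i. Suc i < length ws \<longrightarrow> fst (ws ! i) \<noteq> fst (ws ! Suc i))"

definition word_val :: "('a, 'b) monoid_scheme \<Rightarrow> (nat \<times> 'a) list \<Rightarrow> 'a" where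
  "word_val G ws = foldr (\<lambda>p acc. snd p \<otimes>\<^bsub>G\<^esub> acc) ws \<one>\<^bsub>G\<^esub>"

definition internal_free_product :: "('a, 'b) monoid_scheme \<Rightarrow> (nat \<Rightarrow> 'a set) \<Rightarrow> nat \<Rightarrow> bool" where
  "internal_free_product G Hs n \<longleftrightarrow>
     (\<forall>i\<in>{1..n}. subgroup (Hs i) G) \<and>
     bij_betw (word_val G) {ws. reduced_word G Hs n ws} (carrier G)"

definition is_basis :: "('a, 'b) monoid_scheme \<Rightarrow> (nat \<Rightarrow> 'a set) \<Rightarrow> nat \<Rightarrow> (nat \<Rightarrow> 'a set) \<Rightarrow> bool" where
  "is_basis G Gs n H \<longleftrightarrow>
     (\<forall>i\<in>{1..n}. \<exists>g\<in>carrier G. H i = (\<lambda>h. g \<otimes>\<^bsub>G\<^esub> h \<otimes>\<^bsub>G\<^esub> inv\<^bsub>G\<^esub> g) ` Gs i) \<and>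
     internal_free_product G H n \<and>
     (\<forall>i. i \<notin> {1..n} \<longrightarrow> H i = {})"

text \<open>Labels are 0,1,..,n with 0 standing for the base label *. A labelled vertex i is
Inl i; an unlabelled vertex is Inr e, where e is its set of (labelled) neighbours
(in a tree distinct unlabelled vertices of valence at least 2 have distinct neighbour sets,
so a tree up to label-preserving isomorphism is the set E of these neighbour sets).\<close>

definition tree_verts :: "nat \<Rightarrow> nat set set \<Rightarrow> (nat + nat set) set" where
  "tree_verts n E = Inl ` {0..n} \<union> Inr ` E"

definition tree_adj :: "nat set set \<Rightarrow> (nat + nat set) \<Rightarrow> (nat + nat set) \<Rightarrow> bool" where
  "tree_adj E u v \<longleftrightarrow> (\<exists>i e. e \<in> E \<and> i \<in> e \<and>
      ((u = Inl i \<and> v = Inr e) \<or> (u = Inr e \<and> v = Inl i)))"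

definition conn_in :: "'v set \<Rightarrow> ('v \<Rightarrow> 'v \<Rightarrow> bool) \<Rightarrow> 'v \<Rightarrow> 'v \<Rightarrow> bool" where
  "conn_in V R u v \<longleftrightarrow> (\<lambda>x y. x \<in> V \<and> y \<in> V \<and> R x y)\<^sup>*\<^sup>* u v"

definition is_tree :: "'v set \<Rightarrow> ('v \<Rightarrow> 'v \<Rightarrow> bool) \<Rightarrow> bool" where
  "is_tree V R \<longleftrightarrow> V \<noteq> {} \<and> (\<forall>u\<in>V. \<forall>v\<in>V. conn_in V R u v) \<and>
     (\<forall>u\<in>V. \<forall>v\<in>V. R u v \<longrightarrow> \<not> conn_in V (\<lambda>x y. R x y \<and> {x, y} \<noteq> {u, v}) u v)"

definition pl_tree :: "nat \<Rightarrow> nat set set \<Rightarrow> bool" where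
  "pl_tree n E \<longleftrightarrow>
     (\<forall>e\<in>E. e \<subseteq> {0..n} \<and> 2 \<le> card e) \<and>
     card {e\<in>E. (0::nat) \<in> e} = 1 \<and>
     is_tree (tree_verts n E) (tree_adj E)"

definition petals :: "nat \<Rightarrow> nat set set \<Rightarrow> nat \<Rightarrow> nat set set" where
  "petals n E k = {{j \<in> {0..n} - {k}. conn_in (tree_verts n E - {Inl k}) (tree_adj E) (Inl i) (Inl j)}
                   | i. i \<in> {0..n} - {k}}"

definition tree_le :: "nat \<Rightarrow> nat set set \<Rightarrow> nat set set \<Rightarrow> bool" where
  "tree_le n A B \<longleftrightarrow> (\<forall>k\<in>{0..n}. \<forall>P\<in>petals n A k. \<exists>S\<subseteq>petals n B k. P = \<Union>S)"

definition wh_carried :: "('a, 'b) monoid_scheme \<Rightarrow> nat \<Rightarrow> (nat \<Rightarrow> 'a set) \<Rightarrow> nat set set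
    \<Rightarrow> ('a \<Rightarrow> 'a) \<Rightarrow> bool" where
  "wh_carried G n H E \<phi> \<longleftrightarrow> (\<exists>k x.
     k \<in> {1..n} \<and> (\<forall>j\<in>{1..n}. x j \<in> H k) \<and> x k = \<one>\<^bsub>G\<^esub> \<and>
     (\<forall>P\<in>petals n E k. \<forall>i\<in>P. \<forall>j\<in>P. i \<noteq> 0 \<and> j \<noteq> 0 \<longrightarrow> x i = x j) \<and>
     (\<forall>P\<in>petals n E k. 0 \<in> P \<longrightarrow> (\<forall>j\<in>P. j \<noteq> 0 \<longrightarrow> x j = \<one>\<^bsub>G\<^esub>)) \<and>
     \<phi> \<in> iso G G \<and>
     (\<forall>j\<in>{1..n}. \<forall>h\<in>H j. \<phi> h = x j \<otimes>\<^bsub>G\<^esub> h \<otimes>\<^bsub>G\<^esub> inv\<^bsub>G\<^esub> (x j)))"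

inductive_set carried_prod :: "('a, 'b) monoid_scheme \<Rightarrow> nat \<Rightarrow> (nat \<Rightarrow> 'a set) \<Rightarrow> nat set set
    \<Rightarrow> ('a \<Rightarrow> 'a) set"
  for G n H E where
    cp_id: "id \<in> carried_prod G n H E"
  | cp_step: "wh_carried G n H E \<phi> \<Longrightarrow> \<rho> \<in> carried_prod G n H E \<Longrightarrow> \<phi> \<circ> \<rho> \<in> carried_prod G n H E"

definition valid_pairs :: "('a, 'b) monoid_scheme \<Rightarrow> (nat \<Rightarrow> 'a set) \<Rightarrow> nat
    \<Rightarrow> ((nat \<Rightarrow> 'a set) \<times> nat set set) set" where
  "valid_pairs G Gs n = {(H, E). is_basis G Gs n H \<and> pl_tree n E}"

definition ident_step :: "('a, 'b) monoid_scheme \<Rightarrow> (nat \<Rightarrow> 'a set) \<Rightarrow> nat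
    \<Rightarrow> (((nat \<Rightarrow> 'a set) \<times> nat set set) \<times> ((nat \<Rightarrow> 'a set) \<times> nat set set)) set" where
  "ident_step G Gs n = {((H, E), (H', E')). (H, E) \<in> valid_pairs G Gs n \<and> E' = E \<and>
      (\<exists>\<rho>\<in>carried_prod G n H E. H' = (\<lambda>j. \<rho> ` H j))}"

definition ident :: "('a, 'b) monoid_scheme \<Rightarrow> (nat \<Rightarrow> 'a set) \<Rightarrow> nat
    \<Rightarrow> (((nat \<Rightarrow> 'a set) \<times> nat set set) \<times> ((nat \<Rightarrow> 'a set) \<times> nat set set)) set" where
  "ident G Gs n = (ident_step G Gs n \<union> (ident_step G Gs n)\<inverse>)\<^sup>*"

definition L_elems :: "('a, 'b) monoid_scheme \<Rightarrow> (nat \<Rightarrow> 'a set) \<Rightarrow> nat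
    \<Rightarrow> ((nat \<Rightarrow> 'a set) \<times> nat set set) set set" where
  "L_elems G Gs n = valid_pairs G Gs n // ident G Gs n"

definition L_le :: "nat \<Rightarrow> ((nat \<Rightarrow> 'a set) \<times> nat set set) set
    \<Rightarrow> ((nat \<Rightarrow> 'a set) \<times> nat set set) set \<Rightarrow> bool" where
  "L_le n c d \<longleftrightarrow> (\<exists>H A B. (H, A) \<in> c \<and> (H, B) \<in> d \<and> tree_le n A B)"

definition is_chain_in :: "'v set \<Rightarrow> ('v \<Rightarrow> 'v \<Rightarrow> bool) \<Rightarrow> 'v set \<Rightarrow> bool" where
  "is_chain_in P ord_rel \<sigma> \<longleftrightarrow> finite \<sigma> \<and> \<sigma> \<noteq> {} \<and> \<sigma> \<subseteq> P \<and>
     (\<forall>a\<in>\<sigma>. \<forall>b\<in>\<sigma>. ord_rel a b \<or> ord_rel b a)"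

definition closed_simplex :: "'v set \<Rightarrow> ('v \<Rightarrow> real) set" where
  "closed_simplex \<sigma> = {t. (\<forall>v. 0 \<le> t v) \<and> (\<forall>v. v \<notin> \<sigma> \<longrightarrow> t v = 0) \<and> sum t \<sigma> = 1}"

definition realization_space :: "'v set \<Rightarrow> ('v \<Rightarrow> 'v \<Rightarrow> bool) \<Rightarrow> ('v \<Rightarrow> real) set" where
  "realization_space P ord_rel = \<Union>{closed_simplex \<sigma> | \<sigma>. is_chain_in P ord_rel \<sigma>}"

text \<open>Each closed simplex carries the Euclidean topology (= subspace of the product topology,
since its points are supported in a finite set); the realization carries the weak (coherent)
topology with respect to its closed simplices.\<close>

definition geometric_realization :: "'v set \<Rightarrow> ('v \<Rightarrow> 'v \<Rightarrow> bool) \<Rightarrow> ('v \<Rightarrow> real) topology" where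
  "geometric_realization P ord_rel = topology (\<lambda>U. U \<subseteq> realization_space P ord_rel \<and>
     (\<forall>\<sigma>. is_chain_in P ord_rel \<sigma> \<longrightarrow>
        openin (subtopology (product_topology (\<lambda>_. euclideanreal) UNIV) (closed_simplex \<sigma>))
               (U \<inter> closed_simplex \<sigma>)))"

definition L_complex :: "('a, 'b) monoid_scheme \<Rightarrow> (nat \<Rightarrow> 'a set) \<Rightarrow> nat
    \<Rightarrow> (((nat \<Rightarrow> 'a set) \<times> nat set set) set \<Rightarrow> real) topology" where
  "L_complex G Gs n = geometric_realization (L_elems G Gs n) (L_le n)"

end

theory Submission
  imports Defs
begin

text \<open>A basis is described by the vertices that its members fix in the Bass--Serre tree of the given
  splitting. To a basis with a pointed labelled tree assign the total number of edges of the subtrees of the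
  Bass--Serre tree spanned by the neighbour sets of the unlabelled vertices. This number depends only on the
  class and is monotone, so its sublevel sets are subcomplexes of \<open>L(G)\<close>. Within a level, every class
  lies below a unique maximal one: split every unlabelled vertex whose spanned subtree passes through one of
  its own labelled vertices.

  Let \<open>m\<close> be maximal in its level and not the class of the given splitting with the star-shaped tree. The
  classes \<open>b\<close> below \<open>m\<close> of smaller level are foldings of \<open>m\<close>. Keeping only the identifications of edges
  that point in the same direction of the Bass--Serre tree gives \<open>\<pi>(b)\<close> with \<open>b \<le> \<pi>(b) \<ge> a\<close>, where \<open>a\<close>
  makes all such identifications, after representatives have been chosen for which every direction is
  aligned. Hence the lower link of \<open>m\<close> in the smaller levels is contractible. If nothing can be folded, a
  ping-pong argument shows that the basis is the given one. So each level deformation retracts to the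
  preceding one, and the lowest one is a point.\<close>

section \<open>Separation relations of labelled trees\<close>

text \<open>The level drops under folding for a counting reason. Merging two neighbour sets at a
  label replaces two spanned subtrees by one, and an edge common to both is then counted once.
  Subtrees that leave the label along the same edge lose at least that edge; if they leave along
  different edges, they have only one vertex in common and nothing is lost. The obstacle is that a
  class has many bases. Identified pairs differ by one translation on each neighbour set, but
  different neighbour sets move differently, so directions at a label can be compared only inside
  one petal. Level, maximal tree and \<pi> use only such comparisons. Edges of the Bass--Serre tree
  have trivial stabilizers, which makes this representative unique. A representative of \<pi>(b) can
  be rotated into it without leaving the class \<pi>(b), and this gives a \<le> \<pi>(b).\<close>

text \<open>A pointed labelled tree, with \<open>0\<close> for the base label, is recorded by the relation \<open>R k i j\<close>: the
  labelled vertex \<open>k\<close> does not separate \<open>i\<close> from \<open>j\<close>. The unlabelled vertices are recovered as the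
  \<open>hyperedges\<close>, the sets of their neighbours.\<close>

locale sep_family =
  fixes n :: nat and R :: "nat \<Rightarrow> nat \<Rightarrow> nat \<Rightarrow> bool"
  assumes dom: "R k i j \<Longrightarrow> k \<le> n \<and> i \<le> n \<and> j \<le> n \<and> i \<noteq> k \<and> j \<noteq> k"
    and rfl: "k \<le> n \<Longrightarrow> i \<le> n \<Longrightarrow> i \<noteq> k \<Longrightarrow> R k i i"
    and sm: "R k i j \<Longrightarrow> R k j i"
    and trn: "R k i j \<Longrightarrow> R k j l \<Longrightarrow> R k i l"
    and compat: "k \<le> n \<Longrightarrow> l \<le> n \<Longrightarrow> i \<le> n \<Longrightarrow> k \<noteq> l \<Longrightarrow> i \<noteq> k \<Longrightarrow> i \<noteq> l \<Longrightarrow> R k i l \<or> R l i k"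
    and root: "i \<le> n \<Longrightarrow> j \<le> n \<Longrightarrow> i \<noteq> 0 \<Longrightarrow> j \<noteq> 0 \<Longrightarrow> R 0 i j"

text \<open>Two labels are related when they are adjacent to a common unlabelled vertex; the proof
  of \<open>pl_tree_hyperedges\<close> justifies this reading for actual trees.\<close>

definition nbr :: "nat \<Rightarrow> (nat \<Rightarrow> nat \<Rightarrow> nat \<Rightarrow> bool) \<Rightarrow> nat \<Rightarrow> nat \<Rightarrow> bool" where
  "nbr n R i j \<longleftrightarrow> i \<le> n \<and> j \<le> n \<and> i \<noteq> j \<and> (\<forall>k\<le>n. k \<noteq> i \<longrightarrow> k \<noteq> j \<longrightarrow> R k i j)"

definition btw :: "nat \<Rightarrow> (nat \<Rightarrow> nat \<Rightarrow> nat \<Rightarrow> bool) \<Rightarrow> nat \<Rightarrow> nat \<Rightarrow> nat set" where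
  "btw n R i j = {k. k \<le> n \<and> k \<noteq> i \<and> k \<noteq> j \<and> \<not> R k i j}"

text \<open>The first labelled vertex on the path from \<open>k\<close> to \<open>i\<close>.
  Directions at \<open>k\<close> in the Bass--Serre tree are later compared at these first vertices
  instead of the far ends \<open>i\<close>.\<close>

definition toward :: "nat \<Rightarrow> (nat \<Rightarrow> nat \<Rightarrow> nat \<Rightarrow> bool) \<Rightarrow> nat \<Rightarrow> nat \<Rightarrow> nat" where
  "toward n R k i = (THE l. nbr n R k l \<and> (l = i \<or> l \<in> btw n R k i))"

definition hedge :: "nat \<Rightarrow> (nat \<Rightarrow> nat \<Rightarrow> nat \<Rightarrow> bool) \<Rightarrow> nat \<Rightarrow> nat \<Rightarrow> nat set" where
  "hedge n R k i = insert k {l. nbr n R k l \<and> R k i l}"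

definition hyperedges :: "nat \<Rightarrow> (nat \<Rightarrow> nat \<Rightarrow> nat \<Rightarrow> bool) \<Rightarrow> nat set set" where
  "hyperedges n R = {hedge n R k i | k i. k \<le> n \<and> i \<le> n \<and> i \<noteq> k}"

lemma finite_btw [simp]: "finite (btw n R i j)"
  by (rule finite_subset[of _ "{..n}"]) (auto simp: btw_def)

context sep_family
begin

lemma nbr_sym: "nbr n R i j \<Longrightarrow> nbr n R j i"
  unfolding nbr_def using sm by blast

lemma btw_sym: "btw n R i j = btw n R j i"
  unfolding btw_def using sm by blast

text \<open>The number of separating labels takes the place of distance. This strict monotonicity
  justifies the inductions on \<open>card (btw n R i j)\<close>.\<close>

lemma btw_psubset:
  assumes "k \<in> btw n R i j" "i \<le> n" "j \<le> n"
  shows "btw n R i k \<subset> btw n R i j"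
proof -
  have "l \<in> btw n R i j" if "l \<in> btw n R i k" for l
  proof -
    have l: "l \<le> n" "l \<noteq> i" "l \<noteq> k" "\<not> R l i k" using that by (auto simp: btw_def)
    have k: "k \<le> n" "k \<noteq> i" "k \<noteq> j" "\<not> R k i j" using assms by (auto simp: btw_def)
    have ikl: "R k i l" using compat[of k l i] l k assms by blast
    have "l \<noteq> j" using ikl k by auto
    moreover have "\<not> R l i j"
    proof
      assume ij: "R l i j"
      have "R k j l \<or> R l j k" using compat[of k l j] l k assms \<open>l \<noteq> j\<close> by blast
      then show False using ikl ij l k trn sm by blast
    qed
    ultimately show ?thesis using l by (auto simp: btw_def)
  qed
  moreover have "k \<notin> btw n R i k" by (auto simp: btw_def)
  ultimately show ?thesis using assms by blast
qed

lemma btw_psubset':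
  assumes "k \<in> btw n R i j" "i \<le> n" "j \<le> n"
  shows "btw n R k j \<subset> btw n R i j"
  using btw_psubset[of k j i] assms btw_sym by auto

lemma btw_card_less:
  assumes "k \<in> btw n R i j" "i \<le> n" "j \<le> n"
  shows "card (btw n R i k) < card (btw n R i j)" "card (btw n R k j) < card (btw n R i j)"
  using psubset_card_mono[OF finite_btw btw_psubset[OF assms]]
    psubset_card_mono[OF finite_btw btw_psubset'[OF assms]] by auto

lemma nbr_iff_btw: "i \<le> n \<Longrightarrow> j \<le> n \<Longrightarrow> i \<noteq> j \<Longrightarrow> nbr n R i j \<longleftrightarrow> btw n R i j = {}"
  by (auto simp: nbr_def btw_def)

text \<open>Existence: a candidate with fewest labels between it and \<open>k\<close>. Uniqueness:
  two neighbours of \<open>k\<close> do not cut each other off from \<open>k\<close>, so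
  \<open>compat\<close> forbids that both separate \<open>k\<close> from \<open>i\<close>.\<close>

lemma toward_ex1:
  assumes "k \<le> n" "i \<le> n" "i \<noteq> k"
  shows "\<exists>!l. nbr n R k l \<and> (l = i \<or> l \<in> btw n R k i)"
proof -
  define S where "S = insert i (btw n R k i)"
  have "finite S" "S \<noteq> {}" by (auto simp: S_def)
  from arg_min_if_finite[OF this, of "\<lambda>x. card (btw n R k x)"]
  obtain l where l: "l \<in> S" "\<And>x. x \<in> S \<Longrightarrow> card (btw n R k l) \<le> card (btw n R k x)"
    by (meson linorder_not_less)
  have lS: "l \<le> n" "l \<noteq> k" using l assms by (auto simp: S_def btw_def)
  have "btw n R k l = {}"
  proof (rule ccontr)
    assume "btw n R k l \<noteq> {}"
    then obtain x where x: "x \<in> btw n R k l" by auto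
    have "x \<in> S" using x l(1) btw_psubset[of l k i] assms by (auto simp: S_def)
    then show False using btw_card_less(1)[OF x] l(2) assms lS by fastforce
  qed
  then have ex: "nbr n R k l \<and> (l = i \<or> l \<in> btw n R k i)"
    using l lS assms nbr_iff_btw by (auto simp: S_def)
  moreover have "l' = l''" if a: "nbr n R k l' \<and> (l' = i \<or> l' \<in> btw n R k i)"
    "nbr n R k l'' \<and> (l'' = i \<or> l'' \<in> btw n R k i)" for l' l''
  proof (rule ccontr)
    assume ne: "l' \<noteq> l''"
    show False
    proof (cases "l' = i \<or> l'' = i")
      case True then show ?thesis using a ne assms nbr_iff_btw by auto
    next
      case False
      then have s: "l' \<in> btw n R k i" "l'' \<in> btw n R k i" using a by auto
      have 1: "R l' k l''" "R l'' k l'" using a ne unfolding nbr_def by auto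
      have "R l' i l'' \<or> R l'' i l'" using compat[of l' l'' i] a ne False s assms by (auto simp: nbr_def)
      then show False using 1 s trn sm unfolding btw_def by blast
    qed
  qed
  ultimately show ?thesis by blast
qed

lemma toward:
  assumes "k \<le> n" "i \<le> n" "i \<noteq> k"
  shows "nbr n R k (toward n R k i)" "toward n R k i = i \<or> toward n R k i \<in> btw n R k i"
  using theI'[OF toward_ex1[OF assms]] unfolding toward_def by auto

lemma toward_eqI:
  assumes "k \<le> n" "i \<le> n" "i \<noteq> k" "nbr n R k l" "l = i \<or> l \<in> btw n R k i"
  shows "toward n R k i = l"
  using toward_ex1[OF assms(1-3)] toward[OF assms(1-3)] assms(4,5) by blast

lemma toward_nbr: "nbr n R k i \<Longrightarrow> toward n R k i = i"
  by (rule toward_eqI) (auto simp: nbr_def)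

lemma btw_R: "l \<in> btw n R k i \<Longrightarrow> k \<le> n \<Longrightarrow> i \<le> n \<Longrightarrow> i \<noteq> k \<Longrightarrow> R k l i"
  using compat[of k l i] sm unfolding btw_def by blast

lemma toward_R:
  assumes "k \<le> n" "i \<le> n" "i \<noteq> k"
  shows "R k (toward n R k i) i"
  using toward(2)[OF assms]
proof
  assume "toward n R k i = i" then show ?thesis using rfl[OF assms] by simp
qed (use btw_R assms in blast)

lemma toward_btw: 
  assumes "x \<in> btw n R k i" "k \<le> n" "i \<le> n" 
  shows "toward n R k x = toward n R k i"
proof -
  have x: "x \<le> n" "x \<noteq> k" using assms by (auto simp: btw_def)
  have "i \<noteq> k" using assms rfl[of x k] by (auto simp: btw_def)
  have "toward n R k x \<in> btw n R k i"
    using toward(2)[of k x] x assms btw_psubset[OF assms] by auto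
  then show ?thesis
    using toward(1)[of k x] toward_eqI[of k i "toward n R k x"] x assms \<open>i \<noteq> k\<close> by auto
qed

lemma nbr_trans:
  assumes "nbr n R k a" "nbr n R k b" "R k a b" "a \<noteq> b"
  shows "nbr n R a b"
proof -
  have "R x a b" if "x \<le> n" "x \<noteq> a" "x \<noteq> b" for x
  proof (cases "x = k")
    case False
    then have "R x k a" "R x k b" using assms that by (auto simp: nbr_def)
    then show ?thesis using sm trn by blast
  qed (use assms in auto)
  then show ?thesis using assms by (auto simp: nbr_def)
qed

lemma hedge_nbr:
  assumes "a \<in> hedge n R k i" "b \<in> hedge n R k i" "a \<noteq> b"
  shows "nbr n R a b"
proof -
  have "nbr n R a b" if "a = k" using assms that by (auto simp: hedge_def)
  moreover have "nbr n R a b" if "b = k" using assms that nbr_sym by (auto simp: hedge_def)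
  moreover have "nbr n R a b" if "a \<noteq> k" "b \<noteq> k"
  proof -
    have k: "nbr n R k a" "nbr n R k b" "R k i a" "R k i b" using assms that by (auto simp: hedge_def)
    then show ?thesis using nbr_trans[OF k(1,2)] sm trn assms(3) by blast
  qed
  ultimately show ?thesis by blast
qed

lemma hedge_nbr_mem: "nbr n R a b \<Longrightarrow> a \<in> hedge n R a b \<and> b \<in> hedge n R a b"
  using rfl[of a b] by (auto simp: hedge_def nbr_def)

lemma hedge_swap: assumes "nbr n R a b" shows "hedge n R a b = hedge n R b a"
proof -
  have "hedge n R a b \<subseteq> hedge n R b a" if "nbr n R a b" for a b
  proof
    fix l assume l: "l \<in> hedge n R a b"
    show "l \<in> hedge n R b a"
    proof (cases "l = b \<or> l = a")
      case True then show ?thesis using that nbr_sym[OF that] rfl[of b a] by (auto simp: hedge_def nbr_def)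
    next
      case False
      then have al: "nbr n R a l" "R a b l" using l by (auto simp: hedge_def)
      then have bl: "nbr n R b l" using nbr_trans[of a b l] that False by auto
      have "R b a l" using al that False unfolding nbr_def by auto
      then show ?thesis using bl by (auto simp: hedge_def)
    qed
  qed
  from this[OF assms] this[OF nbr_sym[OF assms]] show ?thesis by (rule subset_antisym)
qed

text \<open>The base label and the direction in \<open>hedge\<close> are only one way to address a
  neighbour set; any two of its members address it equally well. Hence two hyperedges share at most
  one label.\<close>

lemma hedge_eq:
  assumes "a \<in> hedge n R k i" "b \<in> hedge n R k i" "a \<noteq> b"
  shows "hedge n R k i = hedge n R a b"
proof -
  have 1: "hedge n R k i = hedge n R k x" if "x \<in> hedge n R k i" "x \<noteq> k" for k i x
  proof -
    have "R k i x" using that by (auto simp: hedge_def)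
    then have "R k i l \<longleftrightarrow> R k x l" for l using trn sm by blast
    then show ?thesis by (simp add: hedge_def)
  qed
  have n: "nbr n R a b" using hedge_nbr assms by auto
  show ?thesis
  proof (cases "a = k")
    case True then show ?thesis using 1[of b k i] assms by auto
  next
    case False
    then have ka: "hedge n R k i = hedge n R k a" "nbr n R k a"
      using 1[of a k i] assms by (auto simp: hedge_def)
    then have "hedge n R k i = hedge n R a k" using hedge_swap[of k a] by simp
    then show ?thesis using 1[of b a k] assms by simp
  qed
qed

lemma hyperedge_eq_hedge:
  assumes "e \<in> hyperedges n R" "a \<in> e" "b \<in> e" "a \<noteq> b"
  shows "nbr n R a b" "e = hedge n R a b"
proof -
  obtain k i where "e = hedge n R k i" using assms by (auto simp: hyperedges_def)
  then show "nbr n R a b" "e = hedge n R a b"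
    using hedge_nbr[of a k i b] hedge_eq[of a k i b] assms(2-4) by auto
qed

lemma hyperedges_eqI:
  assumes "e \<in> hyperedges n R" "e' \<in> hyperedges n R" "a \<in> e" "b \<in> e" "a \<in> e'" "b \<in> e'" "a \<noteq> b"
  shows "e = e'"
  using hyperedge_eq_hedge(2)[OF assms(1,3,4,7)] hyperedge_eq_hedge(2)[OF assms(2,5,6,7)] by simp

lemma hedge_in: "nbr n R a b \<Longrightarrow> hedge n R a b \<in> hyperedges n R"
  unfolding hyperedges_def nbr_def by blast

lemma hyperedge_two:
  assumes "e \<in> hyperedges n R" obtains a b where "a \<in> e" "b \<in> e" "a \<noteq> b" "nbr n R a b" "e = hedge n R a b"
proof -
  obtain k i where e: "e = hedge n R k i" "k \<le> n" "i \<le> n" "i \<noteq> k" using assms by (auto simp: hyperedges_def)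
  have "toward n R k i \<in> e" using e toward(1)[of k i] toward_R[of k i] sm by (auto simp: hedge_def)
  moreover have "k \<in> e" "toward n R k i \<noteq> k" using e toward(1)[of k i] by (auto simp: hedge_def nbr_def)
  ultimately show ?thesis
    using that[of k "toward n R k i"] hyperedge_eq_hedge[OF assms, of k "toward n R k i"] by metis
qed

lemma hyperedge_subset: "e \<in> hyperedges n R \<Longrightarrow> e \<subseteq> {0..n}"
  unfolding hyperedges_def hedge_def nbr_def by auto

lemma finite_hyperedges: "finite (hyperedges n R)"
  by (rule finite_subset[of _ "Pow {0..n}"]) (use hyperedge_subset in auto)

lemma hyperedge_mem_nbr:
  assumes "e \<in> hyperedges n R" "a \<in> e" "b \<in> e" "a \<noteq> b" "nbr n R a c" "nbr n R b c"
  shows "c \<in> e"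
proof -
  have e: "nbr n R a b" "e = hedge n R a b" using hyperedge_eq_hedge[OF assms(1-4)] by auto
  have "R a b c" using assms(6,5) e(1) by (auto simp: nbr_def)
  then show ?thesis using e assms by (auto simp: hedge_def)
qed

lemma hedge_mem_R:
  assumes "e \<in> hyperedges n R" "a \<in> e" "b \<in> e" "c \<in> e" "a \<noteq> b" "a \<noteq> c"
  shows "R a b c"
proof (cases "b = c")
  case True
  have "a \<le> n" "c \<le> n" using assms hyperedge_subset[OF assms(1)] by auto
  then show ?thesis using assms rfl[of a c] True by auto
next
  case False
  then have "nbr n R b c" using hyperedge_eq_hedge(1)[OF assms(1,3,4)] by auto
  then show ?thesis using assms hyperedge_subset[OF assms(1)] unfolding nbr_def by auto
qed

text \<open>\<open>p\<close> is the member of \<open>f\<close> nearest to a point \<open>z0\<close>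
  of \<open>f'\<close> outside \<open>f\<close>. If another member lay on the same side of
  \<open>p\<close> as \<open>z0\<close>, the first vertex from \<open>p\<close> towards
  \<open>z0\<close> would belong to \<open>f\<close> and be nearer.\<close>

lemma hyperedge_gate:
  assumes "f \<in> hyperedges n R" "f' \<in> hyperedges n R" "f \<noteq> f'"
  obtains p where "p \<in> f" "\<And>q z. q \<in> f \<Longrightarrow> z \<in> f' \<Longrightarrow> q \<noteq> p \<Longrightarrow> z \<noteq> p \<Longrightarrow> \<not> R p q z"
proof -
  obtain a b where ab: "a \<in> f'" "b \<in> f'" "a \<noteq> b" using hyperedge_two[OF assms(2)] by metis
  obtain z0 where z0: "z0 \<in> f'" "z0 \<notin> f"
    using ab hyperedges_eqI[OF assms(1,2), of a b] assms(3) by blast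
  have fin: "finite f" using hyperedge_subset[OF assms(1)] finite_subset by blast
  have fne: "f \<noteq> {}" using assms(1) by (auto simp: hyperedges_def hedge_def)
  obtain p where p: "p \<in> f" "\<And>x. x \<in> f \<Longrightarrow> card (btw n R p z0) \<le> card (btw n R x z0)"
    using arg_min_if_finite[OF fin fne, of "\<lambda>x. card (btw n R x z0)"] by (meson linorder_not_less)
  have le: "p \<le> n" "z0 \<le> n"
    using p(1) z0(1) hyperedge_subset[OF assms(1)] hyperedge_subset[OF assms(2)] by auto
  have pz: "p \<noteq> z0" using p z0 by auto
  have no: "\<not> R p q z0" if q: "q \<in> f" "q \<noteq> p" for q
  proof
    assume r: "R p q z0"
    define a where "a = toward n R p z0"
    have a: "nbr n R p a" "a = z0 \<or> a \<in> btw n R p z0" "R p a z0"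
      using toward[of p z0] toward_R[of p z0] le pz by (auto simp: a_def)
    have "R p q a" using r a sm trn by blast
    then have "a \<in> hedge n R p q" using a by (auto simp: hedge_def)
    then have af: "a \<in> f" using hyperedge_eq_hedge(2)[OF assms(1) p(1) q(1)] q by auto
    then have "a \<in> btw n R p z0" using a z0 by auto
    then show False using btw_card_less(2)[of a p z0] p(2)[OF af] le by auto
  qed
  show ?thesis
  proof (rule that[OF p(1)])
    fix q z assume a: "q \<in> f" "z \<in> f'" "q \<noteq> p" "z \<noteq> p"
    have "R p z z0"
    proof (cases "z = z0")
      case True then show ?thesis using rfl[of p z0] le pz by auto
    next
      case False
      then have "nbr n R z z0" using hyperedge_eq_hedge(1)[OF assms(2) a(2) z0(1)] by auto
      then show ?thesis using a le pz by (auto simp: nbr_def)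
    qed
    then show "\<not> R p q z" using no[OF a(1,3)] trn by blast
  qed
qed

end

section \<open>Comparison of a tree with a refinement\<close>

text \<open>The coarse relation \<open>R\<close> belongs to the smaller tree of the order:
  forgetting separations merges hyperedges, which folds edges at labelled vertices.\<close>

locale sep_refine = c: sep_family n R + f: sep_family n R'
  for n R R' +
  assumes finer: "R' k i j \<Longrightarrow> R k i j"
begin

lemma nbr_coarse: "nbr n R' i j \<Longrightarrow> nbr n R i j"
  unfolding nbr_def using finer by blast

lemma btw_coarse: "btw n R i j \<subseteq> btw n R' i j"
  unfolding btw_def using finer by blast

lemma hedge_coarse: "hedge n R' i j \<subseteq> hedge n R i j"
  unfolding hedge_def using finer nbr_coarse by blast

text \<open>The fine path between two neighbours of the coarse tree therefore runs inside their
  coarse hyperedge, by \<open>hyperedge_mem_nbr\<close>.\<close>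

lemma btw_fine_nbr:
  assumes "nbr n R i j" "k \<in> btw n R' i j"
  shows "nbr n R k i" "nbr n R k j"
proof -
  have ij: "i \<le> n" "j \<le> n" "i \<noteq> j" using assms by (auto simp: nbr_def)
  have k: "k \<le> n" "k \<noteq> i" "k \<noteq> j" "\<not> R' k i j" using assms by (auto simp: btw_def)
  have main: "R l k i" if l: "l \<le> n" "l \<noteq> k" "l \<noteq> i" for l
  proof (cases "l = j")
    case True
    then show ?thesis using f.compat[of k l i] k ij finer[of l i k] c.sm l by blast
  next
    case False
    show ?thesis
    proof (rule ccontr)
      assume a: "\<not> R l k i"
      have "R l i j" using assms(1) l False by (auto simp: nbr_def)
      then have "\<not> R l k j" using a c.trn c.sm by blast
      then have "\<not> R' l i k" "\<not> R' l j k" using a finer c.sm by blast+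
      then have "R' k i l" "R' k j l" using f.compat[of k l i] f.compat[of k l j] k ij l False by blast+
      then show False using k f.trn f.sm by blast
    qed
  qed
  show ki: "nbr n R k i" using main k ij unfolding nbr_def by auto
  have "R l k j" if l: "l \<le> n" "l \<noteq> k" "l \<noteq> j" for l
  proof (cases "l = i")
    case True
    then show ?thesis using f.compat[of k l j] k ij finer[of l j k] c.sm f.sm l by blast
  next
    case False
    then show ?thesis using main[of l] assms(1) l c.trn unfolding nbr_def by blast
  qed
  then show "nbr n R k j" using k ij unfolding nbr_def by auto
qed

text \<open>Follow the fine path from \<open>i\<close> to \<open>j\<close>, which stays in
  \<open>e\<close>: the colour has to change between two fine neighbours. Later \<open>col\<close>
  is the side of an edge of the Bass--Serre tree.\<close>

lemma bichromatic_refine: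
  assumes "e \<in> hyperedges n R" "i \<in> e" "j \<in> e" "col i \<noteq> col j"
  shows "\<exists>f\<in>hyperedges n R'. f \<subseteq> e \<and> (\<exists>a\<in>f. \<exists>b\<in>f. col a \<noteq> col b)"
  using assms(2-)
proof (induction "card (btw n R' i j)" arbitrary: i j rule: less_induct)
  case less
  have le: "i \<le> n" "j \<le> n" using less.prems c.hyperedge_subset[OF assms(1)] by auto
  have ne: "i \<noteq> j" using less.prems by auto
  have ij: "nbr n R i j" "e = hedge n R i j" using c.hyperedge_eq_hedge[OF assms(1) less.prems(1,2) ne] by simp_all
  show ?case
  proof (cases "btw n R' i j = {}")
    case True
    then have "nbr n R' i j" using f.nbr_iff_btw le ne by auto
    then show ?thesis using f.hedge_in f.hedge_nbr_mem[of i j] hedge_coarse[of i j] ij(2) less.prems by blast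
  next
    case False
    then obtain k where k: "k \<in> btw n R' i j" by auto
    have "k \<in> e" using c.hyperedge_mem_nbr[OF assms(1) less.prems(1,2) ne] btw_fine_nbr[OF ij(1) k] c.nbr_sym by auto
    then show ?thesis
      using less.hyps[OF f.btw_card_less(1)[OF k le]] less.hyps[OF f.btw_card_less(2)[OF k le]] less.prems
      by (cases "col i = col k") auto
  qed
qed

lemma hyperedge_coarse:
  assumes "f \<in> hyperedges n R'"
  obtains e where "e \<in> hyperedges n R" "f \<subseteq> e"
proof -
  obtain a b where "nbr n R' a b" "f = hedge n R' a b" using f.hyperedge_two[OF assms] by metis
  then show ?thesis using that[of "hedge n R a b"] hedge_coarse nbr_coarse c.hedge_in by blast
qed

lemma toward_coarse:
  assumes "k \<le> n" "i \<le> n" "i \<noteq> k"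
  shows "toward n R' k (toward n R k i) = toward n R' k i"
  using c.toward(2)[OF assms]
proof
  assume "toward n R k i \<in> btw n R k i"
  then show ?thesis using f.toward_btw[of _ k i] btw_coarse assms by blast
qed simp

end

section \<open>Trees as separation relations, and back\<close>

definition psep :: "nat \<Rightarrow> nat set set \<Rightarrow> nat \<Rightarrow> nat \<Rightarrow> nat \<Rightarrow> bool" where
  "psep n E k i j \<longleftrightarrow> k \<le> n \<and> i \<in> {0..n} - {k} \<and> j \<in> {0..n} - {k} \<and>
     conn_in (tree_verts n E - {Inl k}) (tree_adj E) (Inl i) (Inl j)"

lemma conn_refl: "conn_in V R x x"
  by (simp add: conn_in_def)

lemma conn_trans: "conn_in V R x y \<Longrightarrow> conn_in V R y z \<Longrightarrow> conn_in V R x z"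
  by (simp add: conn_in_def)

lemma conn_edge: "x \<in> V \<Longrightarrow> y \<in> V \<Longrightarrow> R x y \<Longrightarrow> conn_in V R x y"
  by (auto simp: conn_in_def)

lemma conn_step: "conn_in V R x y \<Longrightarrow> y \<in> V \<Longrightarrow> z \<in> V \<Longrightarrow> R y z \<Longrightarrow> conn_in V R x z"
  using conn_trans conn_edge by metis

lemma conn_mono:
  assumes "conn_in V R u v"
    and "\<And>x y. x \<in> V \<Longrightarrow> y \<in> V \<Longrightarrow> R x y \<Longrightarrow> x \<in> V' \<and> y \<in> V' \<and> R' x y"
  shows "conn_in V' R' u v"
  using assms(1) unfolding conn_in_def
  by (rule rtranclp_mono[THEN predicate2D, rotated]) (use assms(2) in auto)

lemma conn_sym:
  assumes "conn_in V R u v" "\<And>x y. R x y \<Longrightarrow> R y x"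
  shows "conn_in V R v u"
  using assms(1) unfolding conn_in_def
proof (induction rule: rtranclp_induct)
  case (step y z)
  then show ?case using assms(2) converse_rtranclp_into_rtranclp[of "\<lambda>x y. x \<in> V \<and> y \<in> V \<and> R x y" z y u] by blast
qed simp

lemma conn_mem: "conn_in V R x y \<Longrightarrow> x \<noteq> y \<Longrightarrow> x \<in> V \<and> y \<in> V"
  unfolding conn_in_def by (metis (mono_tags, lifting) converse_rtranclpE rtranclp.cases)

lemma conn_induct [consumes 1, case_names base step]:
  assumes "conn_in V R x y" "P x"
    and "\<And>y z. conn_in V R x y \<Longrightarrow> y \<in> V \<Longrightarrow> z \<in> V \<Longrightarrow> R y z \<Longrightarrow> P y \<Longrightarrow> P z"
  shows "P y"
  using assms(1) unfolding conn_in_def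
  by (induction rule: rtranclp_induct) (use assms(2,3) in \<open>auto simp: conn_in_def\<close>)

lemma conn_leave:
  assumes "conn_in V R x y" "x \<noteq> y"
  shows "\<exists>z\<in>V. R x z \<and> conn_in (V - {x}) R z y"
proof -
  have "x = y \<or> (\<exists>z\<in>V. R x z \<and> conn_in (V - {x}) R z y)"
    using assms(1)
  proof (induction rule: conn_induct)
    case (step y z)
    show ?case
    proof (cases "y = x \<or> z = x")
      \<comment> \<open>When the walk leaves or re-enters \<open>x\<close>, everything before this
        moment is dropped.\<close>
      case True
      then show ?thesis using step conn_refl by metis
    next
      case False
      then show ?thesis using step conn_step[of "V - {x}" R _ y z] by blast
    qed
  qed simp
  then show ?thesis using assms by auto
qed

lemma tree_adj_sym: "tree_adj E x y \<Longrightarrow> tree_adj E y x"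
  by (auto simp: tree_adj_def)

lemma tree_adj_Inl: "tree_adj E (Inl i) y \<longleftrightarrow> (\<exists>e\<in>E. i \<in> e \<and> y = Inr e)"
  by (auto simp: tree_adj_def)

lemma tree_adj_Inr: "tree_adj E (Inr e) y \<longleftrightarrow> e \<in> E \<and> (\<exists>i\<in>e. y = Inl i)"
  by (auto simp: tree_adj_def)

lemma Inl_tree_verts [simp]: "Inl i \<in> tree_verts n E \<longleftrightarrow> i \<le> n"
  by (auto simp: tree_verts_def)

lemma Inr_tree_verts [simp]: "Inr e \<in> tree_verts n E \<longleftrightarrow> e \<in> E"
  by (auto simp: tree_verts_def)

text \<open>For \<open>compat\<close>, walk from \<open>i\<close> until the first of
  \<open>k\<close> and \<open>l\<close> is met. For \<open>root\<close>, removing the leaf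
  \<open>*\<close> does not disconnect the tree.\<close>

lemma pl_tree_sep_family:
  assumes E: "pl_tree n E"
  shows "sep_family n (psep n E)"
proof
  let ?V = "tree_verts n E" and ?A = "tree_adj E"
  have con: "conn_in ?V ?A u v" if "u \<in> ?V" "v \<in> ?V" for u v
    using E that by (auto simp: pl_tree_def is_tree_def)
  show "psep n E k i j \<Longrightarrow> k \<le> n \<and> i \<le> n \<and> j \<le> n \<and> i \<noteq> k \<and> j \<noteq> k" for k i j
    by (auto simp: psep_def)
  show "k \<le> n \<Longrightarrow> i \<le> n \<Longrightarrow> i \<noteq> k \<Longrightarrow> psep n E k i i" for k i
    by (auto simp: psep_def conn_refl)
  show "psep n E k i j \<Longrightarrow> psep n E k j i" for k i j
    using conn_sym[OF _ tree_adj_sym] by (auto simp: psep_def)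
  show "psep n E k i j \<Longrightarrow> psep n E k j l \<Longrightarrow> psep n E k i l" for k i j l
    using conn_trans unfolding psep_def by metis
  show "psep n E k i l \<or> psep n E l i k"
    if h: "k \<le> n" "l \<le> n" "i \<le> n" "k \<noteq> l" "i \<noteq> k" "i \<noteq> l" for k l i
  proof -
    \<comment> \<open>Either neither \<open>k\<close> nor \<open>l\<close> has been met so far, or
      the one met first was reached without passing through the other.\<close>
    let ?P = "\<lambda>y. conn_in (?V - {Inl k, Inl l}) ?A (Inl i) y \<or> conn_in (?V - {Inl k}) ?A (Inl i) (Inl l)
        \<or> conn_in (?V - {Inl l}) ?A (Inl i) (Inl k)"
    have "?P y" if "conn_in ?V ?A (Inl i) y" for y
      using that
    proof (induction rule: conn_induct)
      case base then show ?case by (simp add: conn_refl)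
    next
      case (step y z)
      show ?case
      proof (cases "conn_in (?V - {Inl k, Inl l}) ?A (Inl i) y")
        case True
        have y: "y \<notin> {Inl k, Inl l}"
          using conn_mem[OF True] h by (cases "y = Inl i") auto
        have m: "conn_in (?V - {Inl k}) ?A (Inl i) y" "conn_in (?V - {Inl l}) ?A (Inl i) y"
          using conn_mono[OF True] by auto
        show ?thesis
        proof (cases "z \<in> {Inl k, Inl l}")
          case True
          then show ?thesis
          proof
            assume "z = Inl k"
            then have "conn_in (?V - {Inl l}) ?A (Inl i) (Inl k)"
              using y step(2,3,4) h by (intro conn_step[OF m(2)]) simp_all
            then show ?thesis by blast
          next
            assume "z \<in> {Inl l}"
            then have "conn_in (?V - {Inl k}) ?A (Inl i) (Inl l)"
              using y step(2,3,4) h by (intro conn_step[OF m(1)]) simp_all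
            then show ?thesis by blast
          qed
        next
          case False
          then have "conn_in (?V - {Inl k, Inl l}) ?A (Inl i) z"
            using conn_step[OF True, of z] step(2,3,4) y by auto
          then show ?thesis by blast
        qed
      qed (use step in auto)
    qed
    from this[of "Inl k"] con[of "Inl i" "Inl k"] h have "?P (Inl k)" by simp
    moreover have "\<not> conn_in (?V - {Inl k, Inl l}) ?A (Inl i) (Inl k)"
      using conn_mem[of "?V - {Inl k, Inl l}" ?A "Inl i" "Inl k"] h by auto
    ultimately show ?thesis using h by (auto simp: psep_def)
  qed
  show "psep n E 0 i j" if h: "i \<le> n" "j \<le> n" "i \<noteq> 0" "j \<noteq> 0" for i j
  proof -
    obtain e0 where e0: "{e\<in>E. (0::nat) \<in> e} = {e0}"
      using E unfolding pl_tree_def by (metis card_1_singletonE)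
    let ?W = "?V - {Inl 0}"
    \<comment> \<open>While the walk sits at the leaf \<open>0\<close>, the recorded position is its
      only neighbour \<open>e0\<close>, so visits to \<open>0\<close> can be cut out.\<close>
    let ?P = "\<lambda>y. if y = Inl 0 then conn_in ?W ?A (Inl i) (Inr e0) else conn_in ?W ?A (Inl i) y"
    have "conn_in ?V ?A (Inl i) (Inl j)" using con h by auto
    then have "?P (Inl j)"
    proof (induction rule: conn_induct)
      case base then show ?case using h by (simp add: conn_refl)
    next
      case (step y z)
      consider "y = Inl 0" | "y \<noteq> Inl 0" "z = Inl 0" | "y \<noteq> Inl 0" "z \<noteq> Inl 0" by blast
      then show ?case
      proof cases
        case 1
        then have "z = Inr e0" using step(4) e0 by (auto simp: tree_adj_Inl)
        then show ?thesis using step(5) 1 by auto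
      next
        case 2
        then have "tree_adj E (Inl 0) y" using step(4) tree_adj_sym by auto
        then have "y = Inr e0" using e0 by (auto simp: tree_adj_Inl)
        then show ?thesis using step(5) 2 by auto
      next
        case 3
        then show ?thesis using step conn_step[of ?W ?A "Inl i" y z] by auto
      qed
    qed
    then show ?thesis using h by (auto simp: psep_def)
  qed
qed

lemma pl_tree_hyperedges:
  assumes E: "pl_tree n E"
  shows "hyperedges n (psep n E) = E"
proof -
  let ?R = "psep n E"
  let ?V = "tree_verts n E" and ?A = "tree_adj E"
  interpret sep_family n ?R using pl_tree_sep_family[OF E] .
  have con: "conn_in ?V ?A u v" if "u \<in> ?V" "v \<in> ?V" for u v
    using E that by (auto simp: pl_tree_def is_tree_def)
  have cut: "\<not> conn_in ?V (\<lambda>x y. ?A x y \<and> {x, y} \<noteq> {Inl i, Inr e}) (Inl i) (Inr e)"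
    if "e \<in> E" "i \<in> e" "i \<le> n" for i e
    using E that by (auto simp: pl_tree_def is_tree_def tree_adj_def)
  have sub: "e \<subseteq> {0..n}" "2 \<le> card e" if "e \<in> E" for e
    using E that by (auto simp: pl_tree_def)
  have path: "?R k i j" if "e \<in> E" "i \<in> e" "j \<in> e" "k \<le> n" "k \<noteq> i" "k \<noteq> j" for e i j k
  proof -
    have le: "i \<le> n" "j \<le> n" using sub[OF that(1)] that by auto
    have "conn_in (?V - {Inl k}) ?A (Inl i) (Inr e)"
      by (rule conn_edge) (use that le in \<open>auto simp: tree_adj_def\<close>)
    moreover have "conn_in (?V - {Inl k}) ?A (Inr e) (Inl j)"
      by (rule conn_edge) (use that le in \<open>auto simp: tree_adj_def\<close>)
    ultimately have "conn_in (?V - {Inl k}) ?A (Inl i) (Inl j)" by (rule conn_trans)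
    then show ?thesis using that le by (auto simp: psep_def)
  qed
  have a: "nbr n ?R i j" if "e \<in> E" "i \<in> e" "j \<in> e" "i \<noteq> j" for e i j
    using path[OF that(1-3)] sub(1)[OF that(1)] that unfolding nbr_def by auto
  \<comment> \<open>If no vertex joins \<open>i\<close> and \<open>j\<close>, the path between them
    passes through some \<open>e\<close> and then a label \<open>k\<close> with
    \<open>k \<noteq> j\<close>. As \<open>k\<close> does not separate \<open>i\<close> from
    \<open>j\<close>, a detour around \<open>k\<close> closes a cycle through the edge from
    \<open>k\<close> to \<open>e\<close>.\<close>
  have b: "\<exists>e\<in>E. i \<in> e \<and> j \<in> e" if ij: "nbr n ?R i j" for i j
  proof (rule ccontr)
    assume no: "\<not> (\<exists>e\<in>E. i \<in> e \<and> j \<in> e)"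
    have le: "i \<le> n" "j \<le> n" "i \<noteq> j" using ij by (auto simp: nbr_def)
    have "conn_in ?V ?A (Inl i) (Inl j)" using con le by auto
    from conn_leave[OF this] le obtain e where e: "e \<in> E" "i \<in> e"
      "conn_in (?V - {Inl i}) ?A (Inr e) (Inl j)" by (auto simp: tree_adj_Inl)
    from conn_leave[OF e(3)] obtain z where z: "z \<in> ?V - {Inl i}" "?A (Inr e) z"
      "conn_in (?V - {Inl i} - {Inr e}) ?A z (Inl j)" by blast
    then obtain k where zk: "z = Inl k" "k \<in> e" by (auto simp: tree_adj_Inr)
    then have k: "k \<in> e" "k \<le> n" "k \<noteq> i"
      "conn_in (?V - {Inl i} - {Inr e}) ?A (Inl k) (Inl j)" using z by auto
    have kj: "k \<noteq> j" using no e k by auto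
    have "?R k i j" using ij k kj by (auto simp: nbr_def)
    then have 1: "conn_in (?V - {Inl k}) ?A (Inl i) (Inl j)" by (simp add: psep_def)
    let ?B = "\<lambda>x y. ?A x y \<and> {x, y} \<noteq> {Inl k, Inr e}"
    have Bsym: "?B x y \<Longrightarrow> ?B y x" for x y using tree_adj_sym by (auto simp: insert_commute)
    have "conn_in ?V ?B (Inl k) (Inl j)" using conn_mono[OF k(4)] by (auto simp: doubleton_eq_iff)
    moreover have "conn_in ?V ?B (Inl j) (Inl i)"
      by (rule conn_sym[OF conn_mono[OF 1] Bsym]) (auto simp: doubleton_eq_iff)
    moreover have "conn_in ?V ?B (Inl i) (Inr e)"
      by (rule conn_edge) (use e k le in \<open>auto simp: tree_adj_def doubleton_eq_iff\<close>)
    ultimately have "conn_in ?V ?B (Inl k) (Inr e)" by (rule conn_trans[OF conn_trans])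
    then show False using cut[OF e(1) k(1,2)] by simp
  qed
  have c: "e = hedge n ?R i j" if h: "e \<in> E" "i \<in> e" "j \<in> e" "i \<noteq> j" for e i j
  proof
    have le: "i \<le> n" "j \<le> n" using sub[OF h(1)] h by auto
    show "e \<subseteq> hedge n ?R i j" using a[OF h(1,2)] path[OF h(1) h(3)] le h by (auto simp: hedge_def)
    show "hedge n ?R i j \<subseteq> e"
    proof
      \<comment> \<open>A label of the hyperedge outside \<open>e\<close> would be joined to
        \<open>i\<close> by a second vertex \<open>e2\<close> and to \<open>j\<close> by a path
        avoiding \<open>i\<close>, which closes a cycle through the edge from \<open>i\<close> to
        \<open>e\<close>.\<close>
      fix l assume l: "l \<in> hedge n ?R i j"
      show "l \<in> e"
      proof (rule ccontr)
        assume nl: "l \<notin> e"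
        then have "l \<noteq> i" using h by auto
        then have l': "nbr n ?R i l" "?R i j l" using l by (auto simp: hedge_def)
        obtain e2 where e2: "e2 \<in> E" "i \<in> e2" "l \<in> e2" using b[OF l'(1)] by auto
        have ln: "l \<le> n" using l' by (auto simp: nbr_def)
        let ?B = "\<lambda>x y. ?A x y \<and> {x, y} \<noteq> {Inl i, Inr e}"
        have Bsym: "?B x y \<Longrightarrow> ?B y x" for x y using tree_adj_sym by (auto simp: insert_commute)
        have ne: "e2 \<noteq> e" using e2 nl by auto
        have "conn_in ?V ?B (Inl i) (Inr e2)"
          by (rule conn_edge) (use e2 ne le in \<open>auto simp: tree_adj_def doubleton_eq_iff\<close>)
        moreover have "conn_in ?V ?B (Inr e2) (Inl l)"
          by (rule conn_edge) (use e2 ne ln in \<open>auto simp: tree_adj_def doubleton_eq_iff\<close>)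
        moreover have "conn_in (?V - {Inl i}) ?A (Inl j) (Inl l)" using l' by (simp add: psep_def)
        then have "conn_in ?V ?B (Inl l) (Inl j)"
          by (rule conn_sym[OF conn_mono Bsym]) (auto simp: doubleton_eq_iff)
        moreover have "conn_in ?V ?B (Inl j) (Inr e)"
          by (rule conn_edge) (use h le in \<open>auto simp: tree_adj_def doubleton_eq_iff\<close>)
        ultimately have "conn_in ?V ?B (Inl i) (Inr e)" by (rule conn_trans[OF conn_trans[OF conn_trans]])
        then show False using cut[OF h(1,2) le(1)] by simp
      qed
    qed
  qed
  show ?thesis
  proof
    show "E \<subseteq> hyperedges n ?R"
    proof
      fix e assume e: "e \<in> E"
      then obtain i j where ij: "i \<in> e" "j \<in> e" "i \<noteq> j"
        using sub(2)[OF e] card_2_iff' obtain_subset_with_card_n[OF sub(2)[OF e]] by (metis subsetD)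
      then show "e \<in> hyperedges n ?R" using c[OF e ij] hedge_in[OF a[OF e ij]] by simp
    qed
    show "hyperedges n ?R \<subseteq> E"
    proof
      fix e assume e: "e \<in> hyperedges n ?R"
      obtain i j where ij: "i \<in> e" "j \<in> e" "i \<noteq> j" "nbr n ?R i j" "e = hedge n ?R i j"
        using hyperedge_two[OF e] by metis
      obtain e' where e': "e' \<in> E" "i \<in> e'" "j \<in> e'" using b[OF ij(4)] by auto
      then show "e \<in> E" using c[OF e' ij(3)] ij by simp
    qed
  qed
qed

lemma pl_tree_eqI:
  assumes "pl_tree n E" "pl_tree n E'" "psep n E = psep n E'"
  shows "E = E'"
  using assms pl_tree_hyperedges by metis

text \<open>Acyclicity is the delicate point: after an edge from \<open>i\<close> to
  \<open>e\<close> is removed, every other label reachable from \<open>i\<close> is separated by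
  \<open>i\<close> from another member \<open>j\<close> of \<open>e\<close>.\<close>

lemma (in sep_family) pl_tree_of_sep:
  assumes n: "1 \<le> n"
  shows "pl_tree n (hyperedges n R)" "psep n (hyperedges n R) = R"
proof -
  let ?E = "hyperedges n R"
  let ?V = "tree_verts n ?E" and ?A = "tree_adj ?E"
  \<comment> \<open>\<open>K\<close> is a set of labels to be avoided: empty for connectedness, a
    singleton for the comparison with \<open>psep\<close>.\<close>
  have path: "conn_in (?V - Inl ` K) ?A (Inl i) (Inl j)"
    if "i \<le> n" "j \<le> n" "i \<notin> K" "j \<notin> K" "\<And>k. k \<in> K \<Longrightarrow> R k i j" for K i j
    using that
  proof (induction "card (btw n R i j)" arbitrary: i j rule: less_induct)
    case less
    show ?case
    proof (cases "i = j \<or> nbr n R i j")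
      case True
      then show ?thesis
      proof
        assume "nbr n R i j"
        then have e: "hedge n R i j \<in> ?E" "i \<in> hedge n R i j" "j \<in> hedge n R i j"
          using hedge_in hedge_nbr_mem by auto
        have "conn_in (?V - Inl ` K) ?A (Inl i) (Inr (hedge n R i j))"
          by (rule conn_edge) (use e less.prems in \<open>auto simp: tree_adj_def\<close>)
        moreover have "conn_in (?V - Inl ` K) ?A (Inr (hedge n R i j)) (Inl j)"
          by (rule conn_edge) (use e less.prems in \<open>auto simp: tree_adj_def\<close>)
        ultimately show ?thesis by (rule conn_trans)
      qed (simp add: conn_refl)
    next
      case False
      then obtain l where l: "l \<in> btw n R i j" using nbr_iff_btw[of i j] less.prems by auto
      then have ln: "l \<le> n" "l \<notin> K" using less.prems(5)[of l] by (auto simp: btw_def)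
      have kk: "R k i l \<and> R k l j" if k: "k \<in> K" for k
      proof -
        have ij: "R k i j" using less.prems(5)[OF k] .
        have "R k i l"
        proof (rule ccontr)
          assume "\<not> R k i l"
          then have "k \<in> btw n R i l" using dom[OF ij] ln k by (auto simp: btw_def)
          then have "k \<in> btw n R i j" using btw_psubset[OF l] less.prems by auto
          then show False using ij by (auto simp: btw_def)
        qed
        then show ?thesis using ij sm trn by blast
      qed
      have "conn_in (?V - Inl ` K) ?A (Inl i) (Inl l)"
        by (rule less.hyps[OF btw_card_less(1)[OF l]]) (use less.prems ln kk in auto)
      moreover have "conn_in (?V - Inl ` K) ?A (Inl l) (Inl j)"
        by (rule less.hyps[OF btw_card_less(2)[OF l]]) (use less.prems ln kk in auto)
      ultimately show ?thesis by (rule conn_trans)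
    qed
  qed
  have con: "conn_in ?V ?A (Inl i) (Inl j)" if "i \<le> n" "j \<le> n" for i j
    using path[of i j "{}"] that by auto
  have conn0: "\<exists>i\<le>n. conn_in ?V ?A (Inl i) u" if "u \<in> ?V" for u
  proof (cases u)
    case (Inl i)
    then have "i \<le> n" using that by simp
    then show ?thesis using Inl conn_refl[of ?V ?A "Inl i"] by blast
  next
    case (Inr e)
    then have e: "e \<in> ?E" using that by auto
    obtain a b where ab: "a \<in> e" using hyperedge_two[OF e] by metis
    have an: "a \<le> n" using ab hyperedge_subset[OF e] by auto
    have "conn_in ?V ?A (Inl a) u"
      by (rule conn_edge) (use e ab an Inr in \<open>auto simp: tree_adj_def\<close>)
    then show ?thesis using an by auto
  qed
  have connected: "conn_in ?V ?A u v" if uv: "u \<in> ?V" "v \<in> ?V" for u v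
  proof -
    obtain i j where "i \<le> n" "j \<le> n" "conn_in ?V ?A (Inl i) u" "conn_in ?V ?A (Inl j) v"
      using conn0[OF uv(1)] conn0[OF uv(2)] by blast
    note ij = this
    show ?thesis
      by (rule conn_trans[OF conn_trans[OF conn_sym[OF ij(3) tree_adj_sym] con[OF ij(1,2)]] ij(4)])
  qed
  have cut: "\<not> conn_in ?V (\<lambda>x y. ?A x y \<and> {x, y} \<noteq> {Inl i, Inr e}) (Inl i) (Inr e)"
    if e: "e \<in> ?E" "i \<in> e" for i e
  proof
    assume c: "conn_in ?V (\<lambda>x y. ?A x y \<and> {x, y} \<noteq> {Inl i, Inr e}) (Inl i) (Inr e)"
    obtain j where j: "j \<in> e" "j \<noteq> i" using hyperedge_two[OF e(1)] by metis
    let ?P = "\<lambda>y. case y of Inl l \<Rightarrow> l = i \<or> \<not> R i l j | Inr f \<Rightarrow> f \<noteq> e \<and> (\<forall>l\<in>f. l \<noteq> i \<longrightarrow> \<not> R i l j)"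
    have "?P y" if "conn_in ?V (\<lambda>x y. ?A x y \<and> {x, y} \<noteq> {Inl i, Inr e}) (Inl i) y" for y
      using that
    proof (induction rule: conn_induct)
      case (step y z)
      show ?case
      proof (cases y)
        case (Inl l)
        then obtain f where f: "f \<in> ?E" "l \<in> f" "z = Inr f" using step(4) by (auto simp: tree_adj_Inl)
        show ?thesis
        proof (cases "l = i")
          case True
          then have ne: "f \<noteq> e" using step(4) Inl f by auto
          have "\<not> R i x j" if x: "x \<in> f" "x \<noteq> i" for x
          proof
            assume "R i x j"
            then have "R i j x" by (rule sm)
            moreover have "nbr n R i x" using hyperedge_eq_hedge(1)[OF f(1), of i x] f True x by auto
            ultimately have "x \<in> hedge n R i j" by (simp add: hedge_def)
            then have "x \<in> e" using hyperedge_eq_hedge(2)[OF e(1) e(2) j(1)] j by auto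
            then show False using hyperedges_eqI[OF f(1) e(1), of i x] f True x e ne by auto
          qed
          then show ?thesis using f ne by auto
        next
          case False
          then have l: "\<not> R i l j" using step(5) Inl by auto
          have le: "l \<notin> e" using hedge_mem_R[OF e(1,2) _ j(1)] False j l by auto
          have "\<not> R i x j" if x: "x \<in> f" "x \<noteq> i" for x
          proof -
            have "i \<le> n" using e hyperedge_subset[OF e(1)] by auto
            have "R i l x"
            proof (cases "l = x")
              case True
              then show ?thesis using rfl[of i l] False f hyperedge_subset[OF f(1)] \<open>i \<le> n\<close> by auto
            next
              case xl: False
              then have "nbr n R l x" using hyperedge_eq_hedge(1)[OF f(1,2) x(1)] by auto
              then show ?thesis using False x \<open>i \<le> n\<close> by (auto simp: nbr_def)
            qed
            then show ?thesis using l trn by blast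
          qed
          then show ?thesis using f le by auto
        qed
      next
        case (Inr f)
        then obtain l where "l \<in> f" "z = Inl l" using step(4) by (auto simp: tree_adj_Inr)
        then show ?thesis using step(5) Inr by auto
      qed
    qed auto
    from this[OF c] show False by simp
  qed
  have tree: "is_tree ?V ?A"
    unfolding is_tree_def
  proof (intro conjI ballI impI)
    show "?V \<noteq> {}" using Inl_tree_verts[of 0 n ?E] by blast
  next
    fix u v assume uv: "u \<in> ?V" "v \<in> ?V" "?A u v"
    then obtain i e where ie: "e \<in> ?E" "i \<in> e" "u = Inl i \<and> v = Inr e \<or> u = Inr e \<and> v = Inl i"
      by (auto simp: tree_adj_def)
    let ?B = "\<lambda>x y. ?A x y \<and> {x, y} \<noteq> {Inl i, Inr e}"
    have Bsym: "?B x y \<Longrightarrow> ?B y x" for x y using tree_adj_sym by (auto simp: insert_commute)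
    show "\<not> conn_in ?V (\<lambda>x y. ?A x y \<and> {x, y} \<noteq> {u, v}) u v"
      using ie(3) cut[OF ie(1,2)] conn_sym[of ?V ?B "Inr e" "Inl i", OF _ Bsym]
      by (auto simp: insert_commute)
  qed (use connected in auto)
  have "{e \<in> ?E. 0 \<in> e} = {hedge n R 0 1}"
  proof -
    have "hedge n R 0 1 \<in> ?E" "0 \<in> hedge n R 0 1" using n by (auto simp: hyperedges_def hedge_def)
    moreover have "e = hedge n R 0 1" if e: "e \<in> ?E" "0 \<in> e" for e
    proof -
      obtain b where b: "b \<in> e" "b \<noteq> 0" using hyperedge_two[OF e(1)] by metis
      have bn: "b \<le> n" using b hyperedge_subset[OF e(1)] by auto
      have b1: "R 0 b 1" using root[of b 1] bn b(2) n by linarith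
      have "R 0 b l \<longleftrightarrow> R 0 1 l" for l using trn[OF b1, of l] trn[OF sm[OF b1], of l] by blast
      then have "hedge n R 0 b = hedge n R 0 1" unfolding hedge_def by presburger
      moreover have "e = hedge n R 0 b" using hyperedge_eq_hedge(2)[OF e(1) e(2) b(1)] b(2) by blast
      ultimately show ?thesis by (rule back_subst[of "\<lambda>x. e = x", rotated])
    qed
    ultimately show ?thesis by blast
  qed
  then have card0: "card {e \<in> ?E. 0 \<in> e} = 1" by simp
  have "2 \<le> card e" if e: "e \<in> ?E" for e
  proof -
    obtain a b where "a \<in> e" "b \<in> e" "a \<noteq> b" using hyperedge_two[OF e] by metis
    moreover have "finite e" using hyperedge_subset[OF e] finite_subset by blast
    ultimately show ?thesis using card_mono[of e "{a,b}"] by auto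
  qed
  then show "pl_tree n ?E" using hyperedge_subset tree card0 by (auto simp: pl_tree_def)
  have "psep n ?E k i j \<longleftrightarrow> R k i j" for k i j
  proof
    assume p: "psep n ?E k i j"
    then have le: "k \<le> n" "i \<le> n" "i \<noteq> k" "j \<noteq> k" by (auto simp: psep_def)
    let ?P = "\<lambda>y. case y of Inl l \<Rightarrow> R k i l | Inr f \<Rightarrow> \<forall>l\<in>f. l \<noteq> k \<longrightarrow> R k i l"
    have "conn_in (?V - {Inl k}) ?A (Inl i) (Inl j)" using p by (simp add: psep_def)
    then have "?P (Inl j)"
    proof (induction rule: conn_induct)
      case base then show ?case using rfl le by auto
    next
      case (step y z)
      show ?case
      proof (cases y)
        case (Inl l)
        then obtain f where f: "f \<in> ?E" "l \<in> f" "z = Inr f" using step(4) by (auto simp: tree_adj_Inl)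
        have l: "R k i l" "l \<noteq> k" using step(5,2) Inl by auto
        have "R k i x" if x: "x \<in> f" "x \<noteq> k" for x
        proof (cases "x = l")
          case False
          then have "nbr n R l x" using hyperedge_eq_hedge(1)[OF f(1,2) x(1)] by auto
          then have "R k l x" using l x le by (auto simp: nbr_def)
          then show ?thesis using l trn by blast
        qed (use l in simp)
        then show ?thesis using f by simp
      next
        case (Inr f)
        then obtain l where "l \<in> f" "z = Inl l" using step(4) by (auto simp: tree_adj_Inr)
        then show ?thesis using step(5,3) Inr by auto
      qed
    qed
    then show "R k i j" by simp
  next
    assume r: "R k i j"
    then show "psep n ?E k i j" using path[of i j "{k}"] dom[OF r] by (auto simp: psep_def)
  qed
  then show "psep n ?E = R" by blast
qed

section \<open>Reduced words and Whitehead automorphisms\<close>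

locale free_product = group G for G (structure) +
  fixes Hs :: "nat \<Rightarrow> 'a set" and n :: nat
  assumes ifp: "internal_free_product G Hs n"
begin

abbreviation "rw \<equiv> reduced_word G Hs n"
abbreviation "val \<equiv> word_val G"

lemma sub: "i \<in> {1..n} \<Longrightarrow> subgroup (Hs i) G"
  using ifp by (auto simp: internal_free_product_def)

lemma Hs_carrier: "i \<in> {1..n} \<Longrightarrow> h \<in> Hs i \<Longrightarrow> h \<in> carrier G"
  using sub subgroup.mem_carrier by metis

lemma bij: "bij_betw val {ws. rw ws} (carrier G)"
  using ifp by (auto simp: internal_free_product_def)

lemma rw_iff: "rw ws \<longleftrightarrow> (\<forall>p\<in>set ws. fst p \<in> {1..n} \<and> snd p \<in> Hs (fst p) - {\<one>}) \<and> distinct_adj (map fst ws)"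
  unfolding reduced_word_def distinct_adj_conv_nth all_set_conv_all_nth by auto

lemma rw_Cons: "rw (p # ws) \<longleftrightarrow> fst p \<in> {1..n} \<and> snd p \<in> Hs (fst p) - {\<one>} \<and> rw ws \<and> (ws = [] \<or> fst p \<noteq> fst (hd ws))"
  unfolding rw_iff by (cases ws) auto

lemma rw_Nil [simp]: "rw []" by (simp add: rw_iff)

definition letters :: "(nat \<times> 'a) list \<Rightarrow> bool" where
  "letters ws \<longleftrightarrow> (\<forall>p\<in>set ws. fst p \<in> {1..n} \<and> snd p \<in> Hs (fst p))"

lemma rw_letters: "rw ws \<Longrightarrow> letters ws" by (auto simp: rw_iff letters_def)

lemma val_Nil [simp]: "val [] = \<one>" by (simp add: word_val_def)
lemma val_Cons [simp]: "val (p # ws) = snd p \<otimes> val ws" by (simp add: word_val_def)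

lemma val_closed [simp]: "letters ws \<Longrightarrow> val ws \<in> carrier G"
proof (induction ws)
  case (Cons p ws)
  then have "letters ws" "snd p \<in> carrier G" using Hs_carrier[of "fst p" "snd p"] by (auto simp: letters_def)
  then show ?case using Cons by simp
qed simp

lemma val_append: "letters ws \<Longrightarrow> letters vs \<Longrightarrow> val (ws @ vs) = val ws \<otimes> val vs"
proof (induction ws)
  case (Cons p ws)
  then have "letters ws" "snd p \<in> carrier G" using Hs_carrier[of "fst p" "snd p"] by (auto simp: letters_def)
  then show ?case using Cons by (simp add: m_assoc)
qed simp

definition nf :: "'a \<Rightarrow> (nat \<times> 'a) list" where
  "nf g = the_inv_into {ws. rw ws} val g"

lemma nf: assumes "g \<in> carrier G" shows "rw (nf g)" "val (nf g) = g"
proof -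
  have "nf g \<in> {ws. rw ws}" unfolding nf_def
    by (rule the_inv_into_into) (use bij assms in \<open>auto simp: bij_betw_def\<close>)
  then show "rw (nf g)" by simp
  show "val (nf g) = g" unfolding nf_def
    by (rule f_the_inv_into_f) (use bij assms in \<open>auto simp: bij_betw_def\<close>)
qed

lemma nf_val: "rw ws \<Longrightarrow> nf (val ws) = ws"
  unfolding nf_def by (rule the_inv_into_f_f) (use bij in \<open>auto simp: bij_betw_def\<close>)

lemma nf_one [simp]: "nf \<one> = []" using nf_val[of "[]"] by simp

lemma nf_Nil: "g \<in> carrier G \<Longrightarrow> nf g = [] \<longleftrightarrow> g = \<one>"
  using nf(2)[of g] by auto

text \<open>The label of the first letter of the reduced word, and \<open>0\<close> for the identity.\<close>

definition lab :: "'a \<Rightarrow> nat" where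
  "lab z = (if nf z = [] then 0 else fst (hd (nf z)))"

lemma lab_one [simp]: "lab \<one> = 0" by (simp add: lab_def)

lemma lab_letter: assumes "i \<in> {1..n}" "a \<in> Hs i" "a \<noteq> \<one>" shows "lab a = i"
proof -
  have "rw [(i, a)]" using assms by (simp add: rw_Cons)
  moreover have "val [(i, a)] = a" using Hs_carrier assms by simp
  ultimately show ?thesis using nf_val by (force simp: lab_def)
qed

definition winv :: "(nat \<times> 'a) list \<Rightarrow> (nat \<times> 'a) list" where
  "winv ws = rev (map (\<lambda>p. (fst p, inv (snd p))) ws)"

lemma winv: assumes "rw ws" shows "rw (winv ws)" "val (winv ws) = inv (val ws)"
proof -
  have "fst p \<in> {1..n} \<and> snd p \<in> Hs (fst p) - {\<one>}" if "p \<in> set (winv ws)" for p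
  proof -
    obtain q where q: "q \<in> set ws" "p = (fst q, inv (snd q))" using \<open>p \<in> set (winv ws)\<close> by (auto simp: winv_def)
    then have f: "fst q \<in> {1..n}" "snd q \<in> Hs (fst q)" "snd q \<noteq> \<one>" using assms by (auto simp: rw_iff)
    have "inv (snd q) \<in> Hs (fst q)" using subgroup.m_inv_closed[OF sub] f by auto
    moreover have "inv (snd q) \<noteq> \<one>" using f Hs_carrier by auto
    ultimately show ?thesis using q f by auto
  qed
  moreover have "map fst (winv ws) = rev (map fst ws)" by (simp add: winv_def rev_map comp_def)
  ultimately show "rw (winv ws)" using assms by (auto simp: rw_iff)
  show "val (winv ws) = inv (val ws)" using rw_letters[OF assms]
  proof (induction ws)
    case (Cons p ws)
    then have l: "letters ws" "fst p \<in> {1..n}" "snd p \<in> Hs (fst p)" by (auto simp: letters_def)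
    then have c: "snd p \<in> carrier G" "val ws \<in> carrier G" using Hs_carrier by auto
    have lw: "letters (winv ws)" using l subgroup.m_inv_closed[OF sub] by (auto simp: letters_def winv_def)
    have lp: "letters [(fst p, inv (snd p))]" using l subgroup.m_inv_closed[OF sub] by (auto simp: letters_def)
    have "winv (p # ws) = winv ws @ [(fst p, inv (snd p))]" by (simp add: winv_def)
    then show ?case using val_append[OF lw lp] Cons.IH[OF l(1)] c by (simp add: inv_mult_group)
  qed (simp add: winv_def)
qed

text \<open>The reduced word of \<open>inv d\<close> ends with the label with which that of
  \<open>d\<close> begins, so the word of \<open>z\<close> can follow without cancellation. Together
  with \<open>lab_right_mult\<close> this carries the combinatorics of the Bass--Serre tree.\<close>

lemma lab_no_cancel:
  assumes "d \<in> carrier G" "z \<in> carrier G" "d \<noteq> \<one>" "lab d \<noteq> lab z"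
  shows "lab (inv d \<otimes> z) = lab (inv d)"
proof -
  let ?w = "winv (nf d)"
  have w: "rw ?w" "val ?w = inv d" using winv[OF nf(1)] nf(2) assms by auto
  obtain p ws where pw: "nf d = p # ws" using nf_Nil assms by (cases "nf d") auto
  have ne: "?w \<noteq> []" using pw by (simp add: winv_def)
  have last: "last (map fst ?w) = lab d" using pw by (simp add: winv_def lab_def)
  have "rw (?w @ nf z)"
  proof (cases "nf z = []")
    case False
    then have "hd (map fst (nf z)) = lab z" by (simp add: lab_def hd_map)
    then show ?thesis using w(1) nf(1)[OF assms(2)] last assms(4) ne False
      by (auto simp: rw_iff distinct_adj_append_iff)
  qed (use w in simp)
  moreover have "val (?w @ nf z) = inv d \<otimes> z"
    using val_append[OF rw_letters rw_letters] w nf assms by auto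
  ultimately have "nf (inv d \<otimes> z) = ?w @ nf z" "nf (inv d) = ?w" using nf_val w by (metis, metis)
  then show ?thesis using ne by (simp add: lab_def)
qed

lemma lab_split:
  assumes "z \<in> carrier G" "z \<noteq> \<one>"
  obtains x where "x \<in> Hs (lab z)" "x \<noteq> \<one>" "lab (inv x \<otimes> z) \<noteq> lab z"
proof -
  obtain p ws where pw: "nf z = p # ws" using nf_Nil assms by (cases "nf z") auto
  have r: "fst p \<in> {1..n}" "snd p \<in> Hs (fst p)" "snd p \<noteq> \<one>" "rw ws" "ws = [] \<or> fst p \<noteq> fst (hd ws)"
    using nf(1)[OF assms(1)] pw by (auto simp: rw_Cons)
  have l: "lab z = fst p" by (simp add: lab_def pw)
  have c: "snd p \<in> carrier G" "val ws \<in> carrier G" using r Hs_carrier rw_letters by auto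
  have "z = snd p \<otimes> val ws" using nf(2)[OF assms(1)] pw by simp
  then have "inv (snd p) \<otimes> z = val ws" using c by (simp add: inv_solve_left')
  then have "lab (inv (snd p) \<otimes> z) = (if ws = [] then 0 else fst (hd ws))" using nf_val[OF r(4)] by (simp add: lab_def)
  then have "lab (inv (snd p) \<otimes> z) \<noteq> lab z" using r l by auto
  then show ?thesis using that[of "snd p"] r l by simp
qed

text \<open>Right multiplication by a letter affects only the last syllable, so it changes the first
  label only if the word has at most one syllable. Of these cases only \<open>z = \<one>\<close>
  produces a new nonzero label.\<close>

lemma lab_right_mult:
  assumes "z \<in> carrier G" "i \<in> {1..n}" "x \<in> Hs i" "j \<noteq> 0" "lab z \<noteq> j" "lab (z \<otimes> x) = j"
  shows "z = \<one> \<and> i = j"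
proof -
  have xc: "x \<in> carrier G" using Hs_carrier assms by auto
  have "z = \<one>"
  proof (rule ccontr)
    assume nz: "z \<noteq> \<one>"
    have iz: "inv z \<in> carrier G" "inv z \<noteq> \<one>" using nz assms by auto
    show False
    proof (cases "lab (inv z) = i")
      case False
      have "x \<noteq> \<one>" using assms by auto
      then have "lab x = i" using lab_letter assms by auto
      then have "lab (inv (inv z) \<otimes> x) = lab (inv (inv z))" using lab_no_cancel[OF iz(1) xc iz(2)] False by auto
      then show ?thesis using assms by simp
    next
      case True
      obtain b where b: "b \<in> Hs i" "lab (inv b \<otimes> inv z) \<noteq> i" using lab_split[OF iz] True by metis
      have bc: "b \<in> carrier G" "inv b \<in> Hs i" using b Hs_carrier assms subgroup.m_inv_closed[OF sub] by auto
      define y where "y = inv b \<otimes> inv z"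
      have y: "y \<in> carrier G" "lab y \<noteq> i" using b bc assms by (auto simp: y_def)
      have iy: "inv y = z \<otimes> b" using bc assms by (simp add: y_def inv_mult_group)
      have zz: "z = inv y \<otimes> inv b" using bc assms by (simp add: iy m_assoc)
      have zx: "z \<otimes> x = inv y \<otimes> (inv b \<otimes> x)" using bc xc assms y by (simp add: zz m_assoc)
      have m: "inv b \<otimes> x \<in> Hs i" using subgroup.m_closed[OF sub[OF assms(2)] bc(2) assms(3)] .
      show ?thesis
      proof (cases "y = \<one>")
        case True
        have "z = inv b" "z \<otimes> x = inv b \<otimes> x" using zz zx True bc xc by auto
        moreover have "inv b \<noteq> \<one>" using nz calculation by simp
        ultimately show ?thesis using lab_letter[OF assms(2) bc(2)] lab_letter[OF assms(2) m] assms by (cases "inv b \<otimes> x = \<one>") auto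
      next
        case False
        have "lab (inv y \<otimes> c) = lab (inv y)" if c: "c \<in> Hs i" for c
        proof (cases "c = \<one>")
          case True then show ?thesis using y by simp
        next
          case ne: False
          then have "lab c = i" using lab_letter assms c by auto
          then show ?thesis using lab_no_cancel[OF y(1) _ False] Hs_carrier[OF assms(2) c] y by auto
        qed
        then show ?thesis using zz zx bc m assms by metis
      qed
    qed
  qed
  then show ?thesis using assms xc lab_letter[OF assms(2,3)] by (cases "x = \<one>") auto
qed

lemma gen_induct [consumes 1, case_names one mult]:
  assumes "g \<in> carrier G" "P \<one>"
    and "\<And>i h g. i \<in> {1..n} \<Longrightarrow> h \<in> Hs i \<Longrightarrow> g \<in> carrier G \<Longrightarrow> P g \<Longrightarrow> P (h \<otimes> g)"
  shows "P g"
proof -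
  have "P (val ws)" if "letters ws" for ws
    using that
  proof (induction ws)
    case (Cons p ws)
    then have "letters ws" by (auto simp: letters_def)
    then show ?case using Cons assms(3)[of "fst p" "snd p" "val ws"] by (auto simp: letters_def)
  qed (simp add: assms)
  then show ?thesis using nf[OF assms(1)] rw_letters by metis
qed

section \<open>Homomorphisms on a free product and Whitehead automorphisms\<close>

definition ext :: "(nat \<Rightarrow> 'a \<Rightarrow> 'a) \<Rightarrow> 'a \<Rightarrow> 'a" where
  "ext f g = foldr (\<lambda>p acc. f (fst p) (snd p) \<otimes> acc) (nf g) \<one>"

lemma ext_hom:
  assumes f: "\<And>i h. i \<in> {1..n} \<Longrightarrow> h \<in> Hs i \<Longrightarrow> f i h \<in> carrier G"
    and hom: "\<And>i h h'. i \<in> {1..n} \<Longrightarrow> h \<in> Hs i \<Longrightarrow> h' \<in> Hs i \<Longrightarrow> f i (h \<otimes> h') = f i h \<otimes> f i h'"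
  shows "ext f \<in> hom G G" "\<And>i h. i \<in> {1..n} \<Longrightarrow> h \<in> Hs i \<Longrightarrow> ext f h = f i h"
proof -
  let ?F = "\<lambda>ws. foldr (\<lambda>p acc. f (fst p) (snd p) \<otimes> acc) ws \<one>"
  have f1: "f i \<one> = \<one>" if "i \<in> {1..n}" for i
  proof -
    have o: "\<one> \<in> Hs i" using subgroup.one_closed[OF sub[OF that]] .
    have "f i \<one> \<otimes> f i \<one> = f i \<one>" using hom[OF that o o] by simp
    then show ?thesis using f[OF that o] by simp
  qed
  have Fc: "?F ws \<in> carrier G" if "letters ws" for ws
    using that by (induction ws) (auto simp: letters_def f)
  have ec: "ext f g \<in> carrier G" if "g \<in> carrier G" for g
    using Fc rw_letters nf(1)[OF that] by (simp add: ext_def)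
  \<comment> \<open>The letter \<open>h\<close> is prepended to the normal form of \<open>g\<close>,
    or merged into its first letter, or cancels it. Full multiplicativity then follows by induction
    on the left factor.\<close>
  have step: "ext f (h \<otimes> g) = f i h \<otimes> ext f g" if i: "i \<in> {1..n}" and h: "h \<in> Hs i" and g: "g \<in> carrier G" for i h g
  proof (cases "h = \<one>")
    case True
    then show ?thesis using f1[OF i] g ec[OF g] by simp
  next
    case hn: False
    have hc: "h \<in> carrier G" using Hs_carrier i h by auto
    show ?thesis
    proof (cases "nf g = [] \<or> fst (hd (nf g)) \<noteq> i")
      case True
      then have "rw ((i, h) # nf g)" using nf(1)[OF g] i h hn by (auto simp: rw_Cons)
      moreover have "val ((i, h) # nf g) = h \<otimes> g" using nf(2)[OF g] by simp
      ultimately have "nf (h \<otimes> g) = (i, h) # nf g" using nf_val by metis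
      then show ?thesis by (simp add: ext_def)
    next
      case False
      then obtain x ws where ws: "nf g = (i, x) # ws" by (cases "nf g") auto
      have r: "x \<in> Hs i" "x \<noteq> \<one>" "rw ws" "ws = [] \<or> i \<noteq> fst (hd ws)" using nf(1)[OF g] ws by (auto simp: rw_Cons)
      have xc: "x \<in> carrier G" "val ws \<in> carrier G" using Hs_carrier i r rw_letters by auto
      have hx: "h \<otimes> x \<in> Hs i" using subgroup.m_closed[OF sub[OF i] h r(1)] .
      have gx: "g = x \<otimes> val ws" using nf(2)[OF g] ws by simp
      have hg: "h \<otimes> g = (h \<otimes> x) \<otimes> val ws" using gx hc xc by (simp add: m_assoc)
      have fc: "f i h \<in> carrier G" "f i x \<in> carrier G" "?F ws \<in> carrier G" using f i h r Fc rw_letters by auto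
      have e: "f i h \<otimes> ext f g = f i (h \<otimes> x) \<otimes> ?F ws" using hom[OF i h r(1)] fc ws by (simp add: ext_def m_assoc)
      show ?thesis
      proof (cases "h \<otimes> x = \<one>")
        case True
        then have "h \<otimes> g = val ws" using hg xc by simp
        then have "nf (h \<otimes> g) = ws" using nf_val[OF r(3)] by simp
        then show ?thesis using e True f1[OF i] fc by (simp add: ext_def)
      next
        case False
        then have "rw ((i, h \<otimes> x) # ws)" using r i hx by (auto simp: rw_Cons)
        from nf_val[OF this] have "nf (h \<otimes> g) = (i, h \<otimes> x) # ws" using hg by simp
        then show ?thesis using e by (simp add: ext_def)
      qed
    qed
  qed
  have e1: "ext f \<one> = \<one>" by (simp add: ext_def)
  have mult: "ext f (g \<otimes> g') = ext f g \<otimes> ext f g'" if "g \<in> carrier G" "g' \<in> carrier G" for g g'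
    using that(1)
  proof (induction g rule: gen_induct)
    case one then show ?case using e1 ec that by simp
  next
    case (mult i h g)
    have hc: "h \<in> carrier G" using Hs_carrier mult by auto
    then show ?case using mult step[of i h g] step[of i h "g \<otimes> g'"] that ec f[of i h] by (simp add: m_assoc)
  qed
  show "ext f \<in> hom G G" using mult ec by (auto simp: hom_def)
  show "ext f h = f i h" if "i \<in> {1..n}" "h \<in> Hs i" for i h
    using step[OF that, of \<one>] e1 f[OF that] Hs_carrier[OF that] by simp
qed

lemma hom_eq_id:
  assumes "\<phi> \<in> hom G G" "\<And>i h. i \<in> {1..n} \<Longrightarrow> h \<in> Hs i \<Longrightarrow> \<phi> h = h" "g \<in> carrier G"
  shows "\<phi> g = g"
  using assms(3)
proof (induction g rule: gen_induct)
  case one then show ?case using assms(1) hom_one is_group by blast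
next
  case (mult i h g) then show ?case using assms(1,2) Hs_carrier by (auto simp: hom_def)
qed

text \<open>The inverse is the automorphism given by the inverse elements.\<close>

lemma whitehead_automorphism:
  assumes k: "k \<in> {1..n}" and x: "\<And>j. j \<in> {1..n} \<Longrightarrow> x j \<in> Hs k" "x k = \<one>"
  shows "\<exists>\<phi>\<in>iso G G. \<forall>j\<in>{1..n}. \<forall>h\<in>Hs j. \<phi> h = x j \<otimes> h \<otimes> inv (x j)"
proof -
  have ex: "\<exists>\<phi>\<in>hom G G. \<forall>j\<in>{1..n}. \<forall>h\<in>Hs j. \<phi> h = y j \<otimes> h \<otimes> inv (y j)"
    if y: "\<And>j. j \<in> {1..n} \<Longrightarrow> y j \<in> Hs k" for y
  proof -
    let ?f = "\<lambda>j h. y j \<otimes> h \<otimes> inv (y j)"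
    have c: "y j \<in> carrier G" if "j \<in> {1..n}" for j using y that Hs_carrier k by blast
    have 1: "?f i h \<in> carrier G" if "i \<in> {1..n}" "h \<in> Hs i" for i h
      using c Hs_carrier that by simp
    have 2: "?f i (h \<otimes> h') = ?f i h \<otimes> ?f i h'" if "i \<in> {1..n}" "h \<in> Hs i" "h' \<in> Hs i" for i h h'
    proof -
      have hc: "h \<in> carrier G" "h' \<in> carrier G" "y i \<in> carrier G" using that Hs_carrier c by auto
      have "inv (y i) \<otimes> (y i \<otimes> (h' \<otimes> inv (y i))) = h' \<otimes> inv (y i)" using hc by (simp add: m_assoc[symmetric])
      then show ?thesis using hc by (simp add: m_assoc)
    qed
    show ?thesis using ext_hom[of ?f, OF 1 2] by blast
  qed
  obtain \<phi> where p: "\<phi> \<in> hom G G" "\<forall>j\<in>{1..n}. \<forall>h\<in>Hs j. \<phi> h = x j \<otimes> h \<otimes> inv (x j)"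
    using ex[of x] x by blast
  have ixH: "inv (x j) \<in> Hs k" if "j \<in> {1..n}" for j using subgroup.m_inv_closed[OF sub[OF k]] x that by blast
  obtain \<psi> where q: "\<psi> \<in> hom G G" "\<forall>j\<in>{1..n}. \<forall>h\<in>Hs j. \<psi> h = inv (x j) \<otimes> h \<otimes> inv (inv (x j))"
    using ex[of "\<lambda>j. inv (x j)"] ixH by blast
  \<comment> \<open>Since \<open>x k = \<one>\<close>, both maps fix the factor that contains all
    the \<open>x j\<close>, so either one undoes the conjugation by the other.\<close>
  have pk: "\<phi> h = h" "\<psi> h = h" if "h \<in> Hs k" for h using p q k x that Hs_carrier by auto
  have inv1: "\<phi> (\<psi> h) = h \<and> \<psi> (\<phi> h) = h" if j: "j \<in> {1..n}" and h: "h \<in> Hs j" for j h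
  proof -
    have c: "x j \<in> carrier G" "h \<in> carrier G" using x j h k Hs_carrier by blast+
    have pp: "\<phi> (u \<otimes> h \<otimes> v) = u \<otimes> \<phi> h \<otimes> v" "\<psi> (u \<otimes> h \<otimes> v) = u \<otimes> \<psi> h \<otimes> v"
      if "u \<in> Hs k" "v \<in> Hs k" for u v
      using hom_mult[OF p(1)] hom_mult[OF q(1)] pk that c Hs_carrier[OF k] by simp_all
    have f: "\<phi> h = x j \<otimes> h \<otimes> inv (x j)" "\<psi> h = inv (x j) \<otimes> h \<otimes> x j" using p q j h c by auto
    have r: "u \<otimes> (v \<otimes> h \<otimes> u) \<otimes> v = h" if "u \<otimes> v = \<one>" "u \<in> carrier G" "v \<in> carrier G" for u v
    proof -
      have "u \<otimes> (v \<otimes> h \<otimes> u) \<otimes> v = (u \<otimes> v) \<otimes> h \<otimes> (u \<otimes> v)" using that(2,3) c by (simp add: m_assoc)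
      then show ?thesis using that c by simp
    qed
    have "\<phi> (\<psi> h) = inv (x j) \<otimes> \<phi> h \<otimes> x j" unfolding f(2) using pp(1)[of "inv (x j)" "x j"] x(1)[OF j] ixH[OF j] by simp
    moreover have "\<psi> (\<phi> h) = x j \<otimes> \<psi> h \<otimes> inv (x j)" unfolding f(1) using pp(2)[of "x j" "inv (x j)"] x(1)[OF j] ixH[OF j] by simp
    ultimately show ?thesis using f r[of "inv (x j)" "x j"] r[of "x j" "inv (x j)"] c by simp
  qed
  have "\<phi> (\<psi> g) = g" "\<psi> (\<phi> g) = g" if "g \<in> carrier G" for g
  proof -
    have "\<phi> \<circ> \<psi> \<in> hom G G" "\<psi> \<circ> \<phi> \<in> hom G G" using p(1) q(1) by (auto simp: hom_def Pi_iff)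
    then show "\<phi> (\<psi> g) = g" "\<psi> (\<phi> g) = g"
      using hom_eq_id[of "\<phi> \<circ> \<psi>" g] hom_eq_id[of "\<psi> \<circ> \<phi>" g] inv1 that by auto
  qed
  then have "bij_betw \<phi> (carrier G) (carrier G)"
    by (intro bij_betw_byWitness[of _ \<psi>]) (use p(1) q(1) in \<open>auto simp: hom_def\<close>)
  then show ?thesis using p by (auto simp: iso_def)
qed

lemma iso_free_product:
  assumes p: "\<phi> \<in> iso G G"
  shows "internal_free_product G (\<lambda>j. \<phi> ` Hs j) n"
proof -
  have h: "\<phi> \<in> hom G G" and b: "bij_betw \<phi> (carrier G) (carrier G)" using p by (auto simp: iso_def)
  have inj: "inj_on \<phi> (carrier G)" using b by (simp add: bij_betw_def)
  have s: "subgroup (\<phi> ` Hs i) G" if "i \<in> {1..n}" for i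
    using group_hom.subgroup_img_is_subgroup[of G G \<phi> "Hs i"] sub[OF that] h is_group
    by (simp add: group_hom_def group_hom_axioms_def)
  let ?m = "map (\<lambda>p. (fst p, \<phi> (snd p)))"
  have p1: "\<phi> \<one> = \<one>" using h hom_one is_group by blast
  have ne: "\<phi> y \<noteq> \<one>" if "y \<in> carrier G" "y \<noteq> \<one>" for y using inj that p1 by (metis inj_onD one_closed)
  let ?rw' = "reduced_word G (\<lambda>j. \<phi> ` Hs j) n"
  have rw': "?rw' ws \<longleftrightarrow> (\<forall>p\<in>set ws. fst p \<in> {1..n} \<and> snd p \<in> \<phi> ` Hs (fst p) - {\<one>}) \<and> distinct_adj (map fst ws)" for ws
    unfolding reduced_word_def distinct_adj_conv_nth all_set_conv_all_nth by auto
  have img: "?m ` {ws. rw ws} = {ws. ?rw' ws}"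
  proof
    show "?m ` {ws. rw ws} \<subseteq> {ws. ?rw' ws}"
    proof
      fix ws' assume "ws' \<in> ?m ` {ws. rw ws}"
      then obtain ws where ws: "rw ws" "ws' = ?m ws" by auto
      have "fst p \<in> {1..n} \<and> snd p \<in> \<phi> ` Hs (fst p) - {\<one>}" if "p \<in> set ws'" for p
      proof -
        obtain q where q: "q \<in> set ws" "p = (fst q, \<phi> (snd q))" using \<open>p \<in> set ws'\<close> ws by auto
        then have "fst q \<in> {1..n}" "snd q \<in> Hs (fst q)" "snd q \<noteq> \<one>" using ws(1) by (auto simp: rw_iff)
        then show ?thesis using q ne[of "snd q"] Hs_carrier[of "fst q" "snd q"] by auto
      qed
      moreover have "distinct_adj (map fst ws')" using ws by (simp add: rw_iff comp_def)
      ultimately show "ws' \<in> {ws. ?rw' ws}" by (simp add: rw')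
    qed
    show "{ws. ?rw' ws} \<subseteq> ?m ` {ws. rw ws}"
    proof
      fix ws assume "ws \<in> {ws. ?rw' ws}"
      then have w: "?rw' ws" by simp
      define vs where "vs = map (\<lambda>p. (fst p, SOME y. y \<in> Hs (fst p) \<and> \<phi> y = snd p)) ws"
      have y: "(SOME y. y \<in> Hs (fst p) \<and> \<phi> y = snd p) \<in> Hs (fst p) \<and> \<phi> (SOME y. y \<in> Hs (fst p) \<and> \<phi> y = snd p) = snd p"
        if "p \<in> set ws" for p
      proof (rule someI_ex)
        have "snd p \<in> \<phi> ` Hs (fst p)" using w that by (simp add: rw')
        then show "\<exists>y. y \<in> Hs (fst p) \<and> \<phi> y = snd p" by auto
      qed
      have "rw vs"
      proof -
        have "fst q \<in> {1..n} \<and> snd q \<in> Hs (fst q) - {\<one>}" if "q \<in> set vs" for q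
        proof -
          obtain p where p: "p \<in> set ws" "fst q = fst p" "snd q = (SOME y. y \<in> Hs (fst p) \<and> \<phi> y = snd p)"
            using \<open>q \<in> set vs\<close> by (auto simp: vs_def)
          have "fst p \<in> {1..n}" "snd p \<noteq> \<one>" using w p(1) by (simp_all add: rw')
          moreover have "snd q \<in> Hs (fst p)" "\<phi> (snd q) = snd p" using y[OF p(1)] p(3) by simp_all
          ultimately show ?thesis using p(2) p1 by auto
        qed
        moreover have "map fst vs = map fst ws" by (simp add: vs_def comp_def)
        moreover have "distinct_adj (map fst ws)" using w by (simp add: rw')
        ultimately show ?thesis by (simp only: rw_iff) blast
      qed
      moreover have "?m vs = ws"
      proof -
        have "?m vs = map (\<lambda>p. p) ws" unfolding vs_def map_map using y by (intro map_cong) auto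
        then show ?thesis by simp
      qed
      ultimately show "ws \<in> ?m ` {ws. rw ws}" by force
    qed
  qed
  have val': "val (?m ws) = \<phi> (val ws)" if "letters ws" for ws
    using that
  proof (induction ws)
    case (Cons p ws)
    then have l: "letters ws" "snd p \<in> carrier G" using Hs_carrier[of "fst p" "snd p"] by (auto simp: letters_def)
    then show ?case using Cons.IH hom_mult[OF h] by simp
  qed (simp add: p1)
  have comp: "(val \<circ> ?m) ws = (\<phi> \<circ> val) ws" if "rw ws" for ws using val' rw_letters that by simp
  have bb: "bij_betw (\<phi> \<circ> val) {ws. rw ws} (carrier G)" using bij_betw_trans[OF bij b] .
  have "bij_betw (val \<circ> ?m) {ws. rw ws} (carrier G)"
    using bb comp by (subst bij_betw_cong[of _ _ "\<phi> \<circ> val"]) auto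
  then have "inj_on val (?m ` {ws. rw ws})" "val ` (?m ` {ws. rw ws}) = carrier G"
    by (auto simp: bij_betw_def image_comp dest: inj_on_imageI)
  then have "bij_betw val {ws. ?rw' ws} (carrier G)" by (simp add: img bij_betw_def)
  then show ?thesis using s by (simp add: internal_free_product_def)
qed

end

section \<open>Bases in the Bass--Serre tree of the given splitting\<close>

locale reference_product = free_product G Gs n for G (structure) and Gs n +
  assumes nontriv: "i \<in> {1..n} \<Longrightarrow> Gs i \<noteq> {\<one>}"
begin

lemma letter_ex: assumes "i \<in> {1..n}" obtains x where "x \<in> Gs i" "x \<noteq> \<one>"
  using nontriv[OF assms] subgroup.one_closed[OF sub[OF assms]] by blast

definition cjset :: "'a \<Rightarrow> 'a set \<Rightarrow> 'a set" where
  "cjset c A = (\<lambda>h. c \<otimes> h \<otimes> inv c) ` A"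

lemma cjset_mult:
  assumes "c \<in> carrier G" "d \<in> carrier G" "A \<subseteq> carrier G"
  shows "cjset c (cjset d A) = cjset (c \<otimes> d) A"
  unfolding cjset_def image_image
  by (rule image_cong) (use assms in \<open>auto simp: m_assoc inv_mult_group\<close>)

lemma cjset_one: "A \<subseteq> carrier G \<Longrightarrow> cjset \<one> A = A"
  unfolding cjset_def by (force simp: subset_iff image_iff)

lemma cjset_self: assumes "subgroup A G" "x \<in> A" shows "cjset x A = A"
proof -
  have sub: "cjset x A \<subseteq> A" if "x \<in> A" for x
    using subgroup.m_closed[OF assms(1)] subgroup.m_inv_closed[OF assms(1)] that by (auto simp: cjset_def)
  have c: "x \<in> carrier G" "A \<subseteq> carrier G" "inv x \<in> A" using assms subgroup.mem_carrier subgroup.subset subgroup.m_inv_closed by metis+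
  have "A = cjset x (cjset (inv x) A)" using c by (simp add: cjset_mult cjset_one)
  also have "\<dots> \<subseteq> cjset x A" using sub[OF c(3)] by (auto simp: cjset_def)
  finally show ?thesis using sub[OF assms(2)] by blast
qed

lemma Gs_sub: "i \<in> {1..n} \<Longrightarrow> Gs i \<subseteq> carrier G" using subgroup.subset[OF sub] by simp

text \<open>After removal of a first letter from \<open>Gs i\<close>, the rest \<open>y\<close>
  still conjugates \<open>x\<close> to some \<open>u\<close> in \<open>Gs i\<close>. Then
  \<open>inv u \<otimes> y = y \<otimes> inv x\<close>, where the left side begins with label
  \<open>i\<close>, while \<open>lab_right_mult\<close> allows this for the right side only if
  \<open>y = \<one>\<close>.\<close>

lemma normalizer:
  assumes i: "i \<in> {1..n}" and z: "z \<in> carrier G" and c: "cjset z (Gs i) = Gs i"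
  shows "z \<in> Gs i"
proof (rule ccontr)
  assume nz: "z \<notin> Gs i"
  obtain x where x: "x \<in> Gs i" "x \<noteq> \<one>" using letter_ex[OF i] .
  note mem = subgroup.m_closed[OF sub[OF i]] subgroup.m_inv_closed[OF sub[OF i]] subgroup.one_closed[OF sub[OF i]]
  have carr: "w \<in> carrier G" if "w \<in> Gs i" for w using Hs_carrier[OF i that] .
  obtain b where b: "b \<in> Gs i" "lab (inv b \<otimes> z) \<noteq> i"
  proof (cases "lab z = i")
    case True
    then have "z \<noteq> \<one>" using i by auto
    then show ?thesis using lab_split[OF z] True that by metis
  next
    case False then show ?thesis using that[of \<one>] mem z by simp
  qed
  define y where "y = inv b \<otimes> z"
  have y: "y \<in> carrier G" "lab y \<noteq> i" "y \<noteq> \<one>" using b z carr[OF b(1)] nz by (auto simp: y_def inv_eq_1_iff) (metis inv_solve_left' one_closed r_one)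
  have zy: "z = b \<otimes> y" using z carr[OF b(1)] by (simp add: y_def m_assoc[symmetric])
  have yG: "y \<notin> Gs i" using nz zy mem b by auto
  have yx: "y \<otimes> w \<otimes> inv y \<in> Gs i" if w: "w \<in> Gs i" for w
  proof -
    have "z \<otimes> w \<otimes> inv z \<in> Gs i" using c w by (auto simp: cjset_def)
    then have "inv b \<otimes> (z \<otimes> w \<otimes> inv z) \<otimes> b \<in> Gs i" using b mem by simp
    moreover have "inv b \<otimes> (z \<otimes> w \<otimes> inv z) \<otimes> b = y \<otimes> w \<otimes> inv y"
      using carr[OF w] carr[OF b(1)] z by (simp add: y_def m_assoc inv_mult_group)
    ultimately show ?thesis by simp
  qed
  define u where "u = y \<otimes> x \<otimes> inv y"
  have u: "u \<in> Gs i" "u \<in> carrier G" using yx[OF x(1)] carr by (auto simp: u_def)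
  have "u \<noteq> \<one>"
  proof
    assume "u = \<one>"
    then have "y \<otimes> x = y" using y carr[OF x(1)] by (simp add: u_def inv_solve_right')
    then show False using y carr[OF x(1)] x by (simp add: r_cancel_one)
  qed
  then have "lab u = i" using lab_letter[OF i u(1)] by simp
  then have "lab (inv u \<otimes> y) = lab (inv u)" using lab_no_cancel[OF u(2) y(1) \<open>u \<noteq> \<one>\<close>] y by simp
  moreover have "lab (inv u) = i" using lab_letter[OF i mem(2)[OF u(1)]] \<open>u \<noteq> \<one>\<close> u by simp
  moreover have "inv u \<otimes> y = y \<otimes> inv x" using y carr[OF x(1)] by (simp add: u_def m_assoc inv_mult_group)
  ultimately have "lab (y \<otimes> inv x) = i" by simp
  then show False using lab_right_mult[OF y(1) i mem(2)[OF x(1)], of i] y i by auto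
qed

text \<open>The Bass--Serre tree is used in the form with all group elements \<open>g\<close> and
  all cosets \<open>lcos g i\<close> as vertices and the pairs \<open>(i, g)\<close> as edges from
  \<open>g\<close> to \<open>lcos g i\<close>. Thus
  \<open>lab (inv \<gamma> \<otimes> c) \<noteq> k\<close> says that the edge
  \<open>(k, \<gamma>)\<close> does not separate the vertices \<open>\<gamma>\<close> and
  \<open>c\<close>.\<close>

definition lcos :: "'a \<Rightarrow> nat \<Rightarrow> 'a set" where
  "lcos c i = {c \<otimes> x | x. x \<in> Gs i}"

text \<open>At a coset vertex at most one edge leads towards \<open>c\<close>. Two of them would
  differ by a nontrivial \<open>w\<close> in \<open>Gs i\<close>, and passing from one to the other
  would make \<open>inv \<beta> \<otimes> c\<close> begin with label \<open>i\<close>. Existence is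
  \<open>lcos_gate\<close>.\<close>

lemma lcos_uniq:
  assumes i: "i \<in> {1..n}" and g: "g \<in> carrier G" and c: "c \<in> carrier G"
    and a: "\<alpha> \<in> lcos g i" "\<beta> \<in> lcos g i" "lab (inv \<alpha> \<otimes> c) \<noteq> i" "lab (inv \<beta> \<otimes> c) \<noteq> i"
  shows "\<alpha> = \<beta>"
proof -
  obtain x y where xy: "\<alpha> = g \<otimes> x" "\<beta> = g \<otimes> y" "x \<in> Gs i" "y \<in> Gs i" using a by (auto simp: lcos_def)
  have cc: "x \<in> carrier G" "y \<in> carrier G" using xy Hs_carrier i by auto
  define w where "w = inv x \<otimes> y"
  have w: "w \<in> Gs i" "w \<in> carrier G" using xy subgroup.m_closed[OF sub[OF i]] subgroup.m_inv_closed[OF sub[OF i]] cc by (auto simp: w_def)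
  have "inv \<beta> \<otimes> c = inv w \<otimes> (inv \<alpha> \<otimes> c)"
  proof -
    have "inv w = inv y \<otimes> x" using cc by (simp add: w_def inv_mult_group)
    moreover have "inv y \<otimes> x \<otimes> (inv x \<otimes> inv g \<otimes> c) = inv y \<otimes> (x \<otimes> inv x) \<otimes> inv g \<otimes> c"
      using cc g c by (simp only: m_assoc inv_closed m_closed)
    ultimately show ?thesis using cc g c xy by (simp add: inv_mult_group)
  qed
  have "w = \<one>"
  proof (rule ccontr)
    assume n: "w \<noteq> \<one>"
    then have l: "lab w = i" "lab (inv w) = i" using lab_letter[OF i] w subgroup.m_inv_closed[OF sub[OF i]] by auto
    have ac: "inv \<alpha> \<otimes> c \<in> carrier G" using xy cc g c by simp
    have "lab (inv w \<otimes> (inv \<alpha> \<otimes> c)) = lab (inv w)" using lab_no_cancel[OF w(2) ac n] l a by simp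
    then show False using \<open>inv \<beta> \<otimes> c = _\<close> l a by simp
  qed
  then have "x = y" using cc by (metis inv_solve_left' one_closed r_one w_def)
  then show ?thesis using xy by simp
qed

lemma lcos_mem: "i \<in> {1..n} \<Longrightarrow> g \<in> carrier G \<Longrightarrow> g \<in> lcos g i"
  unfolding lcos_def using subgroup.one_closed[OF sub] by (force intro: exI[of _ \<one>])

lemma lcos_carrier: "i \<in> {1..n} \<Longrightarrow> g \<in> carrier G \<Longrightarrow> c \<in> lcos g i \<Longrightarrow> c \<in> carrier G"
  using Hs_carrier by (auto simp: lcos_def)

lemma lcos_gate:
  assumes i: "i \<in> {1..n}" and g: "g \<in> carrier G" and c: "c \<in> carrier G"
  obtains \<gamma> where "\<gamma> \<in> lcos g i" "lab (inv \<gamma> \<otimes> c) \<noteq> i"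
proof (cases "lab (inv g \<otimes> c) = i")
  case False
  then show ?thesis using that[of g] lcos_mem i g by auto
next
  case True
  have z: "inv g \<otimes> c \<in> carrier G" "inv g \<otimes> c \<noteq> \<one>" using g c True i by auto
  obtain x where x: "x \<in> Gs i" "lab (inv x \<otimes> (inv g \<otimes> c)) \<noteq> i" using lab_split[OF z] True by metis
  have "inv x \<otimes> (inv g \<otimes> c) = inv (g \<otimes> x) \<otimes> c" using Hs_carrier[OF i x(1)] g c by (simp add: m_assoc inv_mult_group)
  then show ?thesis using that[of "g \<otimes> x"] x by (auto simp: lcos_def)
qed

text \<open>The elements \<open>c\<close> and \<open>c \<otimes> x\<close> are neighbours of one
  coset vertex, so the path between them crosses only the edges \<open>(j, c)\<close> and
  \<open>(j, c \<otimes> x)\<close>; the prescribed sides single out the former.\<close>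

lemma lab_lcos_const:
  assumes l: "l \<in> {1..n}" and d: "\<delta> \<in> carrier G" and c: "c \<in> carrier G" "j \<in> {1..n}" "x \<in> Gs j"
    and lb: "lab (inv \<delta> \<otimes> c) \<noteq> l" "lab (inv \<delta> \<otimes> (c \<otimes> x)) = l"
  shows "\<delta> = c \<and> j = l"
proof -
  have xc: "x \<in> carrier G" using Hs_carrier c by blast
  have e: "inv \<delta> \<otimes> (c \<otimes> x) = (inv \<delta> \<otimes> c) \<otimes> x" using d c xc by (simp add: m_assoc)
  have "inv \<delta> \<otimes> c = \<one> \<and> j = l"
    using lab_right_mult[of "inv \<delta> \<otimes> c" j x l] lb d c l e by auto
  then show ?thesis using d c by (metis inv_closed inv_equality inv_inv)
qed

text \<open>\<open>pos H j\<close> is the vertex fixed by \<open>H j\<close>, as a left coset of \<open>Gs j\<close>, and \<open>pos H 0\<close> is the base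
  vertex. The edges at this vertex are the elements of the coset, and \<open>dirn H k j\<close> is the one at
  \<open>pos H k\<close> that leads to \<open>pos H j\<close>; so \<open>R0 H\<close> is the separation relation of these vertices.\<close>

definition pos :: "(nat \<Rightarrow> 'a set) \<Rightarrow> nat \<Rightarrow> 'a set" where
  "pos H j = (if j = 0 then {\<one>} else {c \<in> carrier G. H j = cjset c (Gs j)})"

definition conj_sys :: "(nat \<Rightarrow> 'a set) \<Rightarrow> bool" where
  "conj_sys H \<longleftrightarrow> (\<forall>i\<in>{1..n}. \<exists>g\<in>carrier G. H i = cjset g (Gs i))"

definition dirn :: "(nat \<Rightarrow> 'a set) \<Rightarrow> nat \<Rightarrow> nat \<Rightarrow> 'a" where
  "dirn H k j = (THE \<gamma>. \<gamma> \<in> pos H k \<and> (\<forall>c\<in>pos H j. lab (inv \<gamma> \<otimes> c) \<noteq> k))"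

definition R0 :: "(nat \<Rightarrow> 'a set) \<Rightarrow> nat \<Rightarrow> nat \<Rightarrow> nat \<Rightarrow> bool" where
  "R0 H k i j \<longleftrightarrow> k \<le> n \<and> i \<le> n \<and> j \<le> n \<and> i \<noteq> k \<and> j \<noteq> k \<and> (k = 0 \<or> dirn H k i = dirn H k j)"

text \<open>\<open>pos H j\<close> lies on that side of the edge \<open>\<epsilon>\<close> which
  contains the group element \<open>snd \<epsilon>\<close>. The universal quantifier puts a coset
  vertex on the far side of the edges ending at it; for all other edges its elements agree by
  \<open>lab_lcos_const\<close>.\<close>

definition side :: "(nat \<Rightarrow> 'a set) \<Rightarrow> nat \<times> 'a \<Rightarrow> nat \<Rightarrow> bool" where
  "side H \<epsilon> j \<longleftrightarrow> (\<forall>c\<in>pos H j. lab (inv (snd \<epsilon>) \<otimes> c) \<noteq> fst \<epsilon>)"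

lemma pos_carrier: "c \<in> pos H j \<Longrightarrow> c \<in> carrier G"
  by (auto simp: pos_def split: if_splits)

lemma pos_lcos: assumes "j \<in> {1..n}" "c \<in> pos H j" shows "pos H j = lcos c j"
proof
  have c: "c \<in> carrier G" "H j = cjset c (Gs j)" using assms by (auto simp: pos_def)
  have sb: "Gs j \<subseteq> carrier G" using Gs_sub assms by simp
  show "pos H j \<subseteq> lcos c j"
  proof
    fix d assume "d \<in> pos H j"
    then have d: "d \<in> carrier G" "cjset d (Gs j) = cjset c (Gs j)" using assms c by (auto simp: pos_def)
    have "cjset (inv c \<otimes> d) (Gs j) = cjset (inv c) (cjset d (Gs j))"
      by (rule cjset_mult[symmetric]) (use c d(1) sb in auto)
    also have "\<dots> = Gs j" unfolding d(2) using c sb by (simp add: cjset_mult cjset_one)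
    finally have "inv c \<otimes> d \<in> Gs j" using normalizer[OF assms(1)] c d by simp
    moreover have "d = c \<otimes> (inv c \<otimes> d)" using c d by (simp add: m_assoc[symmetric])
    ultimately show "d \<in> lcos c j" by (auto simp: lcos_def)
  qed
  show "lcos c j \<subseteq> pos H j"
  proof
    fix d assume "d \<in> lcos c j"
    then obtain x where x: "x \<in> Gs j" "d = c \<otimes> x" by (auto simp: lcos_def)
    have "cjset d (Gs j) = cjset c (cjset x (Gs j))" using x c sb by (simp add: cjset_mult subset_iff)
    then show "d \<in> pos H j" using assms x c cjset_self[OF sub[OF assms(1)] x(1)] sb by (auto simp: pos_def)
  qed
qed

lemma pos_nonempty: assumes "conj_sys H" "j \<le> n" shows "pos H j \<noteq> {}"
proof (cases "j = 0")
  case False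
  then have "j \<in> {1..n}" using assms by simp
  then obtain g where "g \<in> carrier G" "H j = cjset g (Gs j)" using assms(1) unfolding conj_sys_def by blast
  then show ?thesis using False by (auto simp: pos_def)
qed (simp add: pos_def)

lemma pos_stab:
  assumes j: "j \<in> {1..n}" and c: "c \<in> pos H j"
  shows "x \<in> H j \<Longrightarrow> x \<otimes> c \<in> pos H j" "d \<in> pos H j \<Longrightarrow> d \<otimes> inv c \<in> H j" "H j \<subseteq> carrier G"
proof -
  have cc: "c \<in> carrier G" "H j = cjset c (Gs j)" using c j by (auto simp: pos_def)
  have sb: "Gs j \<subseteq> carrier G" using Gs_sub j by simp
  show "H j \<subseteq> carrier G" using cc sb by (auto simp: cjset_def)
  show "x \<otimes> c \<in> pos H j" if xH: "x \<in> H j"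
  proof -
    obtain a where a: "a \<in> Gs j" "x = c \<otimes> a \<otimes> inv c" using xH cc by (auto simp: cjset_def)
    have "x \<otimes> c = c \<otimes> a" using a cc sb by (simp add: m_assoc subset_iff)
    then show ?thesis unfolding pos_lcos[OF j c] using a by (auto simp: lcos_def)
  qed
  show "d \<otimes> inv c \<in> H j" if "d \<in> pos H j"
    using that cc unfolding pos_lcos[OF j c] by (auto simp: lcos_def cjset_def)
qed

text \<open>One element of the target coset suffices as a test, since by
  \<open>lab_lcos_const\<close> an edge with label \<open>k \<noteq> j\<close> has all of that coset
  on one side.\<close>

lemma dirn_eqI:
  assumes k: "k \<in> {1..n}" "j \<le> n" "j \<noteq> k" and g: "\<gamma> \<in> pos H k" and c: "c \<in> pos H j" "lab (inv \<gamma> \<otimes> c) \<noteq> k"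
  shows "dirn H k j = \<gamma>" "\<forall>c\<in>pos H j. lab (inv \<gamma> \<otimes> c) \<noteq> k"
proof -
  have gc: "\<gamma> \<in> carrier G" "c \<in> carrier G" using g c pos_carrier by auto
  show all: "\<forall>c\<in>pos H j. lab (inv \<gamma> \<otimes> c) \<noteq> k"
  proof (cases "j = 0")
    case True then show ?thesis using c by (auto simp: pos_def)
  next
    case False
    then have j: "j \<in> {1..n}" using k by auto
    show ?thesis unfolding pos_lcos[OF j c(1)] using lab_lcos_const[OF k(1) gc j _ c(2)] k by (auto simp: lcos_def)
  qed
  show "dirn H k j = \<gamma>" unfolding dirn_def
  proof (rule the_equality)
    fix \<beta> assume b: "\<beta> \<in> pos H k \<and> (\<forall>c\<in>pos H j. lab (inv \<beta> \<otimes> c) \<noteq> k)"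
    show "\<beta> = \<gamma>" using lcos_uniq[OF k(1) gc(1,2), of \<beta> \<gamma>] b g c pos_lcos[OF k(1) g] by auto
  qed (use g all in auto)
qed

lemma dirn:
  assumes H: "conj_sys H" and k: "k \<in> {1..n}" "j \<le> n" "j \<noteq> k"
  shows "dirn H k j \<in> pos H k" "c \<in> pos H j \<Longrightarrow> lab (inv (dirn H k j) \<otimes> c) \<noteq> k"
proof -
  obtain g where g: "g \<in> pos H k" using pos_nonempty[OF H, of k] k by auto
  obtain c0 where c0: "c0 \<in> pos H j" using pos_nonempty[OF H, of j] k by auto
  obtain \<gamma> where gm: "\<gamma> \<in> pos H k" "lab (inv \<gamma> \<otimes> c0) \<noteq> k"
    using lcos_gate[OF k(1) pos_carrier[OF g] pos_carrier[OF c0]] pos_lcos[OF k(1) g] by metis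
  then show "dirn H k j \<in> pos H k" using dirn_eqI(1)[OF k gm(1) c0 gm(2)] by simp
  show "c \<in> pos H j \<Longrightarrow> lab (inv (dirn H k j) \<otimes> c) \<noteq> k"
    using dirn_eqI[OF k gm(1) c0 gm(2)] by simp
qed

text \<open>The edges \<open>(k, \<alpha>)\<close> and \<open>(l, \<alpha>')\<close> face each other
  with their group element ends, so the half-trees beyond them are disjoint and cannot both contain
  \<open>c\<close>.\<close>

lemma lcos_compat:
  assumes k: "k \<in> {1..n}" "l \<in> {1..n}" and al: "\<alpha> \<in> carrier G" "\<alpha>' \<in> carrier G" "c \<in> carrier G"
    and g: "lab (inv \<alpha> \<otimes> \<alpha>') \<noteq> k" "lab (inv \<alpha>' \<otimes> \<alpha>) \<noteq> l" and ne: "\<alpha> = \<alpha>' \<Longrightarrow> k \<noteq> l"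
  shows "lab (inv \<alpha> \<otimes> c) \<noteq> k \<or> lab (inv \<alpha>' \<otimes> c) \<noteq> l"
proof (rule disjCI)
  assume "\<not> lab (inv \<alpha>' \<otimes> c) \<noteq> l"
  then have l: "lab (inv \<alpha>' \<otimes> c) = l" by simp
  define d where "d = inv \<alpha>' \<otimes> \<alpha>"
  have d: "d \<in> carrier G" "inv d = inv \<alpha> \<otimes> \<alpha>'" using al by (auto simp: d_def inv_mult_group)
  have e: "inv \<alpha> \<otimes> c = inv d \<otimes> (inv \<alpha>' \<otimes> c)"
  proof -
    have "inv \<alpha> \<otimes> \<alpha>' \<otimes> (inv \<alpha>' \<otimes> c) = inv \<alpha> \<otimes> (\<alpha>' \<otimes> inv \<alpha>') \<otimes> c" using al by (simp only: m_assoc inv_closed m_closed)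
    then show ?thesis using al d by simp
  qed
  show "lab (inv \<alpha> \<otimes> c) \<noteq> k"
  proof (cases "d = \<one>")
    case True
    then have "\<alpha> = \<alpha>'" using al by (metis d_def inv_solve_left' one_closed r_one)
    then show ?thesis using l ne by auto
  next
    case False
    have "lab (inv d \<otimes> (inv \<alpha>' \<otimes> c)) = lab (inv d)" using lab_no_cancel[OF d(1) _ False] al l g by (simp add: d_def)
    then show ?thesis using e d g by simp
  qed
qed

lemma dirn_compat:
  assumes H: "conj_sys H" and k: "k \<in> {1..n}" "l \<in> {1..n}" "k \<noteq> l" and i: "i \<le> n" "i \<noteq> k" "i \<noteq> l"
  shows "dirn H k i = dirn H k l \<or> dirn H l i = dirn H l k"
proof -
  have le: "k \<le> n" "l \<le> n" using k by auto
  note a = dirn[OF H k(1) le(2)] and b = dirn[OF H k(2) le(1)]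
  have ac: "dirn H k l \<in> carrier G" "dirn H l k \<in> carrier G" using a(1) b(1) k pos_carrier by auto
  obtain c where c: "c \<in> pos H i" using pos_nonempty[OF H i(1)] by auto
  have "lab (inv (dirn H k l) \<otimes> c) \<noteq> k \<or> lab (inv (dirn H l k) \<otimes> c) \<noteq> l"
    using lcos_compat[OF k(1,2) ac pos_carrier[OF c]] a(2)[of "dirn H l k"] b(2)[of "dirn H k l"] a(1) b(1) k by auto
  then show ?thesis
    using dirn_eqI(1)[OF k(1) i(1,2) _ c, of "dirn H k l"] dirn_eqI(1)[OF k(2) i(1,3) _ c, of "dirn H l k"] a(1) b(1) k by auto
qed

lemma R0_sep_family: assumes H: "conj_sys H" shows "sep_family n (R0 H)"
proof (rule sep_family.intro)
  fix k l i j
  show "R0 H k i j \<Longrightarrow> k \<le> n \<and> i \<le> n \<and> j \<le> n \<and> i \<noteq> k \<and> j \<noteq> k" unfolding R0_def by blast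
  show "k \<le> n \<Longrightarrow> i \<le> n \<Longrightarrow> i \<noteq> k \<Longrightarrow> R0 H k i i" unfolding R0_def by blast
  show "R0 H k i j \<Longrightarrow> R0 H k j i" unfolding R0_def by metis
  show "R0 H k i j \<Longrightarrow> R0 H k j l \<Longrightarrow> R0 H k i l" unfolding R0_def by metis
  show "i \<le> n \<Longrightarrow> j \<le> n \<Longrightarrow> i \<noteq> 0 \<Longrightarrow> j \<noteq> 0 \<Longrightarrow> R0 H 0 i j" unfolding R0_def by blast
  assume h: "k \<le> n" "l \<le> n" "i \<le> n" "k \<noteq> l" "i \<noteq> k" "i \<noteq> l"
  have "k = 0 \<or> l = 0 \<or> dirn H k i = dirn H k l \<or> dirn H l i = dirn H l k"
  proof (cases "k = 0 \<or> l = 0")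
    case False
    then have "k \<in> {1..n}" "l \<in> {1..n}" using h by simp_all
    then show ?thesis using dirn_compat[OF H _ _ h(4,3,5,6)] by blast
  qed blast
  then show "R0 H k i l \<or> R0 H l i k" unfolding R0_def using h by blast
qed

lemma dirn_translate:
  assumes H: "conj_sys H" and k: "k \<in> {1..n}" "i \<le> n" "i \<noteq> k" and g: "g \<in> carrier G"
    and p: "pos H' k = (\<lambda>c. g \<otimes> c) ` pos H k" "pos H' i = (\<lambda>c. g \<otimes> c) ` pos H i"
  shows "dirn H' k i = g \<otimes> dirn H k i"
proof -
  obtain c where c: "c \<in> pos H i" using pos_nonempty[OF H k(2)] by auto
  have d: "dirn H k i \<in> pos H k" "lab (inv (dirn H k i) \<otimes> c) \<noteq> k" using dirn[OF H k] c by auto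
  have cc: "c \<in> carrier G" "dirn H k i \<in> carrier G" using c d pos_carrier by auto
  have "inv (g \<otimes> dirn H k i) \<otimes> (g \<otimes> c) = inv (dirn H k i) \<otimes> (inv g \<otimes> g) \<otimes> c"
    using cc g by (simp only: inv_mult_group m_assoc inv_closed m_closed)
  then have "lab (inv (g \<otimes> dirn H k i) \<otimes> (g \<otimes> c)) \<noteq> k" using d cc g by simp
  then show ?thesis 
    using dirn_eqI(1)[OF k, of "g \<otimes> dirn H k i" H' "g \<otimes> c"] imageI[OF d(1), of "\<lambda>c. g \<otimes> c"]
      imageI[OF c, of "\<lambda>c. g \<otimes> c"] p by simp
qed

lemma R0_translate:
  assumes H: "conj_sys H" and g: "g \<in> carrier G"
    and p: "\<And>j. j \<in> {k, i, j'} \<Longrightarrow> pos H' j = (\<lambda>c. g \<otimes> c) ` pos H j"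
  shows "R0 H' k i j' = R0 H k i j'"
proof (cases "k \<in> {1..n} \<and> i \<le> n \<and> j' \<le> n \<and> i \<noteq> k \<and> j' \<noteq> k")
  case True
  then have e: "dirn H' k i = g \<otimes> dirn H k i" "dirn H' k j' = g \<otimes> dirn H k j'"
    using dirn_translate[OF H _ _ _ g, of k _ H'] p by auto
  have c: "dirn H k i \<in> carrier G" "dirn H k j' \<in> carrier G" using True dirn(1)[OF H] pos_carrier by blast+
  show ?thesis using e c g by (auto simp: R0_def)
qed (auto simp: R0_def)

lemma side_translate:
  assumes g: "g \<in> carrier G" and p: "pos H' j = (\<lambda>c. g \<otimes> c) ` pos H j" and e: "snd \<epsilon> \<in> carrier G"
  shows "side H' (fst \<epsilon>, g \<otimes> snd \<epsilon>) j = side H \<epsilon> j"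
proof -
  have "inv (g \<otimes> snd \<epsilon>) \<otimes> (g \<otimes> c) = inv (snd \<epsilon>) \<otimes> c" if "c \<in> pos H j" for c
  proof -
    have c: "c \<in> carrier G" using that pos_carrier by auto
    have "inv (g \<otimes> snd \<epsilon>) \<otimes> (g \<otimes> c) = inv (snd \<epsilon>) \<otimes> (inv g \<otimes> g) \<otimes> c"
      using c g e by (simp only: inv_mult_group m_assoc inv_closed m_closed)
    then show ?thesis using c g e by simp
  qed
  then show ?thesis unfolding side_def p by auto
qed

lemma side_dirn:
  assumes H: "conj_sys H" and k: "k \<in> {1..n}" "j \<le> n" "j \<noteq> k"
  shows "side H (k, dirn H k j) j" "\<not> side H (k, dirn H k j) k"
proof -
  show "side H (k, dirn H k j) j" using dirn(2)[OF H k] by (auto simp: side_def)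
  obtain x where x: "x \<in> Gs k" "x \<noteq> \<one>" using letter_ex[OF k(1)] .
  have d: "dirn H k j \<in> pos H k" using dirn[OF H k] by simp
  have c: "dirn H k j \<in> carrier G" "x \<in> carrier G" using pos_carrier[OF d] Hs_carrier[OF k(1) x(1)] by auto
  have "dirn H k j \<otimes> x \<in> pos H k" unfolding pos_lcos[OF k(1) d] using x by (auto simp: lcos_def)
  moreover have "inv (dirn H k j) \<otimes> (dirn H k j \<otimes> x) = x" using c by (simp add: m_assoc[symmetric])
  moreover have "lab x = k" using lab_letter[OF k(1) x] .
  ultimately show "\<not> side H (k, dirn H k j) k" by (auto simp: side_def intro!: bexI[of _ "dirn H k j \<otimes> x"])
qed

text \<open>An edge crossed on the way from \<open>p\<close> to \<open>q\<close> lies in the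
  direction of \<open>q\<close> at \<open>p\<close>. As \<open>z\<close> lies in another direction,
  this edge is not crossed on the way to \<open>z\<close>.\<close>

lemma side_convex:
  assumes H: "conj_sys H" and p: "p \<in> {1..n}" and q: "q \<le> n" "q \<noteq> p" and z: "z \<le> n" "z \<noteq> p"
    and nr: "\<not> R0 H p q z" and e: "fst \<epsilon> \<in> {1..n}" "snd \<epsilon> \<in> carrier G"
    and s: "side H \<epsilon> q \<noteq> side H \<epsilon> p"
  shows "side H \<epsilon> z = side H \<epsilon> p"
proof -
  obtain i \<delta> where ed: "\<epsilon> = (i, \<delta>)" by (cases \<epsilon>)
  have i: "i \<in> {1..n}" "\<delta> \<in> carrier G" using e ed by auto
  have D: "dirn H p q \<noteq> dirn H p z" using nr p q z by (auto simp: R0_def)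
  note dq = dirn[OF H p q] and dz = dirn[OF H p z]
  show ?thesis
  proof (cases "i = p \<and> \<delta> \<in> pos H p")
    case True
    then have pl: "pos H p = lcos \<delta> p" using pos_lcos[OF p] by auto
    obtain x where x: "x \<in> Gs p" "x \<noteq> \<one>" using letter_ex[OF p] .
    have "\<delta> \<otimes> x \<in> pos H p" using x pl by (auto simp: lcos_def)
    moreover have "inv \<delta> \<otimes> (\<delta> \<otimes> x) = x" using i Hs_carrier[OF p x(1)] by (simp add: m_assoc[symmetric])
    ultimately have sp: "\<not> side H \<epsilon> p" using lab_letter[OF p x] True ed by (auto simp: side_def intro!: bexI[of _ "\<delta> \<otimes> x"])
    then have sq: "side H \<epsilon> q" using s by simp
    obtain c where c: "c \<in> pos H q" using pos_nonempty[OF H q(1)] by auto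
    have "dirn H p q = \<delta>" using dirn_eqI(1)[OF p q _ c, of \<delta>] sq c True ed by (auto simp: side_def)
    then have "dirn H p z \<noteq> \<delta>" using D by simp
    obtain c' where c': "c' \<in> pos H z" using pos_nonempty[OF H z(1)] by auto
    have "lab (inv \<delta> \<otimes> c') = p" using dirn_eqI(1)[OF p z _ c', of \<delta>] \<open>dirn H p z \<noteq> \<delta>\<close> True by auto
    then have "\<not> side H \<epsilon> z" using c' True ed by (auto simp: side_def)
    then show ?thesis using sp by simp
  next
    case False
    obtain c where c: "c \<in> pos H p" using pos_nonempty[OF H, of p] p by auto
    have cc: "c \<in> carrier G" using pos_carrier[OF c] .
    \<comment> \<open>\<open>\<alpha>\<close> gives the edge through which a path from
      \<open>p\<close> reaches the coset vertex of \<open>\<epsilon>\<close>, and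
      \<open>\<alpha>'\<close> below the edge at \<open>p\<close> through which it leaves. The
      vertex \<open>p\<close> lies on the side of \<open>snd \<epsilon>\<close> exactly when
      \<open>\<alpha> = \<delta>\<close>.\<close>
    obtain \<alpha> where al: "\<alpha> \<in> lcos \<delta> i" "lab (inv \<alpha> \<otimes> c) \<noteq> i" using lcos_gate[OF i cc] .
    have ac: "\<alpha> \<in> carrier G" using lcos_carrier[OF i al(1)] .
    have lal: "lcos \<alpha> i = lcos \<delta> i"
    proof -
      obtain x where x: "x \<in> Gs i" "\<alpha> = \<delta> \<otimes> x" using al by (auto simp: lcos_def)
      have xc: "x \<in> carrier G" using Hs_carrier i x by auto
      have "\<alpha> \<otimes> y = \<delta> \<otimes> (x \<otimes> y)" "\<delta> \<otimes> y = \<alpha> \<otimes> (inv x \<otimes> y)" if "y \<in> Gs i" for y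
        using Hs_carrier[OF i(1) that] x xc i by (simp_all add: m_assoc m_assoc[of x "inv x" y, symmetric])
      then show ?thesis using x(1) subgroup.m_closed[OF sub[OF i(1)]] subgroup.m_inv_closed[OF sub[OF i(1)]]
        unfolding lcos_def by blast
    qed
    have anp: "\<not> (i = p \<and> \<alpha> \<in> pos H p)"
    proof
      assume a: "i = p \<and> \<alpha> \<in> pos H p"
      then have "pos H p = lcos \<delta> i" using pos_lcos[OF p] lal by auto
      then show False using False a lcos_mem[OF i] by auto
    qed
    have alp: "lab (inv \<alpha> \<otimes> d) \<noteq> i" if d: "d \<in> pos H p" for d
    proof -
      obtain x where x: "x \<in> Gs p" "d = c \<otimes> x" using d unfolding pos_lcos[OF p c] by (auto simp: lcos_def)
      show ?thesis using lab_lcos_const[OF i(1) ac cc p x(1) al(2)] x anp c by auto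
    qed
    obtain \<alpha>' where al': "\<alpha>' \<in> pos H p" "lab (inv \<alpha>' \<otimes> \<alpha>) \<noteq> p"
      using lcos_gate[OF p cc ac] pos_lcos[OF p c] by metis
    have cp: "lab (inv \<alpha> \<otimes> d) \<noteq> i \<or> lab (inv \<alpha>' \<otimes> d) \<noteq> p" if "d \<in> carrier G" for d
      using lcos_compat[OF i(1) p ac pos_carrier[OF al'(1)] that alp[OF al'(1)] al'(2)] anp al' by auto
    have uq: "\<alpha> = \<delta>" if "d \<in> carrier G" "lab (inv \<alpha> \<otimes> d) \<noteq> i" "lab (inv \<delta> \<otimes> d) \<noteq> i" for d
      using lcos_uniq[OF i that(1) al(1) lcos_mem[OF i] that(2,3)] .
    have sp: "side H \<epsilon> p \<longleftrightarrow> \<alpha> = \<delta>" using alp uq c cc ed by (auto simp: side_def)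
    have dq': "dirn H p q = \<alpha>'"
    proof -
      obtain d where d: "d \<in> pos H q" "lab (inv \<alpha> \<otimes> d) = i"
      proof (cases "\<alpha> = \<delta>")
        case True
        then have "\<not> side H \<epsilon> q" using s sp by simp
        then show ?thesis using that True ed by (auto simp: side_def)
      next
        case ne: False
        then have sq: "side H \<epsilon> q" using s sp by simp
        obtain d where d: "d \<in> pos H q" using pos_nonempty[OF H q(1)] by auto
        then have "lab (inv \<delta> \<otimes> d) \<noteq> i" using sq ed by (auto simp: side_def)
        then show ?thesis using that d uq[OF pos_carrier[OF d]] ne by auto
      qed
      then have "lab (inv \<alpha>' \<otimes> d) \<noteq> p" using cp pos_carrier by blast
      then show ?thesis using dirn_eqI(1)[OF p q al'(1) d(1)] by simp
    qed
    have az: "lab (inv \<alpha> \<otimes> d) \<noteq> i" if d: "d \<in> pos H z" for d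
      using dirn_eqI(1)[OF p z al'(1) d] D dq' cp[OF pos_carrier[OF d]] by auto
    obtain d where d: "d \<in> pos H z" using pos_nonempty[OF H z(1)] by auto
    have "side H \<epsilon> z \<longleftrightarrow> \<alpha> = \<delta>"
    proof
      assume "side H \<epsilon> z"
      then have "lab (inv \<delta> \<otimes> d) \<noteq> i" using d ed by (auto simp: side_def)
      then show "\<alpha> = \<delta>" using uq[OF pos_carrier[OF d] az[OF d]] by simp
    next
      assume "\<alpha> = \<delta>"
      then show "side H \<epsilon> z" using az ed by (auto simp: side_def)
    qed
    then show ?thesis using sp by simp
  qed
qed

text \<open>Each letter of \<open>inv c \<otimes> c'\<close> adds at most two edges, those joining
  the elements before and after it to their common coset vertex.\<close>

lemma finite_sep_centres:
  assumes "c \<in> carrier G" "c' \<in> carrier G"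
  shows "finite {(l, \<delta>). l \<in> {1..n} \<and> \<delta> \<in> carrier G \<and> (lab (inv \<delta> \<otimes> c) \<noteq> l) \<noteq> (lab (inv \<delta> \<otimes> c') \<noteq> l)}"
proof -
  define S where "S c c' = {(l, \<delta>). l \<in> {1..n} \<and> \<delta> \<in> carrier G \<and> (lab (inv \<delta> \<otimes> c) \<noteq> l) \<noteq> (lab (inv \<delta> \<otimes> c') \<noteq> l)}" for c c'
  have tri: "S c c'' \<subseteq> S c c' \<union> S c' c''" for c c' c'' by (auto simp: S_def)
  have "finite (S c (c \<otimes> g))" if "g \<in> carrier G" "c \<in> carrier G" for g c
    using that
  proof (induction g arbitrary: c rule: gen_induct)
    case one then show ?case by (simp add: S_def)
  next
    case (mult i h g)
    have h: "h \<in> carrier G" using Hs_carrier mult by auto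
    have "S c (c \<otimes> h) \<subseteq> {(i, c), (i, c \<otimes> h)}"
    proof (rule subrelI)
      fix l \<delta> assume "(l, \<delta>) \<in> S c (c \<otimes> h)"
      then have l: "l \<in> {1..n}" "\<delta> \<in> carrier G" "(lab (inv \<delta> \<otimes> c) \<noteq> l) \<noteq> (lab (inv \<delta> \<otimes> (c \<otimes> h)) \<noteq> l)"
        by (auto simp: S_def)
      have ih: "inv h \<in> Gs i" using subgroup.m_inv_closed[OF sub] mult by auto
      have e: "c \<otimes> h \<otimes> inv h = c" using h mult by (simp add: m_assoc)
      have ch: "c \<otimes> h \<in> carrier G" using h mult.prems by simp
      have "\<delta> = c \<and> i = l \<or> \<delta> = c \<otimes> h \<and> i = l"
      proof (cases "lab (inv \<delta> \<otimes> c) \<noteq> l")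
        case True
        then show ?thesis using lab_lcos_const[OF l(1,2) mult.prems mult.hyps(1,2) True] l(3) by blast
      next
        case False
        then have "lab (inv \<delta> \<otimes> (c \<otimes> h)) \<noteq> l" using l(3) by blast
        from lab_lcos_const[OF l(1,2) ch mult.hyps(1) ih this] False show ?thesis unfolding e by blast
      qed
      then show "(l, \<delta>) \<in> {(i, c), (i, c \<otimes> h)}" by blast
    qed
    then have "finite (S c (c \<otimes> h))" by (rule finite_subset) simp
    moreover have "finite (S (c \<otimes> h) (c \<otimes> h \<otimes> g))" using mult.IH[of "c \<otimes> h"] mult.prems h by simp
    ultimately have "finite (S c (c \<otimes> h) \<union> S (c \<otimes> h) (c \<otimes> h \<otimes> g))" by simp
    moreover have "c \<otimes> (h \<otimes> g) = c \<otimes> h \<otimes> g" using h mult.prems mult.hyps(3) by (simp add: m_assoc)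
    ultimately show ?case using tri[of c "c \<otimes> (h \<otimes> g)" "c \<otimes> h"] finite_subset by metis
  qed
  from this[of "inv c \<otimes> c'" c] assms have "finite (S c c')" by (simp add: m_assoc[symmetric])
  then show ?thesis by (simp add: S_def)
qed

lemma finite_side_sep:
  assumes H: "conj_sys H" and ij: "i \<le> n" "j \<le> n"
  shows "finite {\<epsilon> \<in> {1..n} \<times> carrier G. side H \<epsilon> i \<noteq> side H \<epsilon> j}"
proof -
  obtain c c' where c: "c \<in> pos H i" "c' \<in> pos H j" using pos_nonempty[OF H] ij by blast
  have cc: "c \<in> carrier G" "c' \<in> carrier G" using c pos_carrier by auto
  \<comment> \<open>A single element \<open>c\<close> of the coset decides the side, except for the
    edge \<open>(i, c)\<close> that joins \<open>c\<close> to the coset vertex itself.\<close>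
  have one: "side H (l, \<delta>) i = (lab (inv \<delta> \<otimes> c) \<noteq> l) \<or> (l, \<delta>) = (i, c)"
    if l: "l \<in> {1..n}" "\<delta> \<in> carrier G" and c: "c \<in> pos H i" and i: "i \<le> n" for l \<delta> i c
  proof (cases "i = 0")
    case True then show ?thesis using c by (auto simp: side_def pos_def)
  next
    case False
    then have i': "i \<in> {1..n}" using i by auto
    show ?thesis
    proof (rule disjCI)
      assume n: "(l, \<delta>) \<noteq> (i, c)"
      have "lab (inv \<delta> \<otimes> d) \<noteq> l" if "d \<in> pos H i" "lab (inv \<delta> \<otimes> c) \<noteq> l" for d
        using that lab_lcos_const[OF l pos_carrier[OF c] i'] n unfolding pos_lcos[OF i' c] by (auto simp: lcos_def)
      then show "side H (l, \<delta>) i = (lab (inv \<delta> \<otimes> c) \<noteq> l)" using c by (auto simp: side_def)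
    qed
  qed
  have "{\<epsilon> \<in> {1..n} \<times> carrier G. side H \<epsilon> i \<noteq> side H \<epsilon> j} \<subseteq> {(i, c), (j, c')} \<union>
    {(l, \<delta>). l \<in> {1..n} \<and> \<delta> \<in> carrier G \<and> (lab (inv \<delta> \<otimes> c) \<noteq> l) \<noteq> (lab (inv \<delta> \<otimes> c') \<noteq> l)}"
  proof
    fix \<epsilon> assume a: "\<epsilon> \<in> {\<epsilon> \<in> {1..n} \<times> carrier G. side H \<epsilon> i \<noteq> side H \<epsilon> j}"
    obtain l \<delta> where "\<epsilon> = (l, \<delta>)" by (cases \<epsilon>)
    then show "\<epsilon> \<in> {(i, c), (j, c')} \<union> {(l, \<delta>). l \<in> {1..n} \<and> \<delta> \<in> carrier G \<and> (lab (inv \<delta> \<otimes> c) \<noteq> l) \<noteq> (lab (inv \<delta> \<otimes> c') \<noteq> l)}"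
      using a one[of l \<delta> c i] one[of l \<delta> c' j] c ij by auto
  qed
  then show ?thesis using finite_sep_centres[OF cc] finite_subset by blast
qed

text \<open>Ping-pong on the reduced words in the basis \<open>H\<close>.\<close>

lemma basis_unique_if_R0_total:
  assumes H: "conj_sys H" and fp: "internal_free_product G H n"
    and R: "\<And>k i j. k \<le> n \<Longrightarrow> i \<le> n \<Longrightarrow> j \<le> n \<Longrightarrow> i \<noteq> k \<Longrightarrow> j \<noteq> k \<Longrightarrow> R0 H k i j"
    and i: "i \<in> {1..n}"
  shows "H i = Gs i"
proof -
  interpret h: free_product G H n using fp by unfold_locales
  define c where "c k = dirn H k 0" for k
  have cpos: "c k \<in> pos H k" "c k \<in> carrier G" if "k \<in> {1..n}" for k
    using dirn(1)[OF H that, of 0] that pos_carrier by (auto simp: c_def)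
  have sep: "lab (inv (c k) \<otimes> d) \<noteq> k" if "k \<in> {1..n}" "j \<le> n" "j \<noteq> k" "d \<in> pos H j" for k j d
  proof -
    have "R0 H k j 0" using R[of k j 0] that by auto
    then have "dirn H k j = c k" using that by (auto simp: R0_def c_def)
    then show ?thesis using dirn(2)[OF H that] by simp
  qed
  \<comment> \<open>A nonempty reduced word in \<open>H\<close> with first label \<open>k\<close>
    has its value in the half-tree beyond the edge \<open>(k, c k)\<close>.\<close>
  have start: "lab (inv (c (fst (hd ws))) \<otimes> h.val ws) = fst (hd ws)" if "h.rw ws" "ws \<noteq> []" for ws
    using that
  proof (induction ws)
    case (Cons p ws)
    define k where "k = fst p"
    have p: "k \<in> {1..n}" "snd p \<in> H k" "snd p \<noteq> \<one>" "h.rw ws" "ws = [] \<or> k \<noteq> fst (hd ws)"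
      using Cons.prems by (auto simp: h.rw_Cons k_def)
    have ck: "c k \<in> carrier G" "H k = cjset (c k) (Gs k)" using cpos[OF p(1)] p(1) by (auto simp: pos_def)
    obtain x where x: "x \<in> Gs k" "snd p = c k \<otimes> x \<otimes> inv (c k)" using p ck by (auto simp: cjset_def)
    have xc: "x \<in> carrier G" using Hs_carrier[OF p(1) x(1)] .
    have xn: "x \<noteq> \<one>" using x p ck by auto
    have vw: "h.val ws \<in> carrier G" using h.rw_letters[OF p(4)] by simp
    define y where "y = inv (c k) \<otimes> h.val ws"
    have y: "y \<in> carrier G" using ck vw by (simp add: y_def)
    have ly: "lab y \<noteq> k"
    proof (cases "ws = []")
      case True
      then show ?thesis using sep[OF p(1), of 0 \<one>] p(1) ck by (auto simp: y_def pos_def)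
    next
      case False
      define l where "l = fst (hd ws)"
      have l: "l \<in> {1..n}" "l \<noteq> k" using p(4,5) False by (cases ws; auto simp: l_def h.rw_Cons)+
      have cl: "c l \<in> carrier G" using cpos[OF l(1)] by simp
      define d where "d = inv (c l) \<otimes> c k"
      have d: "d \<in> carrier G" "inv d = inv (c k) \<otimes> c l" using cl ck by (auto simp: d_def inv_mult_group)
      have v: "inv (c l) \<otimes> h.val ws \<in> carrier G" "lab (inv (c l) \<otimes> h.val ws) = l"
        using Cons.IH[OF p(4) False] cl vw by (auto simp: l_def)
      have e: "y = inv d \<otimes> (inv (c l) \<otimes> h.val ws)"
      proof -
        have "inv (c k) \<otimes> c l \<otimes> (inv (c l) \<otimes> h.val ws) = inv (c k) \<otimes> (c l \<otimes> inv (c l)) \<otimes> h.val ws"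
          using cl ck vw by (simp only: m_assoc inv_closed m_closed)
        then show ?thesis using cl ck vw d by (simp add: y_def)
      qed
      show ?thesis
      proof (cases "d = \<one>")
        case True then show ?thesis using e v l by simp
      next
        case dn: False
        have "lab d \<noteq> l" using sep[OF l(1), of k "c k"] cpos[OF p(1)] p(1) l by (auto simp: d_def)
        then have "lab y = lab (inv d)" using lab_no_cancel[OF d(1) v(1) dn] v e by simp
        then show ?thesis using sep[OF p(1), of l "c l"] cpos[OF l(1)] l d by auto
      qed
    qed
    have "inv (c k) \<otimes> h.val (p # ws) = x \<otimes> y"
    proof -
      have "inv (c k) \<otimes> (c k \<otimes> x \<otimes> inv (c k) \<otimes> h.val ws) = (inv (c k) \<otimes> c k) \<otimes> x \<otimes> (inv (c k) \<otimes> h.val ws)"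
        using ck xc vw by (simp only: m_assoc inv_closed m_closed)
      then show ?thesis using ck xc vw x by (simp add: y_def)
    qed
    moreover have "lab (x \<otimes> y) = k"
    proof -
      have ix: "inv x \<in> Gs k" "inv x \<noteq> \<one>" "inv x \<in> carrier G" using subgroup.m_inv_closed[OF sub[OF p(1)] x(1)] xc xn by auto
      have "lab (inv (inv x) \<otimes> y) = lab (inv (inv x))"
        using lab_no_cancel[OF ix(3) y ix(2)] lab_letter[OF p(1) ix(1,2)] ly by simp
      then show ?thesis using xc lab_letter[OF p(1) x(1) xn] by simp
    qed
    ultimately show ?case by (simp add: k_def)
  qed simp
  \<comment> \<open>A nontrivial letter \<open>x\<close> of the given factor also has a reduced word
    in \<open>H\<close>. Its first label \<open>k\<close> puts \<open>x\<close> beyond the edge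
    \<open>(k, c k)\<close>, whereas \<open>\<one>\<close> is on the near side. As
    \<open>\<one>\<close> and \<open>x\<close> are neighbours of one coset vertex,
    \<open>c k = \<one>\<close> and \<open>k = i\<close>.\<close>
  obtain x where x: "x \<in> Gs i" "x \<noteq> \<one>" using letter_ex[OF i] .
  have xc: "x \<in> carrier G" using Hs_carrier[OF i x(1)] .
  define k where "k = fst (hd (h.nf x))"
  have ne: "h.nf x \<noteq> []" using h.nf_Nil[OF xc] x by simp
  have k: "k \<in> {1..n}" using h.nf(1)[OF xc] ne by (cases "h.nf x") (auto simp: k_def h.rw_Cons)
  have "lab (inv (c k) \<otimes> x) = k" using start[OF h.nf(1)[OF xc] ne] h.nf(2)[OF xc] by (simp add: k_def)
  moreover have "lab (inv (c k)) \<noteq> k" using sep[OF k, of 0 \<one>] k cpos[OF k] by (auto simp: pos_def)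
  ultimately have "inv (c k) = \<one> \<and> i = k" using lab_right_mult[of "inv (c k)" i x k] cpos[OF k] i x k by auto
  then have "\<one> \<in> pos H i" using cpos[OF k] by (metis inv_eq_1_iff)
  then show ?thesis using i Gs_sub[OF i] by (auto simp: pos_def cjset_one)
qed

end

text \<open>\<open>compat\<close> and \<open>root\<close> are positive in the relation, so they
  survive weakening; only the equivalence properties must be checked.\<close>

lemma (in sep_family) coarsening:
  assumes "\<And>k i j. R k i j \<Longrightarrow> C k i j"
    and "\<And>k i j. C k i j \<Longrightarrow> k \<le> n \<and> i \<le> n \<and> j \<le> n \<and> i \<noteq> k \<and> j \<noteq> k"
    and "\<And>k i j. C k i j \<Longrightarrow> C k j i" "\<And>k i j l. C k i j \<Longrightarrow> C k j l \<Longrightarrow> C k i l"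
  shows "sep_family n C"
proof (rule sep_family.intro)
  fix k l i assume h: "k \<le> n" "l \<le> n" "i \<le> n" "k \<noteq> l" "i \<noteq> k" "i \<noteq> l"
  show "C k i l \<or> C l i k" using compat[OF h] assms(1) by blast
next
  fix k i assume "k \<le> n" "i \<le> n" "i \<noteq> k" then show "C k i i" using rfl assms(1) by blast
next
  fix i j assume "i \<le> n" "j \<le> n" "i \<noteq> 0" "j \<noteq> 0" then show "C 0 i j" using root assms(1) by blast
qed (fact assms)+

section \<open>The level function and its behaviour under folding\<close>

context reference_product
begin

text \<open>Incidences between edges of the Bass--Serre tree and spanned subtrees: an edge lies in
  the subtree spanned by \<open>e\<close> when it has members of \<open>e\<close> on both sides. It
  counts once for each such hyperedge.\<close>

definition sepset :: "(nat \<Rightarrow> 'a set) \<Rightarrow> (nat \<Rightarrow> nat \<Rightarrow> nat \<Rightarrow> bool) \<Rightarrow> ((nat \<times> 'a) \<times> nat set) set" where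
  "sepset H R = {(\<epsilon>, e). \<epsilon> \<in> {1..n} \<times> carrier G \<and> e \<in> hyperedges n R \<and> (\<exists>a\<in>e. \<exists>b\<in>e. side H \<epsilon> a \<noteq> side H \<epsilon> b)}"

text \<open>The pairs of \<open>{1..n} \<times> carrier G\<close> are the edges of the Bass--Serre tree of the given splitting, and
  \<open>Lam H R\<close> is the total number of edges of the subtrees spanned by the hyperedges of \<open>R\<close>.\<close>

definition Lam :: "(nat \<Rightarrow> 'a set) \<Rightarrow> (nat \<Rightarrow> nat \<Rightarrow> nat \<Rightarrow> bool) \<Rightarrow> nat" where
  "Lam H R = card (sepset H R)"

text \<open>The effect of an identification on positions: one translation per hyperedge, with
  different hyperedges free to move differently. Hence class invariants are computed one hyperedge
  at a time.\<close>

definition loc :: "(nat \<Rightarrow> nat \<Rightarrow> nat \<Rightarrow> bool) \<Rightarrow> (nat \<Rightarrow> 'a set) \<Rightarrow> (nat \<Rightarrow> 'a set) \<Rightarrow> bool" where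
  "loc R H H' \<longleftrightarrow> (\<forall>e\<in>hyperedges n R. \<exists>g\<in>carrier G. \<forall>j\<in>e. pos H' j = (\<lambda>c. g \<otimes> c) ` pos H j)"

text \<open>Two edges at \<open>pos H k\<close> are aligned if they point in the same direction of the Bass--Serre tree.
  \<open>NA H R R'\<close> says that passing from \<open>R'\<close> to the coarser tree \<open>R\<close> folds only non-aligned edges, which
  keeps \<open>Lam\<close>. \<open>Mrel H R\<close> is the largest tree above \<open>R\<close> with the same \<open>Lam\<close>, the \<open>flat\<close> trees are
  those with \<open>Mrel H R = R\<close>, and \<open>proj H A B\<close> undoes the foldings of non-aligned edges of \<open>A\<close> in \<open>B\<close>.\<close>

definition NA :: "(nat \<Rightarrow> 'a set) \<Rightarrow> (nat \<Rightarrow> nat \<Rightarrow> nat \<Rightarrow> bool) \<Rightarrow> (nat \<Rightarrow> nat \<Rightarrow> nat \<Rightarrow> bool) \<Rightarrow> bool" where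
  "NA H R R' \<longleftrightarrow> (\<forall>k a b. nbr n R' k a \<and> nbr n R' k b \<and> R k a b \<and> \<not> R' k a b \<longrightarrow> \<not> R0 H k a b)"

definition Mrel :: "(nat \<Rightarrow> 'a set) \<Rightarrow> (nat \<Rightarrow> nat \<Rightarrow> nat \<Rightarrow> bool) \<Rightarrow> nat \<Rightarrow> nat \<Rightarrow> nat \<Rightarrow> bool" where
  "Mrel H R k i j \<longleftrightarrow> R k i j \<and> R0 H k (toward n R k i) (toward n R k j)"

definition flat :: "(nat \<Rightarrow> 'a set) \<Rightarrow> (nat \<Rightarrow> nat \<Rightarrow> nat \<Rightarrow> bool) \<Rightarrow> bool" where
  "flat H R \<longleftrightarrow> (\<forall>k i j. nbr n R k i \<and> nbr n R k j \<and> R k i j \<longrightarrow> R0 H k i j)"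

definition proj :: "(nat \<Rightarrow> 'a set) \<Rightarrow> (nat \<Rightarrow> nat \<Rightarrow> nat \<Rightarrow> bool) \<Rightarrow> (nat \<Rightarrow> nat \<Rightarrow> nat \<Rightarrow> bool) \<Rightarrow> nat \<Rightarrow> nat \<Rightarrow> nat \<Rightarrow> bool" where
  "proj H A B k i j \<longleftrightarrow> B k i j \<and> R0 H k (toward n A k i) (toward n A k j)"

text \<open>Unlike in \<open>flat\<close>, edges in different petals at \<open>k\<close> are
  compared too. This property is not invariant under \<open>loc\<close>; \<open>align_exists\<close>
  arranges it by rotations about the labels.\<close>

definition aligned :: "(nat \<Rightarrow> nat \<Rightarrow> nat \<Rightarrow> bool) \<Rightarrow> (nat \<Rightarrow> 'a set) \<Rightarrow> bool" where
  "aligned A H \<longleftrightarrow> (\<forall>k i j. k \<le> n \<and> i \<le> n \<and> j \<le> n \<and> i \<noteq> k \<and> j \<noteq> k \<longrightarrow> R0 H k (toward n A k i) (toward n A k j))"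

lemma finite_sepset:
  assumes H: "conj_sys H" and R: "sep_family n R"
  shows "finite (sepset H R)"
proof -
  interpret sep_family n R by fact
  have "sepset H R \<subseteq> (\<Union>a\<in>{0..n}. \<Union>b\<in>{0..n}. {\<epsilon> \<in> {1..n} \<times> carrier G. side H \<epsilon> a \<noteq> side H \<epsilon> b}) \<times> hyperedges n R"
  proof
    fix z assume z: "z \<in> sepset H R"
    obtain \<epsilon> e where ze: "z = (\<epsilon>, e)" by (cases z)
    then obtain a b where h: "\<epsilon> \<in> {1..n} \<times> carrier G" "e \<in> hyperedges n R" "a \<in> e" "b \<in> e" "side H \<epsilon> a \<noteq> side H \<epsilon> b"
      using z by (auto simp: sepset_def)
    have "a \<in> {0..n}" "b \<in> {0..n}" using h hyperedge_subset[OF h(2)] by blast+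
    then show "z \<in> (\<Union>a\<in>{0..n}. \<Union>b\<in>{0..n}. {\<epsilon> \<in> {1..n} \<times> carrier G. side H \<epsilon> a \<noteq> side H \<epsilon> b}) \<times> hyperedges n R"
      unfolding ze using h by blast
  qed
  moreover have "finite (\<Union>a\<in>{0..n}. \<Union>b\<in>{0..n}. {\<epsilon> \<in> {1..n} \<times> carrier G. side H \<epsilon> a \<noteq> side H \<epsilon> b})"
    by (rule finite_UN_I[OF finite_atLeastAtMost], rule finite_UN_I[OF finite_atLeastAtMost],
        rule finite_side_sep[OF H]) simp_all
  ultimately show ?thesis by (rule finite_subset[OF _ finite_cartesian_product[OF _ finite_hyperedges]])
qed

lemma locE:
  assumes "loc R H H'" "e \<in> hyperedges n R"
  obtains g where "g \<in> carrier G" "\<forall>j\<in>e. pos H' j = (\<lambda>c. g \<otimes> c) ` pos H j"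
  using bspec[OF assms(1)[unfolded loc_def] assms(2)] by (rule bexE)

lemma locI:
  assumes "\<And>e. e \<in> hyperedges n R \<Longrightarrow> \<exists>g\<in>carrier G. \<forall>j\<in>e. pos H' j = (\<lambda>c. g \<otimes> c) ` pos H j"
  shows "loc R H H'"
  unfolding loc_def by (rule ballI) (rule assms)

lemma loc_sym: assumes l: "loc R H H'" shows "loc R H' H"
proof (rule locI)
  fix e assume e: "e \<in> hyperedges n R"
  obtain g where g0: "g \<in> carrier G" "\<forall>j\<in>e. pos H' j = (\<lambda>c. g \<otimes> c) ` pos H j" using locE[OF l e] .
  note g = g0(1) bspec[OF g0(2)]
  have "pos H j = (\<lambda>c. inv g \<otimes> c) ` pos H' j" if "j \<in> e" for j
  proof -
    have "(\<lambda>c. inv g \<otimes> c) ` pos H' j = (\<lambda>c. inv g \<otimes> (g \<otimes> c)) ` pos H j" unfolding g(2)[OF that] image_image ..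
    also have "\<dots> = (\<lambda>c. c) ` pos H j"
    proof (rule image_cong[OF refl])
      fix c assume "c \<in> pos H j"
      then have "c \<in> carrier G" by (rule pos_carrier)
      then show "inv g \<otimes> (g \<otimes> c) = c" using g(1) by (simp add: m_assoc[symmetric])
    qed
    finally show ?thesis by simp
  qed
  then show "\<exists>g\<in>carrier G. \<forall>j\<in>e. pos H j = (\<lambda>c. g \<otimes> c) ` pos H' j"
    by (intro bexI[OF _ inv_closed[OF g(1)]] ballI)
qed

text \<open>Incidences are translated hyperedge by hyperedge. The hyperedge is kept in the pair, so
  the map stays injective although the translating elements differ.\<close>

lemma Lam_loc_le:
  assumes H: "conj_sys H'" and R: "sep_family n R" and l: "loc R H H'"
  shows "Lam H R \<le> Lam H' R"
proof -
  define \<gamma> where "\<gamma> e = (SOME g. g \<in> carrier G \<and> (\<forall>j\<in>e. pos H' j = (\<lambda>c. g \<otimes> c) ` pos H j))" for e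
  have gg: "\<gamma> e \<in> carrier G \<and> (\<forall>j\<in>e. pos H' j = (\<lambda>c. \<gamma> e \<otimes> c) ` pos H j)" if e: "e \<in> hyperedges n R" for e
    unfolding \<gamma>_def
  proof (rule someI_ex)
    obtain g where "g \<in> carrier G" "\<forall>j\<in>e. pos H' j = (\<lambda>c. g \<otimes> c) ` pos H j" using locE[OF l e] .
    then show "\<exists>g. g \<in> carrier G \<and> (\<forall>j\<in>e. pos H' j = (\<lambda>c. g \<otimes> c) ` pos H j)" by (intro exI conjI)
  qed
  have g: "\<gamma> e \<in> carrier G" "j \<in> e \<Longrightarrow> pos H' j = (\<lambda>c. \<gamma> e \<otimes> c) ` pos H j" if "e \<in> hyperedges n R" for e j
    using conjunct1[OF gg[OF that]] bspec[OF conjunct2[OF gg[OF that]]] by simp_all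
  let ?f = "\<lambda>(\<epsilon>::nat \<times> 'a, e). ((fst \<epsilon>, \<gamma> e \<otimes> snd \<epsilon>), e)"
  show ?thesis unfolding Lam_def
  proof (rule card_inj_on_le[of ?f])
    show "inj_on ?f (sepset H R)"
    proof (rule inj_onI)
      fix z z' assume a: "z \<in> sepset H R" "z' \<in> sepset H R" "?f z = ?f z'"
      obtain l d e where z: "z = ((l, d), e)" by (metis prod.collapse)
      obtain l' d' e' where z': "z' = ((l', d'), e')" by (metis prod.collapse)
      have q: "l = l'" "e = e'" "\<gamma> e \<otimes> d = \<gamma> e \<otimes> d'" using a(3) unfolding z z' by auto
      have "e \<in> hyperedges n R" "d \<in> carrier G" "d' \<in> carrier G" using a(1,2) by (auto simp: sepset_def z z')
      then show "z = z'" using q g(1)[of e] by (simp add: z z')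
    qed
    have "?f z \<in> sepset H' R" if zs: "z \<in> sepset H R" for z
    proof -
      obtain l d e where z: "z = ((l, d), e)" by (metis prod.collapse)
      then obtain a b where h: "l \<in> {1..n}" "d \<in> carrier G" "e \<in> hyperedges n R" "a \<in> e" "b \<in> e" "side H (l, d) a \<noteq> side H (l, d) b"
        using zs by (auto simp: sepset_def)
      have "side H' (l, \<gamma> e \<otimes> d) j = side H (l, d) j" if "j \<in> e" for j
        using side_translate[OF g(1)[OF h(3)] g(2)[OF h(3) that], of "(l, d)"] h by simp
      then have "side H' (l, \<gamma> e \<otimes> d) a \<noteq> side H' (l, \<gamma> e \<otimes> d) b" using h by simp
      then show ?thesis using h g(1)[OF h(3)] unfolding sepset_def z by auto
    qed
    then show "?f ` sepset H R \<subseteq> sepset H' R" by blast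
    show "finite (sepset H' R)" using finite_sepset[OF H R] .
  qed
qed

lemma Lam_loc:
  assumes "conj_sys H" "conj_sys H'" "sep_family n R" "loc R H H'"
  shows "Lam H R = Lam H' R"
  using Lam_loc_le[OF assms(2,3,4)] Lam_loc_le[OF assms(1,3) loc_sym[OF assms(4)]] by simp

text \<open>The three labels lie in one hyperedge and are translated together.\<close>

lemma R0_loc:
  assumes H: "conj_sys H" and R: "sep_family n R" and l: "loc R H H'" and n: "nbr n R k i" "nbr n R k j" "R k i j"
  shows "R0 H' k i j = R0 H k i j"
proof -
  interpret sep_family n R by fact
  have e: "hedge n R k i \<in> hyperedges n R" using hedge_in n by simp
  obtain g where g0: "g \<in> carrier G" "\<forall>j\<in>hedge n R k i. pos H' j = (\<lambda>c. g \<otimes> c) ` pos H j" using locE[OF l e] .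
  note g = g0(1) bspec[OF g0(2)]
  have m: "k \<in> hedge n R k i" "i \<in> hedge n R k i" "j \<in> hedge n R k i"
    using hedge_nbr_mem[OF n(1)] n by (auto simp: hedge_def)
  show ?thesis
  proof (rule R0_translate[OF H g(1)])
    fix x assume "x \<in> {k, i, j}"
    then show "pos H' x = (\<lambda>c. g \<otimes> c) ` pos H x" using m by (intro g(2)) auto
  qed
qed

lemma Mrel_loc:
  assumes H: "conj_sys H" and R: "sep_family n R" and l: "loc R H H'"
  shows "Mrel H' R = Mrel H R"
proof (intro ext)
  interpret sep_family n R by fact
  fix k i j
  show "Mrel H' R k i j = Mrel H R k i j"
  proof (cases "R k i j")
    case True
    note d = dom[OF True]
    have t: "R k (toward n R k i) (toward n R k j)"
      using toward_R[of k i] toward_R[of k j] True d sm trn by meson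
    then show ?thesis using R0_loc[OF H R l toward(1)[of k i] toward(1)[of k j] t] d True by (simp add: Mrel_def)
  qed (simp add: Mrel_def)
qed

lemma flat_loc:
  assumes H: "conj_sys H" and R: "sep_family n R" and l: "loc R H H'" and f: "flat H R"
  shows "flat H' R"
  using f R0_loc[OF H R l] unfolding flat_def by blast

text \<open>The first vertices in \<open>A\<close> towards \<open>i\<close> and \<open>j\<close> lie
  in one hyperedge of \<open>B\<close> at \<open>k\<close>, so \<open>R0_loc\<close> applies to
  them.\<close>

lemma proj_loc:
  assumes H: "conj_sys H" and r: "sep_refine n B A" and l: "loc B H H'"
  shows "proj H' A B = proj H A B"
proof (intro ext)
  interpret sep_refine n B A by fact
  fix k i j
  show "proj H' A B k i j = proj H A B k i j"
  proof (cases "B k i j")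
    case True
    note d = c.dom[OF True]
    have n: "nbr n B k (toward n A k i)" "nbr n B k (toward n A k j)" using f.toward(1) nbr_coarse d by simp_all
    have b: "B k (toward n A k i) i" "B k (toward n A k j) j" using f.toward_R finer d by simp_all
    have "B k (toward n A k i) (toward n A k j)" using b True c.sm c.trn by blast
    then show ?thesis using R0_loc[OF H c.sep_family_axioms l n] True by (simp add: proj_def)
  qed (simp add: proj_def)
qed

text \<open>An edge crossing \<open>e\<close> crosses some fine hyperedge inside \<open>e\<close> by
  \<open>bichromatic_refine\<close>. A fine hyperedge has two members and so lies in only one coarse
  hyperedge.\<close>

lemma Lam_mono_inj:
  assumes H: "conj_sys H" and r: "sep_refine n R R'"
  obtains F where "\<And>\<epsilon> e. (\<epsilon>, e) \<in> sepset H R \<Longrightarrow> (\<epsilon>, F \<epsilon> e) \<in> sepset H R' \<and> F \<epsilon> e \<subseteq> e"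
    "inj_on (\<lambda>(\<epsilon>, e). (\<epsilon>, F \<epsilon> e)) (sepset H R)"
proof -
  interpret sep_refine n R R' by fact
  have "\<exists>f. (\<epsilon>, f) \<in> sepset H R' \<and> f \<subseteq> e" if z: "(\<epsilon>, e) \<in> sepset H R" for \<epsilon> e
  proof -
    obtain a b where h: "\<epsilon> \<in> {1..n} \<times> carrier G" "e \<in> hyperedges n R" "a \<in> e" "b \<in> e" "side H \<epsilon> a \<noteq> side H \<epsilon> b"
      using z by (auto simp: sepset_def)
    then show ?thesis using bichromatic_refine[OF h(2-4), of "side H \<epsilon>"] by (auto simp: sepset_def)
  qed
  then obtain F where F: "\<And>\<epsilon> e. (\<epsilon>, e) \<in> sepset H R \<Longrightarrow> (\<epsilon>, F \<epsilon> e) \<in> sepset H R' \<and> F \<epsilon> e \<subseteq> e" by metis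
  have "inj_on (\<lambda>(\<epsilon>, e). (\<epsilon>, F \<epsilon> e)) (sepset H R)"
  proof (rule inj_onI)
    fix z z' assume zz: "z \<in> sepset H R" "z' \<in> sepset H R" "(\<lambda>(\<epsilon>, e). (\<epsilon>, F \<epsilon> e)) z = (\<lambda>(\<epsilon>, e). (\<epsilon>, F \<epsilon> e)) z'"
    obtain \<epsilon> e e' where z: "z = (\<epsilon>, e)" "z' = (\<epsilon>, e')" using zz(3) by (cases z; cases z') auto
    have a: "(\<epsilon>, e) \<in> sepset H R" "(\<epsilon>, e') \<in> sepset H R" "F \<epsilon> e = F \<epsilon> e'" using zz by (simp_all add: z)
    have f: "F \<epsilon> e \<in> hyperedges n R'" "F \<epsilon> e \<subseteq> e" "F \<epsilon> e \<subseteq> e'" using F[OF a(1)] F[OF a(2)] a(3) by (auto simp: sepset_def)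
    obtain x y where "x \<in> F \<epsilon> e" "y \<in> F \<epsilon> e" "x \<noteq> y" using f.hyperedge_two[OF f(1)] by metis
    moreover have "e \<in> hyperedges n R" "e' \<in> hyperedges n R" using a by (auto simp: sepset_def)
    ultimately have "e = e'" using c.hyperedges_eqI[of e e' x y] f by blast
    then show "z = z'" by (simp add: z)
  qed
  then show ?thesis using that F by blast
qed

lemma Lam_mono:
  assumes H: "conj_sys H" and r: "sep_refine n R R'"
  shows "Lam H R \<le> Lam H R'"
proof -
  interpret sep_refine n R R' by fact
  obtain F where F: "\<And>\<epsilon> e. (\<epsilon>, e) \<in> sepset H R \<Longrightarrow> (\<epsilon>, F \<epsilon> e) \<in> sepset H R' \<and> F \<epsilon> e \<subseteq> e"
    "inj_on (\<lambda>(\<epsilon>, e). (\<epsilon>, F \<epsilon> e)) (sepset H R)" using Lam_mono_inj[OF H r] by blast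
  show ?thesis unfolding Lam_def
    by (rule card_inj_on_le[OF F(2)]) (use F(1) finite_sepset[OF H f.sep_family_axioms] in auto)
qed

text \<open>At an aligned fold the edge \<open>\<epsilon>\<close> lies in both subtrees that are
  merged. The injection of \<open>Lam_mono_inj\<close> hits at most one of these two
  incidences.\<close>

lemma Lam_strict:
  assumes H: "conj_sys H" and r: "sep_refine n R R'" and na: "\<not> NA H R R'"
  shows "Lam H R < Lam H R'"
proof -
  interpret sep_refine n R R' by fact
  obtain F where F: "\<And>\<epsilon> e. (\<epsilon>, e) \<in> sepset H R \<Longrightarrow> (\<epsilon>, F \<epsilon> e) \<in> sepset H R' \<and> F \<epsilon> e \<subseteq> e"
    "inj_on (\<lambda>(\<epsilon>, e). (\<epsilon>, F \<epsilon> e)) (sepset H R)" using Lam_mono_inj[OF H r] by blast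
  obtain k a b where kab: "nbr n R' k a" "nbr n R' k b" "R k a b" "\<not> R' k a b" "R0 H k a b"
    using na unfolding NA_def by blast
  have le: "k \<le> n" "a \<le> n" "b \<le> n" "a \<noteq> k" "b \<noteq> k" using kab by (auto simp: nbr_def)
  have "k \<noteq> 0"
  proof
    assume "k = 0" then show False using f.root[OF le(2,3)] kab(4) le(4,5) by simp
  qed
  then have k: "k \<in> {1..n}" using le by auto
  define \<epsilon> where "\<epsilon> = (k, dirn H k a)"
  have eb: "\<epsilon> = (k, dirn H k b)" using kab(5) \<open>k \<noteq> 0\<close> by (auto simp: \<epsilon>_def R0_def)
  have ev: "\<epsilon> \<in> {1..n} \<times> carrier G" using k dirn(1)[OF H k le(2,4)] pos_carrier by (auto simp: \<epsilon>_def)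
  have sd: "side H \<epsilon> a" "side H \<epsilon> b" "\<not> side H \<epsilon> k"
    using side_dirn[OF H k le(2,4)] side_dirn[OF H k le(3,5)] eb by (auto simp: \<epsilon>_def)
  let ?f = "hedge n R' k a" and ?f' = "hedge n R' k b"
  have fm: "k \<in> ?f" "a \<in> ?f" "k \<in> ?f'" "b \<in> ?f'" using f.hedge_nbr_mem kab by auto
  have s: "(\<epsilon>, ?f) \<in> sepset H R'" "(\<epsilon>, ?f') \<in> sepset H R'"
    using f.hedge_in kab(1,2) fm sd ev unfolding sepset_def by blast+
  have ne: "?f \<noteq> ?f'"
  proof
    assume "?f = ?f'"
    then have "b \<in> ?f" using fm by simp
    then show False using kab(4) le by (simp add: hedge_def)
  qed
  let ?e = "hedge n R k a"
  have en: "nbr n R k a" "nbr n R k b" using nbr_coarse kab by auto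
  have eE: "?e \<in> hyperedges n R" using c.hedge_in en by simp
  have em: "k \<in> ?e" "a \<in> ?e" "b \<in> ?e" using c.hedge_nbr_mem[OF en(1)] en kab(3) by (auto simp: hedge_def)
  let ?g = "\<lambda>(\<epsilon>, e). (\<epsilon>, F \<epsilon> e)"
  have "\<not> ((\<epsilon>, ?f) \<in> ?g ` sepset H R \<and> (\<epsilon>, ?f') \<in> ?g ` sepset H R)"
  proof
    assume "(\<epsilon>, ?f) \<in> ?g ` sepset H R \<and> (\<epsilon>, ?f') \<in> ?g ` sepset H R"
    then obtain e1 e2 where e: "(\<epsilon>, e1) \<in> sepset H R" "?f = F \<epsilon> e1" "(\<epsilon>, e2) \<in> sepset H R" "?f' = F \<epsilon> e2" by auto
    have sub: "?f \<subseteq> e1" "?f' \<subseteq> e2" using F(1)[OF e(1)] F(1)[OF e(3)] e(2,4) by simp_all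
    have mem: "e1 \<in> hyperedges n R" "e2 \<in> hyperedges n R" using e(1,3) by (auto simp: sepset_def)
    have "e1 = ?e" using c.hyperedges_eqI[OF mem(1) eE, of k a] sub fm em le by blast
    moreover have "e2 = ?e" using c.hyperedges_eqI[OF mem(2) eE, of k b] sub fm em le by blast
    ultimately show False using e ne by simp
  qed
  then have "?g ` sepset H R \<subset> sepset H R'" using s F(1) by auto
  then have "card (?g ` sepset H R) < card (sepset H R')"
    by (rule psubset_card_mono[OF finite_sepset[OF H f.sep_family_axioms]])
  then show ?thesis using card_image[OF F(2)] by (simp add: Lam_def)
qed

text \<open>Induction along the fine path. At the next fine vertex \<open>a\<close> the fold is not
  aligned, so \<open>a\<close> separates \<open>k\<close> from \<open>i\<close> in the Bass--Serre
  tree as well, and \<open>compat\<close> for \<open>R0\<close> gives the claim at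
  \<open>k\<close>.\<close>

lemma R0_toward_fine:
  assumes H: "conj_sys H" and r: "sep_refine n R R'" and na: "NA H R R'" and ki: "nbr n R k i"
  shows "R0 H k (toward n R' k i) i"
  using ki
proof (induction "card (btw n R' k i)" arbitrary: k rule: less_induct)
  case less
  interpret sep_refine n R R' by fact
  interpret z: sep_family n "R0 H" using R0_sep_family[OF H] .
  have le: "k \<le> n" "i \<le> n" "i \<noteq> k" using less.prems by (auto simp: nbr_def)
  define a where "a = toward n R' k i"
  have a: "nbr n R' k a" "a = i \<or> a \<in> btw n R' k i" using f.toward[OF le] by (auto simp: a_def)
  show ?case
  proof (cases "a = i")
    case True
    then show ?thesis using z.rfl le by (simp add: a_def)
  next
    case False
    then have ab: "a \<in> btw n R' k i" using a by simp
    have an: "a \<le> n" "a \<noteq> k" "\<not> R' a k i" using ab by (auto simp: btw_def)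
    have nn: "nbr n R a i" using btw_fine_nbr(2)[OF less.prems ab] .
    define t where "t = toward n R' a i"
    have t: "nbr n R' a t" "R' a t i" using f.toward(1)[of a i] f.toward_R[of a i] an le False by (auto simp: t_def)
    have IH: "R0 H a t i" unfolding t_def
      using less.hyps[OF f.btw_card_less(2)[OF ab le(1,2)] nn] .
    have "R a k i" using less.prems an False by (auto simp: nbr_def)
    then have "R a k t" using finer[OF t(2)] c.sm c.trn by blast
    moreover have "\<not> R' a k t" using an(3) t(2) f.trn by blast
    ultimately have "\<not> R0 H a k t" using na f.nbr_sym[OF a(1)] t(1) unfolding NA_def by blast
    then have "\<not> R0 H a k i" using IH z.trn z.sm by blast
    then have "\<not> R0 H a i k" using z.sm by blast
    then have "R0 H k i a" using z.compat[of k a i] le an False by blast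
    then show ?thesis using z.sm unfolding a_def by blast
  qed
qed

text \<open>\<open>NA\<close> speaks of fine neighbours only; \<open>R0_toward_fine\<close> replaces
  coarse neighbours by the first fine vertices in their directions.\<close>

lemma NA_global:
  assumes H: "conj_sys H" and r: "sep_refine n R R'" and na: "NA H R R'"
    and p: "nbr n R p q" "nbr n R p z" "R p q z" "\<not> R' p q z"
  shows "\<not> R0 H p q z"
proof
  assume r0: "R0 H p q z"
  interpret sep_refine n R R' by fact
  interpret z: sep_family n "R0 H" using R0_sep_family[OF H] .
  let ?a = "toward n R' p q" and ?b = "toward n R' p z"
  have le: "p \<le> n" "q \<le> n" "q \<noteq> p" "z \<le> n" "z \<noteq> p" using p by (auto simp: nbr_def)
  note ta = f.toward(1)[OF le(1-3)] f.toward_R[OF le(1-3)]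
  note tb = f.toward(1)[OF le(1,4,5)] f.toward_R[OF le(1,4,5)]
  have "R p ?a ?b" using finer[OF ta(2)] finer[OF tb(2)] p(3) c.sm c.trn by blast
  moreover have "\<not> R' p ?a ?b" using ta(2) tb(2) p(4) f.sm f.trn by blast
  ultimately have "\<not> R0 H p ?a ?b" using na ta(1) tb(1) unfolding NA_def by blast
  moreover have "R0 H p ?a q" "R0 H p ?b z" using R0_toward_fine[OF H r na] p by auto
  ultimately show False using r0 z.sm z.trn by blast
qed

text \<open>The gate \<open>p\<close> separates \<open>f\<close> from \<open>f'\<close> in the fine
  tree, hence in the Bass--Serre tree by \<open>NA_global\<close>. By \<open>side_convex\<close>, an
  edge crossed inside \<open>f\<close> is not crossed again on the other side of
  \<open>p\<close>.\<close>

lemma NA_one_sep: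
  assumes H: "conj_sys H" and r: "sep_refine n R R'" and na: "NA H R R'"
    and e: "e \<in> hyperedges n R" and f: "f \<in> hyperedges n R'" "f \<subseteq> e" "f' \<in> hyperedges n R'" "f' \<subseteq> e" "f \<noteq> f'"
    and s: "(\<epsilon>, f) \<in> sepset H R'"
  shows "(\<epsilon>, f') \<notin> sepset H R'"
proof -
  interpret sep_refine n R R' by fact
  obtain p where p: "p \<in> f" "\<And>q z. q \<in> f \<Longrightarrow> z \<in> f' \<Longrightarrow> q \<noteq> p \<Longrightarrow> z \<noteq> p \<Longrightarrow> \<not> R' p q z"
    using f.hyperedge_gate[OF f(1,3,5)] by blast
  obtain a b where ab: "\<epsilon> \<in> {1..n} \<times> carrier G" "a \<in> f" "b \<in> f" "side H \<epsilon> a \<noteq> side H \<epsilon> b" using s by (auto simp: sepset_def)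
  obtain q where q: "q \<in> f" "side H \<epsilon> q \<noteq> side H \<epsilon> p" using ab by metis
  have qp: "q \<noteq> p" using q by auto
  have "side H \<epsilon> z = side H \<epsilon> p" if z: "z \<in> f'" for z
  proof (cases "z = p")
    case False
    have n': "\<not> R' p q z" using p(2)[OF q(1) z qp False] .
    have mem: "p \<in> e" "q \<in> e" "z \<in> e" using p q z f by auto
    have le: "p \<le> n" "q \<le> n" "z \<le> n" using mem c.hyperedge_subset[OF e] by auto
    have "p \<noteq> 0"
    proof
      assume "p = 0" then show False using f.root[OF le(2,3)] n' qp False by simp
    qed
    then have p1: "p \<in> {1..n}" using le by auto
    have nb: "nbr n R p q" "nbr n R p z" using c.hyperedge_eq_hedge(1)[OF e mem(1)] mem qp False by metis+
    have "R p q z" using c.hedge_mem_R[OF e mem] qp False by auto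
    then have "\<not> R0 H p q z" using NA_global[OF H r na nb] n' by simp
    then show ?thesis using side_convex[OF H p1 le(2) qp le(3) False] ab(1) q(2) by auto
  qed simp
  then show ?thesis by (auto simp: sepset_def)
qed

lemma Lam_eq:
  assumes H: "conj_sys H" and r: "sep_refine n R R'" and na: "NA H R R'"
  shows "Lam H R = Lam H R'"
proof (rule antisym)
  show "Lam H R \<le> Lam H R'" using Lam_mono[OF H r] .
  interpret sep_refine n R R' by fact
  define E where "E f = (SOME e. e \<in> hyperedges n R \<and> f \<subseteq> e)" for f
  have E: "E f \<in> hyperedges n R \<and> f \<subseteq> E f" if f: "f \<in> hyperedges n R'" for f
    unfolding E_def by (rule someI_ex) (use hyperedge_coarse[OF f] in blast)
  show "Lam H R' \<le> Lam H R" unfolding Lam_def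
  proof (rule card_inj_on_le[of "\<lambda>(\<epsilon>, f). (\<epsilon>, E f)"])
    show "inj_on (\<lambda>(\<epsilon>, f). (\<epsilon>, E f)) (sepset H R')"
    proof (rule inj_onI)
      fix z z' assume zz: "z \<in> sepset H R'" "z' \<in> sepset H R'" "(\<lambda>(\<epsilon>, f). (\<epsilon>, E f)) z = (\<lambda>(\<epsilon>, f). (\<epsilon>, E f)) z'"
      obtain \<epsilon> f f' where z: "z = (\<epsilon>, f)" "z' = (\<epsilon>, f')" using zz(3) by (cases z; cases z') auto
      have a: "(\<epsilon>, f) \<in> sepset H R'" "(\<epsilon>, f') \<in> sepset H R'" "E f = E f'" using zz by (simp_all add: z)
      have m: "f \<in> hyperedges n R'" "f' \<in> hyperedges n R'" using a by (auto simp: sepset_def)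
      have sub: "f \<subseteq> E f" "f' \<subseteq> E f" "E f \<in> hyperedges n R" using E[OF m(1)] E[OF m(2)] a(3) by simp_all
      have "f = f'" using NA_one_sep[OF H r na sub(3) m(1) sub(1) m(2) sub(2) _ a(1)] a(2) by blast
      then show "z = z'" by (simp add: z)
    qed
    have "(\<epsilon>, E f) \<in> sepset H R" if s: "(\<epsilon>, f) \<in> sepset H R'" for \<epsilon> f
    proof -
      obtain a b where h: "\<epsilon> \<in> {1..n} \<times> carrier G" "f \<in> hyperedges n R'" "a \<in> f" "b \<in> f" "side H \<epsilon> a \<noteq> side H \<epsilon> b"
        using s by (auto simp: sepset_def)
      have "a \<in> E f" "b \<in> E f" "E f \<in> hyperedges n R" using E[OF h(2)] h(3,4) by blast+
      then show ?thesis using h unfolding sepset_def by blast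
    qed
    then show "(\<lambda>(\<epsilon>, f). (\<epsilon>, E f)) ` sepset H R' \<subseteq> sepset H R" by auto
    show "finite (sepset H R)" using finite_sepset[OF H c.sep_family_axioms] .
  qed
qed

text \<open>Petals are split by the Bass--Serre direction of their first vertices. Only
  \<open>compat\<close> needs work: there the first vertices seen from \<open>k\<close> and from
  \<open>l\<close> must be related.\<close>

lemma Mrel_sep:
  assumes H: "conj_sys H" and R: "sep_family n R"
  shows "sep_family n (Mrel H R)"
proof -
  interpret sep_family n R by fact
  interpret z: sep_family n "R0 H" using R0_sep_family[OF H] .
  show ?thesis
  proof (rule sep_family.intro)
    fix k i j l
    show "Mrel H R k i j \<Longrightarrow> k \<le> n \<and> i \<le> n \<and> j \<le> n \<and> i \<noteq> k \<and> j \<noteq> k" using dom unfolding Mrel_def by blast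
    show "Mrel H R k i i" if "k \<le> n" "i \<le> n" "i \<noteq> k"
      using rfl[OF that] z.rfl[of k "toward n R k i"] toward(1)[OF that] by (auto simp: Mrel_def nbr_def)
    show "Mrel H R k i j \<Longrightarrow> Mrel H R k j i" using sm z.sm unfolding Mrel_def by blast
    show "Mrel H R k i j \<Longrightarrow> Mrel H R k j l \<Longrightarrow> Mrel H R k i l" using trn z.trn unfolding Mrel_def by blast
    show "Mrel H R 0 i j" if "i \<le> n" "j \<le> n" "i \<noteq> 0" "j \<noteq> 0"
    proof -
      have "toward n R 0 i \<le> n" "toward n R 0 i \<noteq> 0" "toward n R 0 j \<le> n" "toward n R 0 j \<noteq> 0"
        using toward(1)[of 0 i] toward(1)[of 0 j] that by (auto simp: nbr_def)
      then show ?thesis using root[OF that] z.root by (simp add: Mrel_def)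
    qed
  next
    fix k l i assume h: "k \<le> n" "l \<le> n" "i \<le> n" "k \<noteq> l" "i \<noteq> k" "i \<noteq> l"
    have refl0: "R0 H l (toward n R l x) (toward n R l x)" if "x \<le> n" "x \<noteq> l" for x
      using z.rfl[of l "toward n R l x"] toward(1)[of l x] that h by (auto simp: nbr_def)
    show "Mrel H R k i l \<or> Mrel H R l i k"
    proof (rule disjCI)
      assume nm: "\<not> Mrel H R l i k"
      show "Mrel H R k i l"
      proof (rule ccontr)
        assume nk: "\<not> Mrel H R k i l"
        show False
        proof (cases "R k i l")
          case False
          \<comment> \<open>Here \<open>k\<close> lies between \<open>l\<close> and
            \<open>i\<close>, so both are seen from \<open>l\<close> through the same first
            vertex.\<close>
          then have li: "R l i k" using compat[OF h] by blast
          have "k \<in> btw n R l i" using False h sm by (auto simp: btw_def)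
          then have "toward n R l k = toward n R l i" using toward_btw h by auto
          then show False using nm li refl0[of i] h by (simp add: Mrel_def)
        next
          case True
          let ?i = "toward n R k i" and ?l = "toward n R k l"
          have n0: "\<not> R0 H k ?i ?l" using nk True by (simp add: Mrel_def)
          have ti: "nbr n R k ?i" "?i = i \<or> ?i \<in> btw n R k i" "R k ?i i" using toward toward_R h by auto
          have tl: "nbr n R k ?l" "?l = l \<or> ?l \<in> btw n R k l" "R k ?l l" using toward toward_R h by auto
          have R0r: "R0 H k ?i ?i" using z.rfl[of k ?i] ti(1) by (auto simp: nbr_def)
          have ne: "?i \<noteq> ?l" using n0 R0r by auto
          have lb: "l \<notin> btw n R k i" using toward_btw[of l k i] h ne by auto
          have lik: "R l i k" using lb h sm by (auto simp: btw_def)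
          show False
          proof (cases "?l = l")
            case True
            \<comment> \<open>Here \<open>k\<close>, \<open>l\<close> and \<open>?i\<close> lie in
              one hyperedge, and \<open>compat\<close> for \<open>R0\<close> decides.\<close>
            have kl: "nbr n R l k" using tl(1) True nbr_sym by simp
            have "R k ?i l" using ti(3) \<open>R k i l\<close> trn by blast
            have il: "nbr n R l ?i" using nbr_trans[of k ?i l] ti(1) tl(1) True \<open>R k ?i l\<close> ne nbr_sym by auto
            have "?i = i \<or> ?i \<in> btw n R l i"
            proof (rule disjCI)
              assume "?i \<notin> btw n R l i"
              show "?i = i"
              proof (rule ccontr)
                assume nI: "?i \<noteq> i"
                then have ib: "?i \<in> btw n R k i" using ti by simp
                have ib': "?i \<le> n" "?i \<noteq> k" "\<not> R ?i k i" "?i \<noteq> l" using ib ne True by (simp_all add: btw_def)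
                have "R ?i l k" using kl ib' by (simp add: nbr_def)
                then have "\<not> R ?i l i" using ib'(3) sm trn by blast
                then show False using \<open>?i \<notin> btw n R l i\<close> ib' nI by (simp add: btw_def)
              qed
            qed
            then have "toward n R l i = ?i" using toward_eqI[of l i ?i] h il by auto
            moreover have "toward n R l k = k" using toward_nbr[OF kl] .
            moreover have "R0 H l ?i k"
              using z.compat[of k l ?i] n0 True h ti(1) ne unfolding nbr_def by metis
            ultimately show False using nm lik by (simp add: Mrel_def)
          next
            case False
            \<comment> \<open>Here a label lies between \<open>k\<close> and \<open>l\<close>; the
              first vertex from \<open>l\<close> towards \<open>k\<close> is also the first one
              towards \<open>i\<close>.\<close>
            then have lb': "?l \<in> btw n R k l" using tl by simp
            let ?f = "toward n R l k"
            have tf: "nbr n R l ?f" "?f = k \<or> ?f \<in> btw n R l k" using toward[of l k] h by auto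
            have "?f \<noteq> k"
            proof
              assume "?f = k"
              then have "btw n R l k = {}" using tf(1) nbr_iff_btw h by metis
              then show False using lb' btw_sym by auto
            qed
            then have fb: "?f \<in> btw n R l k" using tf by simp
            have "?f = i \<or> ?f \<in> btw n R l i"
            proof (rule disjCI)
              assume n1: "?f \<notin> btw n R l i"
              show "?f = i"
              proof (rule ccontr)
                assume fi: "?f \<noteq> i"
                have fl: "?f \<noteq> l" "?f \<le> n" "?f \<noteq> k" "\<not> R ?f l k" using fb by (auto simp: btw_def)
                have "R ?f l i" using n1 fi fl by (auto simp: btw_def)
                then have "\<not> R ?f k i" using fl sm trn by blast
                then have "?f \<in> btw n R k i" using fl fi by (auto simp: btw_def)
                moreover have "?f \<in> btw n R k l" using fb btw_sym by simp
                ultimately have "?i = ?l" using toward_btw[of ?f k i] toward_btw[of ?f k l] h by simp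
                then show False using ne by simp
              qed
            qed
            then have "toward n R l i = ?f" using toward_eqI[of l i ?f] h tf by auto
            then show False using nm lik refl0[of k] h by (simp add: Mrel_def)
          qed
        qed
      qed
    qed
  qed
qed

lemma Mrel_refine: "conj_sys H \<Longrightarrow> sep_family n R \<Longrightarrow> sep_refine n R (Mrel H R)"
  unfolding sep_refine_def sep_refine_axioms_def using Mrel_sep by (simp add: Mrel_def)

lemma Mrel_NA: assumes "conj_sys H" "sep_family n R" shows "NA H R (Mrel H R)"
proof -
  interpret sep_refine n R "Mrel H R" using Mrel_refine[OF assms] .
  show ?thesis unfolding NA_def
  proof (intro allI impI notI, elim conjE)
    fix k a b assume h: "nbr n (Mrel H R) k a" "nbr n (Mrel H R) k b" "R k a b" "\<not> Mrel H R k a b" "R0 H k a b"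
    have "toward n R k a = a" "toward n R k b = b" using c.toward_nbr nbr_coarse h(1,2) by simp_all
    then show False using h by (simp add: Mrel_def)
  qed
qed

lemma Mrel_flat: assumes "conj_sys H" "sep_family n R" shows "flat H (Mrel H R)"
proof -
  interpret sep_refine n R "Mrel H R" using Mrel_refine[OF assms] .
  show ?thesis unfolding flat_def
  proof (intro allI impI, elim conjE)
    fix k a b assume h: "nbr n (Mrel H R) k a" "nbr n (Mrel H R) k b" "Mrel H R k a b"
    have "toward n R k a = a" "toward n R k b = b" using c.toward_nbr nbr_coarse h(1,2) by simp_all
    then show "R0 H k a b" using h by (simp add: Mrel_def)
  qed
qed

text \<open>Equal levels exclude aligned folds by \<open>Lam_strict\<close>, so no refinement of the
  same level separates labels of one petal whose first vertices are aligned.\<close>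

lemma Mrel_max:
  assumes H: "conj_sys H" and r: "sep_refine n R R'" and eq: "Lam H R = Lam H R'" and m: "Mrel H R k i j"
  shows "R' k i j"
proof (rule ccontr)
  assume nr: "\<not> R' k i j"
  interpret sep_refine n R R' by fact
  interpret z: sep_family n "R0 H" using R0_sep_family[OF H] .
  have na: "NA H R R'" using Lam_strict[OF H r] eq by auto
  have R: "R k i j" and r0: "R0 H k (toward n R k i) (toward n R k j)" using m by (auto simp: Mrel_def)
  have le: "k \<le> n" "i \<le> n" "i \<noteq> k" "j \<le> n" "j \<noteq> k" using c.dom[OF R] by auto
  let ?a = "toward n R k i" and ?b = "toward n R k j"
  have "R k ?a ?b" using c.toward_R[OF le(1-3)] c.toward_R[OF le(1,4,5)] R c.sm c.trn by blast
  moreover have "\<not> R' k ?a ?b"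
  proof
    assume ab: "R' k ?a ?b"
    have an: "?a \<le> n" "?a \<noteq> k" "?b \<le> n" "?b \<noteq> k" using c.toward(1)[OF le(1-3)] c.toward(1)[OF le(1,4,5)] by (auto simp: nbr_def)
    have "R' k (toward n R' k i) i" "R' k (toward n R' k j) j" using f.toward_R le by auto
    moreover have "R' k (toward n R' k i) ?a" "R' k (toward n R' k j) ?b"
      using f.toward_R[OF le(1) an(1,2)] f.toward_R[OF le(1) an(3,4)] toward_coarse[OF le(1-3)] toward_coarse[OF le(1,4,5)] by simp_all
    ultimately show False using ab nr f.sm f.trn by meson
  qed
  ultimately show False
    using NA_global[OF H r na c.toward(1)[OF le(1-3)] c.toward(1)[OF le(1,4,5)]] r0 by blast
qed

lemma flat_Mrel: assumes R: "sep_family n R" and f: "flat H R" shows "Mrel H R = R"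
proof (intro ext)
  interpret sep_family n R by fact
  fix k i j
  show "Mrel H R k i j = R k i j"
  proof (cases "R k i j")
    case True
    note d = dom[OF True]
    have "R k (toward n R k i) (toward n R k j)" using toward_R[of k i] toward_R[of k j] True d sm trn by meson
    then show ?thesis using f toward(1)[of k i] toward(1)[of k j] d True unfolding flat_def Mrel_def by blast
  qed (simp add: Mrel_def)
qed

text \<open>Flatness of \<open>A\<close> means that labels in a common petal of \<open>A\<close>
  have aligned first vertices, so \<open>proj\<close> does not split petals of
  \<open>A\<close>.\<close>

lemma proj_refine:
  assumes H: "conj_sys H" and r: "sep_refine n B A" and f: "flat H A"
  shows "sep_refine n (proj H A B) A" "sep_refine n B (proj H A B)"
proof -
  interpret sep_refine n B A by fact
  interpret z: sep_family n "R0 H" using R0_sep_family[OF H] .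
  have sub: "proj H A B k i j" if a: "A k i j" for k i j
  proof -
    note d = f.dom[OF a]
    have "A k (toward n A k i) (toward n A k j)" using f.toward_R[of k i] f.toward_R[of k j] a d f.sm f.trn by meson
    then show ?thesis using f f.toward(1)[of k i] f.toward(1)[of k j] d finer[OF a] unfolding flat_def proj_def by blast
  qed
  have s: "sep_family n (proj H A B)"
  proof (rule f.coarsening)
    fix k i j l
    show "A k i j \<Longrightarrow> proj H A B k i j" using sub .
    show "proj H A B k i j \<Longrightarrow> k \<le> n \<and> i \<le> n \<and> j \<le> n \<and> i \<noteq> k \<and> j \<noteq> k" using c.dom unfolding proj_def by blast
    show "proj H A B k i j \<Longrightarrow> proj H A B k j i" using c.sm z.sm unfolding proj_def by blast
    show "proj H A B k i j \<Longrightarrow> proj H A B k j l \<Longrightarrow> proj H A B k i l" using c.trn z.trn unfolding proj_def by blast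
  qed
  show "sep_refine n (proj H A B) A" using s f.sep_family_axioms sub by (simp add: sep_refine_def sep_refine_axioms_def)
  show "sep_refine n B (proj H A B)" using s c.sep_family_axioms by (auto simp: sep_refine_def sep_refine_axioms_def proj_def)
qed

text \<open>A drop of level from \<open>A\<close> to \<open>B\<close> needs an aligned fold by
  \<open>Lam_eq\<close>, and \<open>proj\<close> keeps the aligned folds.\<close>

lemma proj_Lam:
  assumes H: "conj_sys H" and r: "sep_refine n B A" and f: "flat H A" and l: "Lam H B < Lam H A"
  shows "Lam H (proj H A B) < Lam H A"
proof (rule Lam_strict[OF H proj_refine(1)[OF H r f]])
  interpret sep_refine n B A by fact
  have "\<not> NA H B A" using Lam_eq[OF H r] l by auto
  then obtain k a b where h: "nbr n A k a" "nbr n A k b" "B k a b" "\<not> A k a b" "R0 H k a b" unfolding NA_def by blast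
  have "toward n A k a = a" "toward n A k b = b" using f.toward_nbr h by simp_all
  then show "\<not> NA H (proj H A B) A" using h unfolding NA_def proj_def by metis
qed

text \<open>Positions are determined outwards from the base label. Near \<open>j\<close> the two
  bases differ by a translation \<open>g\<close>. The edge at \<open>pos H k\<close> towards
  \<open>j\<close> is also the one back towards \<open>0\<close>, which is already known, so
  \<open>g\<close> fixes an edge and is trivial.\<close>

lemma aligned_unique:
  assumes H: "conj_sys H" and A: "sep_family n A" and l: "loc A H H'" and al: "aligned A H" "aligned A H'" and j: "j \<le> n"
  shows "pos H' j = pos H j"
  using j
proof (induction "card (btw n A 0 j)" arbitrary: j rule: less_induct)
  case less
  interpret sep_family n A by fact
  show ?case
  proof (cases "j = 0")
    case True then show ?thesis by (simp add: pos_def)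
  next
    case False
    define k where "k = toward n A j 0"
    have k: "nbr n A j k" "k = 0 \<or> k \<in> btw n A j 0" using toward[of j 0] False less.prems by (auto simp: k_def)
    have kj: "nbr n A k j" using nbr_sym[OF k(1)] .
    have kn: "k \<le> n" "j \<noteq> k" using kj by (auto simp: nbr_def)
    obtain g where g0: "g \<in> carrier G" "\<forall>j'\<in>hedge n A k j. pos H' j' = (\<lambda>c. g \<otimes> c) ` pos H j'" using locE[OF l hedge_in[OF kj]] .
    note g' = g0(1) bspec[OF g0(2)]
    note g = g'(1) g'(2)[OF conjunct1[OF hedge_nbr_mem[OF kj]]] g'(2)[OF conjunct2[OF hedge_nbr_mem[OF kj]]]
    have "g = \<one>"
    proof (cases "k = 0")
      case True then show ?thesis using g by (auto simp: pos_def)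
    next
      case kn0: False
      then have kb: "k \<in> btw n A 0 j" using k btw_sym by auto
      have pk: "pos H' k = pos H k" using less.hyps[OF btw_card_less(1)[OF kb]] less.prems kn by simp
      define m where "m = toward n A k 0"
      have m: "nbr n A k m" "m = 0 \<or> m \<in> btw n A k 0" using toward[of k 0] kn0 kn by (auto simp: m_def)
      have mn: "m \<le> n" "m \<noteq> k" using m by (auto simp: nbr_def)
      have pm: "pos H' m = pos H m"
      proof (cases "m = 0")
        case True then show ?thesis by (simp add: pos_def)
      next
        case False
        then have "m \<in> btw n A 0 k" using m btw_sym by auto
        then have "card (btw n A 0 m) < card (btw n A 0 j)"
          using btw_card_less(1)[of m 0 k] btw_card_less(1)[OF kb] kn less.prems by simp
        then show ?thesis using less.hyps mn by simp
      qed
      have k1: "k \<in> {1..n}" using kn kn0 by simp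
      have tj: "toward n A k j = j" using toward_nbr[OF kj] .
      have e1: "dirn H k j = dirn H k m" "dirn H' k j = dirn H' k m"
      proof -
        have "R0 H k (toward n A k j) (toward n A k 0)" "R0 H' k (toward n A k j) (toward n A k 0)"
          using al[unfolded aligned_def, rule_format, of k j 0] kn kn0 less.prems by simp_all
        then show "dirn H k j = dirn H k m" "dirn H' k j = dirn H' k m"
          unfolding tj m_def[symmetric] R0_def using kn0 by simp_all
      qed
      have e2: "dirn H' k m = dirn H k m" by (simp add: dirn_def pk pm)
      have e3: "dirn H' k j = g \<otimes> dirn H k j" using dirn_translate[OF H k1 less.prems kn(2) g] .
      have "dirn H k j \<in> carrier G" using dirn(1)[OF H k1 less.prems kn(2)] pos_carrier by blast
      moreover then have "g \<otimes> dirn H k j = dirn H k j" using e1 e2 e3 by simp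
      ultimately show ?thesis using g(1) by simp
    qed
    then have "pos H' j = (\<lambda>c. \<one> \<otimes> c) ` pos H j" using g(3) by simp
    also have "\<dots> = (\<lambda>c. c) ` pos H j" by (rule image_cong[OF refl]) (simp add: pos_carrier)
    finally show ?thesis by simp
  qed
qed

end

section \<open>Petals, tree order and carried automorphisms in terms of separation\<close>

lemma petals_eq: "k \<le> n \<Longrightarrow> petals n E k = {{j. psep n E k i j} | i. i \<in> {0..n} - {k}}"
  unfolding petals_def psep_def by (intro Collect_cong ex_cong1) auto

lemma petals_mem:
  assumes E: "pl_tree n E" and k: "k \<le> n"
  shows "(\<exists>P\<in>petals n E k. i \<in> P \<and> j \<in> P) \<longleftrightarrow> psep n E k i j"
proof -
  interpret sep_family n "psep n E" using pl_tree_sep_family[OF E] .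
  show ?thesis
  proof
    assume "\<exists>P\<in>petals n E k. i \<in> P \<and> j \<in> P"
    then obtain l where "psep n E k l i" "psep n E k l j" unfolding petals_eq[OF k] by auto
    then show "psep n E k i j" using sm trn by blast
  next
    assume p: "psep n E k i j"
    then have "i \<in> {0..n} - {k}" "psep n E k i i" using dom[OF p] rfl[of k i] by auto
    then show "\<exists>P\<in>petals n E k. i \<in> P \<and> j \<in> P" unfolding petals_eq[OF k] using p by blast
  qed
qed

lemma tree_le_iff:
  assumes A: "pl_tree n A" and B: "pl_tree n B"
  shows "tree_le n A B \<longleftrightarrow> sep_refine n (psep n A) (psep n B)"
proof -
  interpret a: sep_family n "psep n A" using pl_tree_sep_family[OF A] .
  interpret b: sep_family n "psep n B" using pl_tree_sep_family[OF B] .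
  have "tree_le n A B \<longleftrightarrow> (\<forall>k i j. psep n B k i j \<longrightarrow> psep n A k i j)"
  proof
    assume t: "tree_le n A B"
    show "\<forall>k i j. psep n B k i j \<longrightarrow> psep n A k i j"
    proof (intro allI impI)
      fix k i j assume p: "psep n B k i j"
      note d = b.dom[OF p]
      have "{l. psep n A k i l} \<in> petals n A k" unfolding petals_eq[OF conjunct1[OF d]] using d by auto
      then obtain S where S: "S \<subseteq> petals n B k" "{l. psep n A k i l} = \<Union>S"
        using t d unfolding tree_le_def by (meson atLeastAtMost_iff le0)
      have "i \<in> \<Union>S" using S(2) a.rfl[of k i] d by auto
      then obtain Q where Q: "Q \<in> S" "i \<in> Q" by blast
      then obtain m where m: "Q = {l. psep n B k m l}" using S(1) unfolding petals_eq[OF conjunct1[OF d]] by auto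
      have "psep n B k m j" using Q(2) m p b.trn by blast
      then show "psep n A k i j" using S(2) Q(1) m by blast
    qed
  next
    assume r: "\<forall>k i j. psep n B k i j \<longrightarrow> psep n A k i j"
    show "tree_le n A B" unfolding tree_le_def
    proof (intro ballI)
      fix k P assume k: "k \<in> {0..n}" and P: "P \<in> petals n A k"
      have kn: "k \<le> n" using k by simp
      obtain i where i: "i \<in> {0..n} - {k}" "P = {j. psep n A k i j}" using P unfolding petals_eq[OF kn] by auto
      let ?S = "(\<lambda>j. {l. psep n B k j l}) ` P"
      have "?S \<subseteq> petals n B k"
      proof
        fix Q assume "Q \<in> ?S"
        then obtain j where j: "psep n A k i j" "Q = {l. psep n B k j l}" using i by auto
        then show "Q \<in> petals n B k" unfolding petals_eq[OF kn] using a.dom[OF j(1)] by auto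
      qed
      moreover have "P = \<Union>?S"
      proof
        show "P \<subseteq> \<Union>?S"
        proof
          fix j assume j: "j \<in> P"
          then have "psep n B k j j" using i a.dom[of k i j] b.rfl[of k j] by auto
          then show "j \<in> \<Union>?S" using j by blast
        qed
        show "\<Union>?S \<subseteq> P"
        proof
          fix l assume "l \<in> \<Union>?S"
          then obtain j where j: "psep n A k i j" "psep n B k j l" using i(2) by auto
          have "psep n A k j l" using r j(2) by simp
          then show "l \<in> P" unfolding i(2) using a.trn[OF j(1)] by simp
        qed
      qed
      ultimately show "\<exists>S\<subseteq>petals n B k. P = \<Union>S" by blast
    qed
  qed
  then show ?thesis using a.sep_family_axioms b.sep_family_axioms by (auto simp: sep_refine_def sep_refine_axioms_def)
qed

lemma wh_carried_iff:
  assumes E: "pl_tree n E"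
  shows "wh_carried G n H E \<phi> \<longleftrightarrow> (\<exists>k x. k \<in> {1..n} \<and> (\<forall>j\<in>{1..n}. x j \<in> H k) \<and> x k = \<one>\<^bsub>G\<^esub> \<and>
     (\<forall>i j. psep n E k i j \<and> i \<noteq> 0 \<and> j \<noteq> 0 \<longrightarrow> x i = x j) \<and>
     (\<forall>j. psep n E k 0 j \<and> j \<noteq> 0 \<longrightarrow> x j = \<one>\<^bsub>G\<^esub>) \<and>
     \<phi> \<in> iso G G \<and>
     (\<forall>j\<in>{1..n}. \<forall>h\<in>H j. \<phi> h = x j \<otimes>\<^bsub>G\<^esub> h \<otimes>\<^bsub>G\<^esub> inv\<^bsub>G\<^esub> (x j)))"
proof -
  have "(\<forall>P\<in>petals n E k. \<forall>i\<in>P. \<forall>j\<in>P. i \<noteq> 0 \<and> j \<noteq> 0 \<longrightarrow> x i = x j) \<longleftrightarrow>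
      (\<forall>i j. psep n E k i j \<and> i \<noteq> 0 \<and> j \<noteq> 0 \<longrightarrow> x i = x j)" if k: "k \<in> {1..n}" for k and x :: "nat \<Rightarrow> 'a"
  proof -
    have kn: "k \<le> n" using k by simp
    show ?thesis unfolding petals_mem[OF E kn, symmetric] by blast
  qed
  moreover have "(\<forall>P\<in>petals n E k. 0 \<in> P \<longrightarrow> (\<forall>j\<in>P. j \<noteq> 0 \<longrightarrow> x j = \<one>\<^bsub>G\<^esub>)) \<longleftrightarrow>
      (\<forall>j. psep n E k 0 j \<and> j \<noteq> 0 \<longrightarrow> x j = \<one>\<^bsub>G\<^esub>)" if k: "k \<in> {1..n}" for k and x :: "nat \<Rightarrow> 'a"
  proof -
    have kn: "k \<le> n" using k by simp
    show ?thesis unfolding petals_mem[OF E kn, symmetric] by blast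
  qed
  ultimately show ?thesis unfolding wh_carried_def by (simp cong: conj_cong)
qed

text \<open>Refinement makes petals smaller, so a finer tree carries more automorphisms.\<close>

lemma wh_carried_mono:
  assumes E: "pl_tree n E" and E': "pl_tree n E'" and r: "sep_refine n (psep n E) (psep n E')" and w: "wh_carried G n H E \<phi>"
  shows "wh_carried G n H E' \<phi>"
proof -
  interpret sep_refine n "psep n E" "psep n E'" by fact
  obtain k x where kx: "k \<in> {1..n}" "\<forall>j\<in>{1..n}. x j \<in> H k" "x k = \<one>\<^bsub>G\<^esub>"
     "\<forall>i j. psep n E k i j \<and> i \<noteq> 0 \<and> j \<noteq> 0 \<longrightarrow> x i = x j"
     "\<forall>j. psep n E k 0 j \<and> j \<noteq> 0 \<longrightarrow> x j = \<one>\<^bsub>G\<^esub>"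
     "\<phi> \<in> iso G G" "\<forall>j\<in>{1..n}. \<forall>h\<in>H j. \<phi> h = x j \<otimes>\<^bsub>G\<^esub> h \<otimes>\<^bsub>G\<^esub> inv\<^bsub>G\<^esub> (x j)"
    using w unfolding wh_carried_iff[OF E] by blast
  have "\<forall>i j. psep n E' k i j \<and> i \<noteq> 0 \<and> j \<noteq> 0 \<longrightarrow> x i = x j" using kx(4) finer by blast
  moreover have "\<forall>j. psep n E' k 0 j \<and> j \<noteq> 0 \<longrightarrow> x j = \<one>\<^bsub>G\<^esub>" using kx(5) finer by blast
  ultimately show ?thesis unfolding wh_carried_iff[OF E']
    by (intro exI[of _ k] exI[of _ x] conjI kx(1-3,6,7))
qed

lemma carried_prod_mono:
  assumes E: "pl_tree n E" and E': "pl_tree n E'" and r: "sep_refine n (psep n E) (psep n E')"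
    and w: "\<rho> \<in> carried_prod G n H E"
  shows "\<rho> \<in> carried_prod G n H E'"
  using w
proof (induction)
  case cp_id show ?case by (rule carried_prod.cp_id)
next
  case (cp_step \<phi> \<rho>)
  show ?case by (rule carried_prod.cp_step[OF wh_carried_mono[OF E E' r cp_step.hyps(1)] cp_step.IH])
qed

section \<open>The effect of identifications on positions, and aligned representatives\<close>

locale mm_setting = reference_product G Gs n for G (structure) and Gs n +
  assumes n1: "1 \<le> n"
begin

abbreviation "basis \<equiv> is_basis G Gs n"
abbreviation "idt \<equiv> ident G Gs n"

lemma basis_conj_sys: "basis H \<Longrightarrow> conj_sys H"
  by (simp add: is_basis_def conj_sys_def cjset_def)

lemma basis_fp: "basis H \<Longrightarrow> free_product G H n"
  unfolding is_basis_def by unfold_locales simp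

lemma basis_sub: "basis H \<Longrightarrow> j \<in> {1..n} \<Longrightarrow> subgroup (H j) G"
  by (simp add: is_basis_def internal_free_product_def)

lemma loc_refl: "loc R H H"
proof (rule locI)
  fix e
  have "pos H j = (\<lambda>c. \<one> \<otimes> c) ` pos H j" for j
  proof -
    have "(\<lambda>c. \<one> \<otimes> c) ` pos H j = (\<lambda>c. c) ` pos H j" by (rule image_cong[OF refl]) (simp add: pos_carrier)
    then show ?thesis by simp
  qed
  then show "\<exists>g\<in>carrier G. \<forall>j\<in>e. pos H j = (\<lambda>c. g \<otimes> c) ` pos H j" by (intro bexI[of _ \<one>] ballI) simp_all
qed

lemma loc_trans: assumes "loc R H H'" "loc R H' H''" shows "loc R H H''"
proof (rule locI)
  fix e assume e: "e \<in> hyperedges n R"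
  obtain g where g: "g \<in> carrier G" "\<forall>j\<in>e. pos H' j = (\<lambda>c. g \<otimes> c) ` pos H j" using locE[OF assms(1) e] .
  obtain h where h: "h \<in> carrier G" "\<forall>j\<in>e. pos H'' j = (\<lambda>c. h \<otimes> c) ` pos H' j" using locE[OF assms(2) e] .
  have "pos H'' j = (\<lambda>c. (h \<otimes> g) \<otimes> c) ` pos H j" if j: "j \<in> e" for j
  proof -
    have "pos H'' j = (\<lambda>c. h \<otimes> (g \<otimes> c)) ` pos H j"
      unfolding bspec[OF h(2) j] bspec[OF g(2) j] image_image ..
    also have "\<dots> = (\<lambda>c. (h \<otimes> g) \<otimes> c) ` pos H j"
      by (rule image_cong[OF refl]) (use g(1) h(1) in \<open>simp add: m_assoc pos_carrier\<close>)
    finally show ?thesis .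
  qed
  then show "\<exists>g\<in>carrier G. \<forall>j\<in>e. pos H'' j = (\<lambda>c. g \<otimes> c) ` pos H j"
    by (intro bexI[of _ "h \<otimes> g"] ballI m_closed h(1) g(1))
qed

lemma pos_cjset:
  assumes H: "conj_sys H" and j: "j \<in> {1..n}" and g: "g \<in> carrier G" and H': "H' j = cjset g (H j)"
  shows "pos H' j = (\<lambda>c. g \<otimes> c) ` pos H j"
proof
  have sb: "Gs j \<subseteq> carrier G" using Gs_sub j by simp
  have jn: "j \<noteq> 0" using j by simp
  show "(\<lambda>c. g \<otimes> c) ` pos H j \<subseteq> pos H' j"
  proof
    fix d assume "d \<in> (\<lambda>c. g \<otimes> c) ` pos H j"
    then obtain c where c: "c \<in> carrier G" "H j = cjset c (Gs j)" "d = g \<otimes> c" using jn by (auto simp: pos_def)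
    then show "d \<in> pos H' j" using jn g sb H' by (simp add: pos_def cjset_mult)
  qed
  show "pos H' j \<subseteq> (\<lambda>c. g \<otimes> c) ` pos H j"
  proof
    fix d assume "d \<in> pos H' j"
    then have d: "d \<in> carrier G" "cjset g (H j) = cjset d (Gs j)" using jn H' by (auto simp: pos_def)
    have Hc: "H j \<subseteq> carrier G"
    proof -
      obtain c where "c \<in> pos H j" using pos_nonempty[OF H, of j] j by auto
      then show ?thesis using pos_stab(3)[OF j] by blast
    qed
    have "H j = cjset (inv g) (cjset g (H j))" using g Hc by (simp add: cjset_mult cjset_one)
    also have "\<dots> = cjset (inv g \<otimes> d) (Gs j)" unfolding d(2) using g d(1) sb by (simp add: cjset_mult)
    finally have "inv g \<otimes> d \<in> pos H j" using g d(1) jn by (simp add: pos_def)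
    moreover have "d = g \<otimes> (inv g \<otimes> d)" using g d(1) by (simp add: m_assoc[symmetric])
    ultimately show "d \<in> (\<lambda>c. g \<otimes> c) ` pos H j" by (rule rev_image_eqI)
  qed
qed

lemma iso_cjset:
  assumes "\<phi> \<in> iso G G" "g \<in> carrier G" "A \<subseteq> carrier G"
  shows "\<phi> ` cjset g A = cjset (\<phi> g) (\<phi> ` A)"
proof -
  have h: "\<phi> \<in> hom G G" using assms(1) by (simp add: iso_def)
  have "\<phi> (g \<otimes> a \<otimes> inv g) = \<phi> g \<otimes> \<phi> a \<otimes> inv (\<phi> g)" if "a \<in> A" for a
  proof -
    have a: "a \<in> carrier G" using that assms(3) by auto
    have "\<phi> (inv g) = inv (\<phi> g)" using group_hom.hom_inv[of G G \<phi> g] h assms(2) is_group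
      by (simp add: group_hom_def group_hom_axioms_def)
    then show ?thesis using hom_mult[OF h] a assms(2) by simp
  qed
  then show ?thesis unfolding cjset_def image_image by (rule image_cong[OF refl])
qed

text \<open>Away from \<open>k\<close> the elements \<open>x j\<close> agree on a hyperedge. At
  \<open>k\<close> the same element may be used, since conjugation by an element of
  \<open>H k\<close> preserves \<open>H k\<close>.\<close>

lemma wh_carried_local:
  assumes H: "basis H" and E: "pl_tree n E" and w: "wh_carried G n H E \<phi>" and e: "e \<in> hyperedges n (psep n E)"
  shows "\<exists>g\<in>carrier G. (0 \<in> e \<longrightarrow> g = \<one>) \<and> (\<forall>j\<in>e - {0}. \<phi> ` H j = cjset g (H j))"
proof -
  interpret sep_family n "psep n E" using pl_tree_sep_family[OF E] .
  obtain k x where k: "k \<in> {1..n}" and x: "\<forall>j\<in>{1..n}. x j \<in> H k" "x k = \<one>"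
    "\<forall>i j. psep n E k i j \<and> i \<noteq> 0 \<and> j \<noteq> 0 \<longrightarrow> x i = x j" "\<forall>j. psep n E k 0 j \<and> j \<noteq> 0 \<longrightarrow> x j = \<one>"
    and p: "\<forall>j\<in>{1..n}. \<forall>h\<in>H j. \<phi> h = x j \<otimes> h \<otimes> inv (x j)"
    using w unfolding wh_carried_iff[OF E] by (elim exE conjE)
  have img: "\<phi> ` H j = cjset (x j) (H j)" if "j \<in> {1..n}" for j
    unfolding cjset_def by (rule image_cong[OF refl]) (use p that in simp)
  \<comment> \<open>The value \<open>\<one>\<close> at the base label encodes that \<open>x\<close>
    is trivial on the petal of the base label.\<close>
  define y where "y j = (if j = 0 then \<one> else x j)" for j
  have yc: "y i = y j" if ij: "psep n E k i j" for i j
  proof -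
    consider "i = 0" "j = 0" | "i = 0" "j \<noteq> 0" | "i \<noteq> 0" "j = 0" | "i \<noteq> 0" "j \<noteq> 0" by blast
    then show ?thesis
    proof cases
      case 2
      then have "x j = \<one>" using x(4)[rule_format, of j] ij by blast
      then show ?thesis using 2 by (simp add: y_def)
    next
      case 3
      then have "x i = \<one>" using x(4)[rule_format, of i] sm[OF ij] by blast
      then show ?thesis using 3 by (simp add: y_def)
    next
      case 4
      then have "x i = x j" using x(3)[rule_format, of i j] ij by blast
      then show ?thesis using 4 by (simp add: y_def)
    qed (simp add: y_def)
  qed
  obtain j0 where j0: "j0 \<in> e" "j0 \<noteq> k" using hyperedge_two[OF e] by metis
  have en: "e \<subseteq> {0..n}" using hyperedge_subset[OF e] .
  have same: "y j = y j0" if j: "j \<in> e" "j \<noteq> k" for j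
  proof (cases "j = j0")
    case False
    have nb: "nbr n (psep n E) j j0" using hyperedge_eq_hedge(1)[OF e j(1) j0(1) False] .
    then have "psep n E k j j0" using j(2) j0(2) k unfolding nbr_def by auto
    then show ?thesis by (rule yc)
  qed simp
  have yH: "y j0 \<in> H k"
  proof (cases "j0 = 0")
    case True then show ?thesis using subgroup.one_closed[OF basis_sub[OF H k]] by (simp add: y_def)
  next
    case False
    then have "j0 \<in> {1..n}" using j0(1) en by auto
    then show ?thesis using bspec[OF x(1)] False by (simp add: y_def)
  qed
  have yG: "y j0 \<in> carrier G" using subgroup.mem_carrier[OF basis_sub[OF H k] yH] .
  have "y j0 = \<one>" if "0 \<in> e"
  proof -
    have "y 0 = y j0" using same[OF that] k by simp
    then show ?thesis by (simp add: y_def)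
  qed
  moreover have "\<phi> ` H j = cjset (y j0) (H j)" if j: "j \<in> e - {0}" for j
  proof (cases "j = k")
    case True
    have "H k \<subseteq> carrier G" using subgroup.subset[OF basis_sub[OF H k]] .
    then have "\<phi> ` H k = H k" using img[OF k] x(2) cjset_one by simp
    then show ?thesis using cjset_self[OF basis_sub[OF H k] yH] True by simp
  next
    case False
    then have "x j = y j0" using same[of j] j by (simp add: y_def)
    moreover have "j \<in> {1..n}" using j en by auto
    ultimately show ?thesis using img[of j] by simp
  qed
  ultimately show ?thesis by (intro bexI[OF _ yG] conjI impI ballI)
qed

lemma carried_prod_local:
  assumes H: "basis H" and E: "pl_tree n E" and r: "\<rho> \<in> carried_prod G n H E"
  shows "\<rho> \<in> iso G G \<and> (\<forall>e\<in>hyperedges n (psep n E). \<exists>g\<in>carrier G. (0 \<in> e \<longrightarrow> g = \<one>) \<and> (\<forall>j\<in>e - {0}. \<rho> ` H j = cjset g (H j)))"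
  using r
proof (induction)
  case cp_id
  interpret sep_family n "psep n E" using pl_tree_sep_family[OF E] .
  have "id ` H j = cjset \<one> (H j)" if "j \<in> {1..n}" for j
    using cjset_one[OF subgroup.subset[OF basis_sub[OF H that]]] by simp
  then have im: "id ` H j = cjset \<one> (H j)" if "e \<in> hyperedges n (psep n E)" "j \<in> e - {0}" for e j
  proof -
    have "j \<in> {1..n}" using hyperedge_subset[OF that(1)] that(2) by auto
    then show ?thesis by (rule \<open>\<And>j. j \<in> {1..n} \<Longrightarrow> id ` H j = cjset \<one> (H j)\<close>)
  qed
  have "id \<in> iso G G" by (auto simp: iso_def hom_def bij_betw_def)
  then show ?case by (intro conjI ballI bexI[OF _ one_closed] impI refl im)
next
  case (cp_step \<phi> \<rho>)
  interpret sep_family n "psep n E" using pl_tree_sep_family[OF E] .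
  have pi: "\<phi> \<in> iso G G" using cp_step(1) unfolding wh_carried_def by (elim exE conjE)
  have "\<phi> \<circ> \<rho> \<in> iso G G" by (rule iso_set_trans[OF conjunct1[OF cp_step.IH] pi])
  moreover have "\<exists>g\<in>carrier G. (0 \<in> e \<longrightarrow> g = \<one>) \<and> (\<forall>j\<in>e - {0}. (\<phi> \<circ> \<rho>) ` H j = cjset g (H j))"
    if e: "e \<in> hyperedges n (psep n E)" for e
  proof -
    obtain g where g: "g \<in> carrier G" "0 \<in> e \<longrightarrow> g = \<one>" "\<forall>j\<in>e - {0}. \<rho> ` H j = cjset g (H j)"
      using bspec[OF conjunct2[OF cp_step.IH] e] by (elim bexE conjE)
    obtain h where h: "h \<in> carrier G" "0 \<in> e \<longrightarrow> h = \<one>" "\<forall>j\<in>e - {0}. \<phi> ` H j = cjset h (H j)"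
      using wh_carried_local[OF H E cp_step(1) e] by (elim bexE conjE)
    have ph: "\<phi> \<in> hom G G" using pi by (simp add: iso_def)
    have pg: "\<phi> g \<in> carrier G" using ph g(1) by (auto simp: hom_def)
    \<comment> \<open>All factors of the product are carried by the original pair, so
      \<open>\<phi>\<close> is known on \<open>H j\<close> itself and turns the conjugator
      \<open>g\<close> into \<open>\<phi> g\<close>.\<close>
    have "(\<phi> \<circ> \<rho>) ` H j = cjset (\<phi> g \<otimes> h) (H j)" if j: "j \<in> e - {0}" for j
    proof -
      have jn: "j \<in> {1..n}" using hyperedge_subset[OF e] j by auto
      have sb: "H j \<subseteq> carrier G" using subgroup.subset[OF basis_sub[OF H jn]] .
      have "(\<phi> \<circ> \<rho>) ` H j = \<phi> ` cjset g (H j)" unfolding bspec[OF g(3) j, symmetric] by (simp only: image_comp)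
      also have "\<dots> = cjset (\<phi> g) (cjset h (H j))" using iso_cjset[OF pi g(1) sb] bspec[OF h(3) j] by simp
      also have "\<dots> = cjset (\<phi> g \<otimes> h) (H j)" using cjset_mult[OF pg h(1) sb] .
      finally show ?thesis .
    qed
    moreover have "0 \<in> e \<longrightarrow> \<phi> g \<otimes> h = \<one>" using g(2) h(2) hom_one[OF ph is_group is_group] by simp
    ultimately show ?thesis by (intro bexI[OF _ m_closed[OF pg h(1)]] conjI ballI)
  qed
  ultimately show ?case by (intro conjI ballI)
qed

lemma ident_step_local:
  assumes s: "((H, E), (H', E')) \<in> ident_step G Gs n"
  shows "basis H" "pl_tree n E" "E' = E" "basis H'" "loc (psep n E) H H'"
proof -
  obtain \<rho> where r: "\<rho> \<in> carried_prod G n H E" "H' = (\<lambda>j. \<rho> ` H j)" and b: "basis H" "pl_tree n E" "E' = E"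
    using s by (auto simp: ident_step_def valid_pairs_def)
  show "basis H" "pl_tree n E" "E' = E" by fact+
  interpret sep_family n "psep n E" using pl_tree_sep_family[OF b(2)] .
  note l = carried_prod_local[OF b(1,2) r(1)]
  interpret h: free_product G H n using basis_fp[OF b(1)] .
  have fp: "internal_free_product G H' n" unfolding r(2) using h.iso_free_product[OF conjunct1[OF l]] .
  have ex: "\<exists>g\<in>carrier G. H' j = cjset g (H j)" if j: "j \<in> {1..n}" for j
  proof -
    have "j \<le> n" "0 \<noteq> j" using j by auto
    then have e: "hedge n (psep n E) j 0 \<in> hyperedges n (psep n E)" unfolding hyperedges_def by blast
    obtain g where "g \<in> carrier G" "\<forall>i\<in>hedge n (psep n E) j 0 - {0}. \<rho> ` H i = cjset g (H i)"
      using bspec[OF conjunct2[OF l] e] by (elim bexE conjE)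
    moreover have "j \<in> hedge n (psep n E) j 0 - {0}" using j by (simp add: hedge_def)
    ultimately show ?thesis unfolding r(2) by blast
  qed
  have "\<exists>g\<in>carrier G. H' j = (\<lambda>h. g \<otimes> h \<otimes> inv g) ` Gs j" if j: "j \<in> {1..n}" for j
  proof -
    obtain g where g: "g \<in> carrier G" "H' j = cjset g (H j)" using ex[OF j] by blast
    obtain c where c: "c \<in> carrier G" "H j = cjset c (Gs j)" using basis_conj_sys[OF b(1)] j unfolding conj_sys_def by blast
    have "H' j = cjset (g \<otimes> c) (Gs j)" using g c cjset_mult[OF g(1) c(1) Gs_sub[OF j]] by simp
    then show ?thesis using g(1) c(1) unfolding cjset_def by (intro bexI[of _ "g \<otimes> c"]) simp_all
  qed
  moreover have "H' i = {}" if "i \<notin> {1..n}" for i using b(1) that by (simp add: r(2) is_basis_def)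
  ultimately show "basis H'" using fp by (simp add: is_basis_def)
  show "loc (psep n E) H H'"
  proof (rule locI)
    fix e assume e: "e \<in> hyperedges n (psep n E)"
    obtain g where g: "g \<in> carrier G" "0 \<in> e \<longrightarrow> g = \<one>" "\<forall>j\<in>e - {0}. \<rho> ` H j = cjset g (H j)"
      using bspec[OF conjunct2[OF l] e] by (elim bexE conjE)
    have "pos H' j = (\<lambda>c. g \<otimes> c) ` pos H j" if j: "j \<in> e" for j
    proof (cases "j = 0")
      case True then show ?thesis using g(2) j by (simp add: pos_def)
    next
      case False
      then have jn: "j \<in> {1..n}" using hyperedge_subset[OF e] j by auto
      have "H' j = cjset g (H j)" using g(3) j False by (simp add: r(2))
      then show ?thesis using pos_cjset[where H' = H', OF basis_conj_sys[OF b(1)] jn g(1)] by simp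
    qed
    then show "\<exists>g\<in>carrier G. \<forall>j\<in>e. pos H' j = (\<lambda>c. g \<otimes> c) ` pos H j" by (intro bexI[OF _ g(1)] ballI)
  qed
qed

lemma ident_local:
  assumes i: "((H, E), (H', E')) \<in> idt" and v: "basis H" "pl_tree n E"
  shows "E' = E \<and> basis H' \<and> loc (psep n E) H H'"
proof -
  have "E'' = E \<and> basis H'' \<and> loc (psep n E) H H''" if "((H, E), z) \<in> idt" "z = (H'', E'')" for z H'' E''
    using that unfolding ident_def
  proof (induction arbitrary: H'' E'' rule: rtrancl_induct)
    case base then show ?case using v loc_refl by simp
  next
    case (step y z)
    obtain K F where y: "y = (K, F)" by (cases y)
    have IH: "F = E" "basis K" "loc (psep n E) H K" using step.IH[OF y] by auto
    show ?case
    proof (cases "(y, z) \<in> ident_step G Gs n")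
      case True
      then have s: "((K, E), (H'', E'')) \<in> ident_step G Gs n" using y step.prems IH(1) by simp
      show ?thesis using ident_step_local[OF s] loc_trans[OF IH(3)] by simp
    next
      case False
      then have s: "((H'', E''), (K, E)) \<in> ident_step G Gs n" using step.hyps(2) y step.prems IH(1) by simp
      note l = ident_step_local[OF s]
      show ?thesis using l loc_trans[OF IH(3) loc_sym, of H''] by auto
    qed
  qed
  then show ?thesis using i by blast
qed

text \<open>Every identification over the coarser tree is also available over the finer one. This
  lets a larger class be represented over any basis of a smaller one.\<close>

lemma ident_mono:
  assumes i: "((H, E), (H', E)) \<in> idt" and v: "basis H" "pl_tree n E" and E2: "pl_tree n E2"
    and r: "sep_refine n (psep n E) (psep n E2)"
  shows "((H, E2), (H', E2)) \<in> idt"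
proof -
  have st: "((K, E2), (K', E2)) \<in> ident_step G Gs n" if "((K, E), (K', E)) \<in> ident_step G Gs n" for K K'
    using that E2 carried_prod_mono[OF v(2) E2 r] by (auto simp: ident_step_def valid_pairs_def)
  have "((H, E2), (H'', E2)) \<in> idt" if "((H, E), z) \<in> idt" "z = (H'', E'')" for z H'' E''
    using that unfolding ident_def
  proof (induction arbitrary: H'' E'' rule: rtrancl_induct)
    case base then show ?case by simp
  next
    case (step y z)
    obtain K F where y: "y = (K, F)" by (cases y)
    have "((H, E), y) \<in> idt" "((H, E), z) \<in> idt"
      unfolding ident_def using step.hyps(1) rtrancl.rtrancl_into_rtrancl[OF step.hyps] by simp_all
    then have F: "F = E" "E'' = E" using ident_local[OF _ v] y step.prems by blast+
    have "((K, E2), (H'', E2)) \<in> ident_step G Gs n \<union> (ident_step G Gs n)\<inverse>"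
      using step.hyps(2) y step.prems F st by auto
    then show ?case using step.IH[OF y] by (meson rtrancl.rtrancl_into_rtrancl)
  qed
  then show ?thesis using i by blast
qed

text \<open>Rotations about different labels do not interfere, so the labels can be aligned one at a time.\<close>

lemma align_step:
  assumes K: "basis K" and r: "sep_refine n C A" and T: "T = hyperedges n C"
    and C: "\<And>k i j. C k i j \<Longrightarrow> R0 K k (toward n A k i) (toward n A k j)" and k: "k \<in> {1..n}"
  shows "\<exists>K'. ((K, T), (K', T)) \<in> idt \<and> basis K' \<and>
     (\<forall>k' f g. k' \<noteq> k \<and> nbr n A k' f \<and> nbr n A k' g \<longrightarrow> R0 K' k' f g = R0 K k' f g) \<and>
     (\<forall>i j. i \<le> n \<and> j \<le> n \<and> i \<noteq> k \<and> j \<noteq> k \<longrightarrow> R0 K' k (toward n A k i) (toward n A k j))"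
proof -
  interpret sep_refine n C A by fact
  have T': "pl_tree n T" "psep n T = C" using c.pl_tree_of_sep[OF n1] by (simp_all add: T)
  interpret h: free_product G K n using basis_fp[OF K] .
  have cs: "conj_sys K" using basis_conj_sys[OF K] .
  have kn: "k \<le> n" "0 \<noteq> k" using k by auto
  let ?t = "toward n A k"
  have tn: "?t j \<le> n" "?t j \<noteq> k" if "j \<le> n" "j \<noteq> k" for j
    using f.toward(1)[OF kn(1) that] by (auto simp: nbr_def)
  have dp: "dirn K k (?t j) \<in> pos K k" if "j \<le> n" "j \<noteq> k" for j using dirn(1)[OF cs k tn[OF that]] .
  \<comment> \<open>Rotates each direction at \<open>k\<close> onto the one towards the base label;
    quotients of elements of \<open>pos K k\<close> lie in \<open>K k\<close>.\<close>
  define x where "x j = (if j \<in> {1..n} - {k} then dirn K k (?t 0) \<otimes> inv (dirn K k (?t j)) else \<one>)" for j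
  have o: "\<one> \<in> K k" using subgroup.one_closed[OF basis_sub[OF K k]] .
  have xK: "x j \<in> K k" for j
    unfolding x_def using pos_stab(2)[OF k dp[of j] dp[of 0]] o kn by auto
  have xk: "x k = \<one>" by (simp add: x_def)
  obtain \<phi> where p: "\<phi> \<in> iso G G" "\<forall>j\<in>{1..n}. \<forall>h\<in>K j. \<phi> h = x j \<otimes> h \<otimes> inv (x j)"
    using h.whitehead_automorphism[OF k, of x] xK xk by blast
  have deq: "dirn K k (?t i) = dirn K k (?t j)" if "C k i j" for i j
    using C[OF that] kn by (auto simp: R0_def)
  have x0: "x j = dirn K k (?t 0) \<otimes> inv (dirn K k (?t j))" if "j \<le> n" "j \<noteq> k" for j
  proof (cases "j = 0")
    case True
    have "dirn K k (?t 0) \<in> carrier G" using dp[of 0] kn pos_carrier by auto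
    then show ?thesis using True by (simp add: x_def)
  qed (use that in \<open>simp add: x_def\<close>)
  have xc: "x i = x j" if "C k i j" for i j
    using x0[of i] x0[of j] deq[OF that] c.dom[OF that] by simp
  have x00: "x 0 = \<one>" by (simp add: x_def)
  have w: "wh_carried G n K T \<phi>"
    unfolding wh_carried_iff[OF T'(1)] T'(2)
  proof (intro exI conjI)
    show "\<forall>i j. C k i j \<and> i \<noteq> 0 \<and> j \<noteq> 0 \<longrightarrow> x i = x j" using xc by blast
    show "\<forall>j. C k 0 j \<and> j \<noteq> 0 \<longrightarrow> x j = \<one>" using xc[of 0] x00 by metis
  qed (use k xK xk p in auto)
  define K' where "K' j = \<phi> ` K j" for j
  have "\<phi> \<circ> id \<in> carried_prod G n K T" by (intro carried_prod.intros w)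
  then have st: "((K, T), (K', T)) \<in> ident_step G Gs n"
    unfolding ident_step_def valid_pairs_def K'_def using K T'(1) by auto
  have bK': "basis K'" using ident_step_local(4)[OF st] .
  have id: "((K, T), (K', T)) \<in> idt" unfolding ident_def using st by blast
  have xG: "x j \<in> carrier G" for j using subgroup.mem_carrier[OF basis_sub[OF K k] xK] .
  have pp: "pos K' j = (\<lambda>c. x j \<otimes> c) ` pos K j" if "j \<le> n" for j
  proof (cases "j = 0")
    case True then show ?thesis by (simp add: pos_def x_def)
  next
    case False
    then have j: "j \<in> {1..n}" using that by simp
    have "K' j = cjset (x j) (K j)" unfolding K'_def cjset_def by (rule image_cong[OF refl]) (use p(2) j in simp)
    then show ?thesis by (rule pos_cjset[where H' = K', OF cs j xG])
  qed
  \<comment> \<open>Elements of \<open>K k\<close> stabilize \<open>pos K k\<close>, so any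
    \<open>x i\<close> may be used there to match the translation of a neighbour.\<close>
  have ppk: "pos K' k = (\<lambda>c. x i \<otimes> c) ` pos K k" for i
  proof -
    have K'k: "K' k = K k"
    proof -
      have "\<phi> ` K k = (\<lambda>h. h) ` K k"
        by (rule image_cong[OF refl]) (use p(2) k xk subgroup.mem_carrier[OF basis_sub[OF K k]] in simp)
      then show ?thesis by (simp add: K'_def)
    qed
    then have "K' k = cjset (x i) (K k)" using cjset_self[OF basis_sub[OF K k] xK] by simp
    then show ?thesis by (rule pos_cjset[where H' = K', OF cs k xG])
  qed
  have xA: "x i = x j" if "A k i j" for i j using xc finer[OF that] by simp
  have "R0 K' k' a b = R0 K k' a b" if h: "k' \<noteq> k" "nbr n A k' a" "nbr n A k' b" for k' a b
  proof (rule R0_translate[OF cs xG[of k']])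
    fix j assume j: "j \<in> {k', a, b}"
    have jn: "j \<le> n" using j h by (auto simp: nbr_def)
    show "pos K' j = (\<lambda>c. x k' \<otimes> c) ` pos K j"
    proof (cases "j = k")
      case True then show ?thesis using ppk by simp
    next
      case False
      \<comment> \<open>Neighbours of \<open>k'\<close> other than \<open>k\<close> lie on the side
        of \<open>k\<close> that contains \<open>k'\<close>, so all of them are translated by
        \<open>x k'\<close>.\<close>
      have "x j = x k'"
      proof (cases "j = k'")
        case jk: False
        then have "nbr n A k' j" using j h by auto
        then have "A k k' j" using h(1) False kn unfolding nbr_def by auto
        then show ?thesis using xA by simp
      qed simp
      then show ?thesis using pp[OF jn] by simp
    qed
  qed
  moreover have "R0 K' k (?t i) (?t j)" if ij: "i \<le> n" "j \<le> n" "i \<noteq> k" "j \<noteq> k" for i j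
  proof -
    have d: "dirn K' k (?t i) = dirn K k (?t 0)" if i: "i \<le> n" "i \<noteq> k" for i
    proof -
      note t = tn[OF i]
      have "x (?t i) = x i" using xA f.toward_R[OF kn(1) i] by blast
      have "dirn K' k (?t i) = x (?t i) \<otimes> dirn K k (?t i)"
        using dirn_translate[OF cs k t xG ppk pp[OF t(1)]] .
      also have "\<dots> = (dirn K k (?t 0) \<otimes> inv (dirn K k (?t i))) \<otimes> dirn K k (?t i)"
        unfolding \<open>x (?t i) = x i\<close> x0[OF i] ..
      also have "\<dots> = dirn K k (?t 0)" using pos_carrier[OF dp[OF i]] pos_carrier[OF dp[of 0]] kn by (simp add: m_assoc)
      finally show ?thesis .
    qed
    show ?thesis using d[OF ij(1,3)] d[OF ij(2,4)] tn[OF ij(1,3)] tn[OF ij(2,4)] kn by (simp add: R0_def)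
  qed
  ultimately show ?thesis using id bK' by (intro exI[of _ K']) simp
qed

text \<open>To be carried by \<open>T\<close>, the rotation at \<open>k\<close> must be constant on
  the petals of \<open>C\<close>. Alignment within these petals is therefore required and is kept
  through the induction over the labels.\<close>

lemma align_exists:
  assumes K: "basis K" and r: "sep_refine n C A" and T: "T = hyperedges n C"
    and C: "\<And>k i j. C k i j \<Longrightarrow> R0 K k (toward n A k i) (toward n A k j)"
  shows "\<exists>K'. ((K, T), (K', T)) \<in> idt \<and> basis K' \<and> aligned A K'"
proof -
  interpret sep_refine n C A by fact
  have "m \<le> n \<Longrightarrow> \<exists>K'. ((K, T), (K', T)) \<in> idt \<and> basis K' \<and>
      (\<forall>k i j. C k i j \<longrightarrow> R0 K' k (toward n A k i) (toward n A k j)) \<and>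
      (\<forall>k i j. k \<le> m \<and> i \<le> n \<and> j \<le> n \<and> i \<noteq> k \<and> j \<noteq> k \<longrightarrow> R0 K' k (toward n A k i) (toward n A k j))" for m
  proof (induction m)
    case 0
    have "R0 K 0 (toward n A 0 i) (toward n A 0 j)" if "i \<le> n" "j \<le> n" "i \<noteq> 0" "j \<noteq> 0" for i j
      using f.toward(1)[of 0 i] f.toward(1)[of 0 j] that by (auto simp: R0_def nbr_def)
    then show ?case using K C unfolding ident_def by (intro exI[of _ K]) auto
  next
    case (Suc m)
    then obtain K1 where K1: "((K, T), (K1, T)) \<in> idt" "basis K1"
      "\<And>k i j. C k i j \<Longrightarrow> R0 K1 k (toward n A k i) (toward n A k j)"
      "\<And>k i j. k \<le> m \<Longrightarrow> i \<le> n \<Longrightarrow> j \<le> n \<Longrightarrow> i \<noteq> k \<Longrightarrow> j \<noteq> k \<Longrightarrow> R0 K1 k (toward n A k i) (toward n A k j)" by auto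
    have k: "Suc m \<in> {1..n}" using Suc.prems by simp
    obtain K2 where K2: "((K1, T), (K2, T)) \<in> idt" "basis K2"
      "\<And>k' f g. k' \<noteq> Suc m \<Longrightarrow> nbr n A k' f \<Longrightarrow> nbr n A k' g \<Longrightarrow> R0 K2 k' f g = R0 K1 k' f g"
      "\<And>i j. i \<le> n \<Longrightarrow> j \<le> n \<Longrightarrow> i \<noteq> Suc m \<Longrightarrow> j \<noteq> Suc m \<Longrightarrow> R0 K2 (Suc m) (toward n A (Suc m) i) (toward n A (Suc m) j)"
      using align_step[OF K1(2) r T K1(3) k] by blast
    have pres: "R0 K2 k (toward n A k i) (toward n A k j)"
      if h: "R0 K1 k (toward n A k i) (toward n A k j)" "k \<le> n" "i \<le> n" "j \<le> n" "i \<noteq> k" "j \<noteq> k" for k i j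
    proof (cases "k = Suc m")
      case True then show ?thesis using K2(4) h by blast
    next
      case False
      then show ?thesis using K2(3)[OF False f.toward(1)[OF h(2,3,5)] f.toward(1)[OF h(2,4,6)]] h(1) by simp
    qed
    have "((K, T), (K2, T)) \<in> idt" using K1(1) K2(1) unfolding ident_def by (rule rtrancl_trans)
    moreover have "\<forall>k i j. C k i j \<longrightarrow> R0 K2 k (toward n A k i) (toward n A k j)"
      using pres K1(3) c.dom by blast
    moreover have "R0 K2 k (toward n A k i) (toward n A k j)"
      if h: "k \<le> Suc m" "i \<le> n" "j \<le> n" "i \<noteq> k" "j \<noteq> k" for k i j
    proof (cases "k = Suc m")
      case True then show ?thesis using K2(4) h by blast
    next
      case False
      then show ?thesis using pres[OF K1(4)] h Suc.prems by auto
    qed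
    ultimately show ?case using K2(2) by blast
  qed
  from this[of n] show ?thesis unfolding aligned_def by auto
qed

end

section \<open>Homotopies of realizations of posets\<close>

definition supp :: "('v \<Rightarrow> real) \<Rightarrow> 'v set" where
  "supp t = {v. t v \<noteq> 0}"

lemma chain_mono: "is_chain_in P lq \<sigma> \<Longrightarrow> \<tau> \<subseteq> \<sigma> \<Longrightarrow> \<tau> \<noteq> {} \<Longrightarrow> is_chain_in P lq \<tau>"
  unfolding is_chain_in_def by (meson finite_subset subset_iff)

lemma chain_subset: "is_chain_in P lq \<sigma> \<Longrightarrow> P \<subseteq> Q \<Longrightarrow> is_chain_in Q lq \<sigma>"
  unfolding is_chain_in_def by auto

lemma simplex_mono:
  assumes "\<sigma> \<subseteq> \<tau>" "finite \<tau>" shows "closed_simplex \<sigma> \<subseteq> closed_simplex \<tau>"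
proof
  fix t assume t: "t \<in> closed_simplex \<sigma>"
  have "sum t \<tau> = sum t \<sigma>"
    by (rule sum.mono_neutral_right) (use assms t in \<open>auto simp: closed_simplex_def\<close>)
  then show "t \<in> closed_simplex \<tau>" using t assms by (auto simp: closed_simplex_def)
qed

lemma simplex_supp:
  assumes "t \<in> closed_simplex \<sigma>" "finite \<sigma>"
  shows "supp t \<subseteq> \<sigma>" "supp t \<noteq> {}" "t \<in> closed_simplex (supp t)"
proof -
  show s: "supp t \<subseteq> \<sigma>" using assms by (auto simp: closed_simplex_def supp_def)
  have "sum t (supp t) = sum t \<sigma>"
    by (rule sum.mono_neutral_left) (use assms s in \<open>auto simp: supp_def\<close>)
  then show "t \<in> closed_simplex (supp t)" using assms by (auto simp: closed_simplex_def supp_def)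
  then show "supp t \<noteq> {}" by (auto simp: closed_simplex_def)
qed

lemma realization_iff:
  "t \<in> realization_space P lq \<longleftrightarrow> is_chain_in P lq (supp t) \<and> t \<in> closed_simplex (supp t)"
proof
  assume "t \<in> realization_space P lq"
  then obtain \<sigma> where s: "is_chain_in P lq \<sigma>" "t \<in> closed_simplex \<sigma>"
    by (auto simp: realization_space_def)
  then have "finite \<sigma>" by (simp add: is_chain_in_def)
  then show "is_chain_in P lq (supp t) \<and> t \<in> closed_simplex (supp t)"
    using simplex_supp[OF s(2)] chain_mono[OF s(1)] by blast
qed (auto simp: realization_space_def)

lemma simplex_in_realization:
  "is_chain_in P lq \<sigma> \<Longrightarrow> t \<in> closed_simplex \<sigma> \<Longrightarrow> t \<in> realization_space P lq"
  by (auto simp: realization_space_def)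

lemma realization_mono: "P \<subseteq> Q \<Longrightarrow> realization_space P lq \<subseteq> realization_space Q lq"
  using chain_subset by (fastforce simp: realization_iff)

lemma closed_simplex_closed: "finite \<sigma> \<Longrightarrow> closed (closed_simplex \<sigma>)"
proof -
  assume fin: "finite \<sigma>"
  have c: "continuous_on UNIV (\<lambda>t::'a\<Rightarrow>real. t v)" for v by simp
  have eq: "closed_simplex \<sigma> = (\<Inter>v. {t. 0 \<le> t v}) \<inter> (\<Inter>v\<in>-\<sigma>. {t. t v = 0}) \<inter> {t. sum t \<sigma> = 1}"
    by (auto simp: closed_simplex_def)
  have "continuous_on UNIV (\<lambda>t::'a\<Rightarrow>real. sum t \<sigma>)"
    by (rule continuous_on_sum) (rule c)
  then have 1: "closed {t::'a\<Rightarrow>real. sum t \<sigma> = 1}"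
    by (rule closed_Collect_eq[OF _ continuous_on_const])
  have 2: "closed (\<Inter>v\<in>-\<sigma>. {t::'a\<Rightarrow>real. t v = 0})"
    by (rule closed_INT) (simp add: closed_Collect_eq[OF c continuous_on_const])
  have 3: "closed (\<Inter>v. {t::'a\<Rightarrow>real. 0 \<le> t v})"
    by (rule closed_INT) (simp add: closed_Collect_le[OF continuous_on_const c])
  show ?thesis unfolding eq by (rule closed_Int[OF closed_Int[OF 3 2] 1])
qed

lemma openin_realization:
  "openin (geometric_realization P lq) U \<longleftrightarrow> U \<subseteq> realization_space P lq \<and>
     (\<forall>\<sigma>. is_chain_in P lq \<sigma> \<longrightarrow> openin (top_of_set (closed_simplex \<sigma>)) (U \<inter> closed_simplex \<sigma>))"
proof -
  let ?P = "\<lambda>U. U \<subseteq> realization_space P lq \<and>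
     (\<forall>\<sigma>. is_chain_in P lq \<sigma> \<longrightarrow> openin (top_of_set (closed_simplex \<sigma>)) (U \<inter> closed_simplex \<sigma>))"
  have "istopology ?P"
    unfolding istopology_def
  proof (intro conjI allI impI; (elim conjE)?)
    fix S T assume h: "\<forall>\<sigma>. is_chain_in P lq \<sigma> \<longrightarrow> openin (top_of_set (closed_simplex \<sigma>)) (S \<inter> closed_simplex \<sigma>)"
      "\<forall>\<sigma>. is_chain_in P lq \<sigma> \<longrightarrow> openin (top_of_set (closed_simplex \<sigma>)) (T \<inter> closed_simplex \<sigma>)"
    fix \<sigma> assume "is_chain_in P lq \<sigma>"
    then have "openin (top_of_set (closed_simplex \<sigma>)) ((S \<inter> closed_simplex \<sigma>) \<inter> (T \<inter> closed_simplex \<sigma>))"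
      by (intro openin_Int[of _ "S \<inter> closed_simplex \<sigma>" "T \<inter> closed_simplex \<sigma>"]) (use h in blast)+
    moreover have "(S \<inter> closed_simplex \<sigma>) \<inter> (T \<inter> closed_simplex \<sigma>) = (S \<inter> T) \<inter> closed_simplex \<sigma>" by auto
    ultimately show "openin (top_of_set (closed_simplex \<sigma>)) ((S \<inter> T) \<inter> closed_simplex \<sigma>)" by simp
  next
    fix K \<sigma> assume h: "\<forall>k\<in>K. ?P k" "is_chain_in P lq \<sigma>"
    have "openin (top_of_set (closed_simplex \<sigma>)) (\<Union>k\<in>K. k \<inter> closed_simplex \<sigma>)"
      using h by (intro openin_Union) auto
    then show "openin (top_of_set (closed_simplex \<sigma>)) (\<Union>K \<inter> closed_simplex \<sigma>)" by simp
  qed (auto)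
  then show ?thesis
    unfolding geometric_realization_def euclidean_product_topology by (simp add: topology_inverse')
qed

lemma topspace_realization [simp]: "topspace (geometric_realization P lq) = realization_space P lq"
proof
  show "topspace (geometric_realization P lq) \<subseteq> realization_space P lq"
    using openin_realization openin_topspace by blast
  have "openin (geometric_realization P lq) (realization_space P lq)"
    unfolding openin_realization
  proof (intro conjI allI impI)
    fix \<sigma> assume "is_chain_in P lq \<sigma>"
    then have "realization_space P lq \<inter> closed_simplex \<sigma> = closed_simplex \<sigma>"
      using simplex_in_realization by blast
    then show "openin (top_of_set (closed_simplex \<sigma>)) (realization_space P lq \<inter> closed_simplex \<sigma>)" by simp
  qed simp
  then show "realization_space P lq \<subseteq> topspace (geometric_realization P lq)"
    by (rule openin_subset)
qed

text \<open>If all supports lie in one finite set, only finitely many closed simplices matter, and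
  on their union the weak topology is no finer than the product topology.\<close>

lemma continuous_map_into_realization:
  assumes f: "continuous_map X euclidean f" and fin: "finite F"
    and im: "\<And>x. x \<in> topspace X \<Longrightarrow> f x \<in> realization_space P lq \<and> supp (f x) \<subseteq> F"
  shows "continuous_map X (geometric_realization P lq) f"
  unfolding continuous_map
proof (intro conjI allI impI)
  show "f ` topspace X \<subseteq> topspace (geometric_realization P lq)" using im by auto
  fix U assume U: "openin (geometric_realization P lq) U"
  define C where "C = (\<Union>\<sigma>\<in>{\<sigma>. \<sigma> \<subseteq> F \<and> is_chain_in P lq \<sigma>}. closed_simplex \<sigma> - U)"
  have "closed (closed_simplex \<sigma> - U)" if "is_chain_in P lq \<sigma>" for \<sigma>
  proof -
    have "openin (top_of_set (closed_simplex \<sigma>)) (U \<inter> closed_simplex \<sigma>)"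
      using U that by (auto simp: openin_realization)
    then have "closedin (top_of_set (closed_simplex \<sigma>)) (closed_simplex \<sigma> - (U \<inter> closed_simplex \<sigma>))"
      by (auto intro: closedin_diff)
    moreover have "closed_simplex \<sigma> - (U \<inter> closed_simplex \<sigma>) = closed_simplex \<sigma> - U" by auto
    ultimately show ?thesis using closed_simplex_closed that
      by (metis closedin_closed_trans is_chain_in_def)
  qed
  then have "closed C" unfolding C_def
    by (intro closed_UN) (use fin in auto)
  then have "openin X {x \<in> topspace X. f x \<in> - C}"
    by (intro openin_continuous_map_preimage[OF f]) auto
  moreover have "f x \<in> - C \<longleftrightarrow> f x \<in> U" if x: "x \<in> topspace X" for x
    using im[OF x] unfolding C_def realization_iff by blast
  then have "{x \<in> topspace X. f x \<in> - C} = {x \<in> topspace X. f x \<in> U}" by blast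
  ultimately show "openin X {x \<in> topspace X. f x \<in> U}" by simp
qed

text \<open>Since the unit interval is locally compact, the product of the realization with the unit
  interval still carries the weak topology with respect to the prisms over its simplices.\<close>

lemma continuous_map_from_prisms:
  assumes f: "\<And>\<sigma>. is_chain_in P lq \<sigma> \<Longrightarrow>
      continuous_map (prod_topology (top_of_set {0..1::real}) (top_of_set (closed_simplex \<sigma>))) Y f"
  shows "continuous_map (prod_topology (top_of_set {0..1}) (geometric_realization P lq)) Y f"
  unfolding continuous_map
proof (intro conjI allI impI)
  let ?I = "{0..1::real}" and ?R = "realization_space P lq"
  show "f ` topspace (prod_topology (top_of_set ?I) (geometric_realization P lq)) \<subseteq> topspace Y"
  proof (clarsimp)
    fix u :: real and x assume u: "0 \<le> u" "u \<le> 1" and x: "x \<in> ?R"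
    then obtain \<sigma> where s: "is_chain_in P lq \<sigma>" "x \<in> closed_simplex \<sigma>" by (auto simp: realization_space_def)
    have "(u, x) \<in> topspace (prod_topology (top_of_set ?I) (top_of_set (closed_simplex \<sigma>)))" using u s by simp
    then show "f (u, x) \<in> topspace Y" using continuous_map_image_subset_topspace[OF f[OF s(1)]] by blast
  qed
  fix W assume W: "openin Y W"
  let ?A = "{z \<in> topspace (prod_topology (top_of_set ?I) (geometric_realization P lq)). f z \<in> W}"
  have pre: "openin (prod_topology (top_of_set ?I) (top_of_set (closed_simplex \<sigma>)))
      {z \<in> ?I \<times> closed_simplex \<sigma>. f z \<in> W}" if "is_chain_in P lq \<sigma>" for \<sigma>
    using openin_continuous_map_preimage[OF f[OF that] W] by simp
  show "openin (prod_topology (top_of_set ?I) (geometric_realization P lq)) ?A"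
    unfolding openin_prod_topology_alt
  proof (intro allI impI)
    fix u x assume "(u, x) \<in> ?A"
    then have u: "u \<in> ?I" and x: "x \<in> ?R" and ux: "f (u, x) \<in> W" by auto
    then obtain \<sigma> where s: "is_chain_in P lq \<sigma>" "x \<in> closed_simplex \<sigma>" by (auto simp: realization_space_def)
    obtain U V where UV: "openin (top_of_set ?I) U" "u \<in> U" "x \<in> V"
        "U \<times> V \<subseteq> {z \<in> ?I \<times> closed_simplex \<sigma>. f z \<in> W}"
    proof -
      have "(u, x) \<in> {z \<in> ?I \<times> closed_simplex \<sigma>. f z \<in> W}" using u s(2) ux by simp
      then show ?thesis using pre[OF s(1)] that unfolding openin_prod_topology_alt by blast
    qed
    obtain \<epsilon> where eps: "\<epsilon> > 0" "cball u \<epsilon> \<inter> ?I \<subseteq> U"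
      using UV(1,2) unfolding openin_contains_cball by blast
    define J where "J = cball u \<epsilon> \<inter> ?I"
    have J: "compactin (top_of_set ?I) J" unfolding J_def
      by (auto simp: compactin_subtopology intro: compact_Int)
    \<comment> \<open>Compactness of \<open>J\<close> and the tube lemma make the trace of this set
      on each simplex open.\<close>
    define V' where "V' = {y \<in> ?R. \<forall>s\<in>J. f (s, y) \<in> W}"
    have "openin (geometric_realization P lq) V'"
      unfolding openin_realization
    proof (intro conjI allI impI)
      fix \<tau> assume t: "is_chain_in P lq \<tau>"
      show "openin (top_of_set (closed_simplex \<tau>)) (V' \<inter> closed_simplex \<tau>)"
      proof (subst openin_subopen, intro ballI)
        fix y assume y: "y \<in> V' \<inter> closed_simplex \<tau>"
        have "J \<times> {y} \<subseteq> {z \<in> ?I \<times> closed_simplex \<tau>. f z \<in> W}"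
          using y by (auto simp: V'_def J_def)
        from tube_lemma_left[OF pre[OF t] J _ this] y obtain A B where AB:
          "openin (top_of_set (closed_simplex \<tau>)) B" "J \<subseteq> A" "y \<in> B" "A \<times> B \<subseteq> {z \<in> ?I \<times> closed_simplex \<tau>. f z \<in> W}"
          by auto
        have "B \<subseteq> V' \<inter> closed_simplex \<tau>"
        proof
          fix b assume b: "b \<in> B"
          then have bt: "b \<in> closed_simplex \<tau>" using openin_subset[OF AB(1)] by auto
          then show "b \<in> V' \<inter> closed_simplex \<tau>"
            using AB b simplex_in_realization[OF t bt] by (auto simp: V'_def)
        qed
        then show "\<exists>T. openin (top_of_set (closed_simplex \<tau>)) T \<and> y \<in> T \<and> T \<subseteq> V' \<inter> closed_simplex \<tau>"
          using AB by blast
      qed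
    qed (auto simp: V'_def)
    moreover have "openin (top_of_set ?I) (ball u \<epsilon> \<inter> ?I)"
      using openin_open_Int[OF open_ball, of ?I u \<epsilon>] by (simp add: Int_commute)
    moreover have "x \<in> V'" using x eps UV by (auto simp: V'_def J_def)
    moreover have "(ball u \<epsilon> \<inter> ?I) \<times> V' \<subseteq> ?A" by (auto simp: V'_def J_def)
    ultimately show "\<exists>U V. openin (top_of_set ?I) U \<and> openin (geometric_realization P lq) V \<and> u \<in> U \<and> x \<in> V \<and> U \<times> V \<subseteq> ?A"
      using u eps by (intro exI[of _ "ball u \<epsilon> \<inter> ?I"] exI[of _ V']) auto
  qed
qed

lemma homotopy_from_prisms:
  assumes "\<And>\<sigma>. is_chain_in P lq \<sigma> \<Longrightarrow> continuous_on ({0..1::real} \<times> closed_simplex \<sigma>) h"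
    and "\<And>\<sigma>. is_chain_in P lq \<sigma> \<Longrightarrow> \<exists>F. finite F \<and>
      (\<forall>u\<in>{0..1}. \<forall>t\<in>closed_simplex \<sigma>. h (u, t) \<in> realization_space Q lq \<and> supp (h (u, t)) \<subseteq> F)"
  shows "continuous_map (prod_topology (top_of_set {0..1}) (geometric_realization P lq))
    (geometric_realization Q lq) h"
proof (rule continuous_map_from_prisms)
  fix \<sigma> assume s: "is_chain_in P lq \<sigma>"
  obtain F where F: "finite F"
    "\<And>u t. u \<in> {0..1} \<Longrightarrow> t \<in> closed_simplex \<sigma> \<Longrightarrow> h (u, t) \<in> realization_space Q lq \<and> supp (h (u, t)) \<subseteq> F"
    using assms(2)[OF s] by blast
  show "continuous_map (prod_topology (top_of_set {0..1}) (top_of_set (closed_simplex \<sigma>))) (geometric_realization Q lq) h"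
  proof (rule continuous_map_into_realization[OF _ F(1)])
    show "continuous_map (prod_topology (top_of_set {0..1}) (top_of_set (closed_simplex \<sigma>))) euclidean h"
      using assms(1)[OF s] by simp
    fix z assume "z \<in> topspace (prod_topology (top_of_set {0..1::real}) (top_of_set (closed_simplex \<sigma>)))"
    then show "h z \<in> realization_space Q lq \<and> supp (h z) \<subseteq> F" using F(2)[of "fst z" "snd z"] by (cases z) simp
  qed
qed

lemma continuous_map_from_simplices:
  assumes "\<And>\<sigma>. is_chain_in P lq \<sigma> \<Longrightarrow> continuous_on (closed_simplex \<sigma>) f"
    and "\<And>\<sigma>. is_chain_in P lq \<sigma> \<Longrightarrow> \<exists>F. finite F \<and>
      (\<forall>t\<in>closed_simplex \<sigma>. f t \<in> realization_space Q lq \<and> supp (f t) \<subseteq> F)"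
  shows "continuous_map (geometric_realization P lq) (geometric_realization Q lq) f"
proof -
  have "continuous_map (prod_topology (top_of_set {0..1::real}) (geometric_realization P lq))
      (geometric_realization Q lq) (\<lambda>z. f (snd z))"
  proof (rule homotopy_from_prisms)
    fix \<sigma> assume s: "is_chain_in P lq \<sigma>"
    show "continuous_on ({0..1::real} \<times> closed_simplex \<sigma>) (\<lambda>z. f (snd z))"
      by (rule continuous_on_compose2[OF assms(1)[OF s]]) (auto intro: continuous_intros)
    show "\<exists>F. finite F \<and> (\<forall>u\<in>{0..1::real}. \<forall>t\<in>closed_simplex \<sigma>.
        f (snd (u, t)) \<in> realization_space Q lq \<and> supp (f (snd (u, t))) \<subseteq> F)"
      using assms(2)[OF s] by auto
  qed
  moreover have "continuous_map (geometric_realization P lq)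
      (prod_topology (top_of_set {0..1::real}) (geometric_realization P lq)) (\<lambda>x. (0, x))"
    by (auto simp: continuous_map_paired continuous_map_id[unfolded id_def])
  ultimately show ?thesis
    using continuous_map_compose[of "geometric_realization P lq"
        "prod_topology (top_of_set {0..1::real}) (geometric_realization P lq)" "\<lambda>x. (0, x)"
        "geometric_realization Q lq" "\<lambda>z. f (snd z)"] by (simp add: o_def)
qed

section \<open>Contracting an increasing union of deformation retracts\<close>

definition def_retract :: "('v \<Rightarrow> 'v \<Rightarrow> bool) \<Rightarrow> 'v set \<Rightarrow> 'v set \<Rightarrow> bool" where
  "def_retract lq Q' Q \<longleftrightarrow> (\<exists>r. continuous_map (geometric_realization Q' lq) (geometric_realization Q lq) r \<and>
     homotopic_with (\<lambda>h. \<forall>x\<in>realization_space Q lq. h x = x)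
       (geometric_realization Q' lq) (geometric_realization Q' lq) id r)"

lemma continuous_map_realization_inclusion:
  assumes "Q \<subseteq> P"
  shows "continuous_map (geometric_realization Q lq) (geometric_realization P lq) (\<lambda>x. x)"
proof (rule continuous_map_from_simplices)
  fix \<sigma> assume s: "is_chain_in Q lq \<sigma>"
  show "\<exists>F. finite F \<and> (\<forall>t\<in>closed_simplex \<sigma>. t \<in> realization_space P lq \<and> supp t \<subseteq> F)"
  proof (intro exI[of _ \<sigma>] conjI ballI)
    show "finite \<sigma>" using s by (simp add: is_chain_in_def)
    fix t assume t: "t \<in> closed_simplex \<sigma>"
    show "t \<in> realization_space P lq" using simplex_in_realization[OF chain_subset[OF s assms] t] .
    show "supp t \<subseteq> \<sigma>" using simplex_supp(1)[OF t] s by (simp add: is_chain_in_def)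
  qed
qed simp

text \<open>The deformation retractions of the stages are run one after the other, the \<open>N\<close>-th one
  during the time interval from \<open>1/2^(N+1)\<close> to \<open>1/2^N\<close>.\<close>

lemma contractible_filtration:
  fixes Y :: "nat \<Rightarrow> 'v set"
  assumes mono: "\<And>N. Y N \<subseteq> Y (Suc N)" and un: "P = (\<Union>N. Y N)" and Y0: "Y 0 = {m}" and lemm: "lq m m"
    and dr: "\<And>N. def_retract lq (Y (Suc N)) (Y N)"
  shows "contractible_space (geometric_realization P lq)"
proof -
  let ?G = "\<lambda>N. geometric_realization (Y N) lq" and ?R = "\<lambda>N. realization_space (Y N) lq"
  let ?I = "top_of_set {0..1::real}"
  have "\<exists>D. continuous_map (prod_topology ?I (?G (Suc N))) (?G (Suc N)) D \<and> (\<forall>x. D (0, x) = x) \<and>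
      continuous_map (?G (Suc N)) (?G N) (\<lambda>x. D (1, x)) \<and> (\<forall>u\<in>{0..1}. \<forall>x\<in>?R N. D (u, x) = x)" for N
  proof -
    obtain r D where r: "continuous_map (?G (Suc N)) (?G N) r"
      and D: "continuous_map (prod_topology ?I (?G (Suc N))) (?G (Suc N)) D"
        "\<forall>x. D (0, x) = id x" "\<forall>x. D (1, x) = r x" "\<forall>t\<in>{0..1}. \<forall>x\<in>?R N. D (t, x) = x"
      using dr[of N] unfolding def_retract_def homotopic_with_def by auto
    then show ?thesis by (intro exI[of _ D]) simp
  qed
  then have "\<exists>D. \<forall>N. continuous_map (prod_topology ?I (?G (Suc N))) (?G (Suc N)) (D N) \<and> (\<forall>x. D N (0, x) = x) \<and>
      continuous_map (?G (Suc N)) (?G N) (\<lambda>x. D N (1, x)) \<and> (\<forall>u\<in>{0..1}. \<forall>x\<in>?R N. D N (u, x) = x)"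
    by (intro choice allI)
  then obtain D where D: "\<And>N. continuous_map (prod_topology ?I (?G (Suc N))) (?G (Suc N)) (D N)"
    "\<And>N x. D N (0, x) = x" "\<And>N. continuous_map (?G (Suc N)) (?G N) (\<lambda>x. D N (1, x))"
    "\<And>N u x. u \<in> {0..1} \<Longrightarrow> x \<in> ?R N \<Longrightarrow> D N (u, x) = x"
    by blast
  \<comment> \<open>The retraction of the largest stage comes first in time. Clamping keeps points
    still until time \<open>1/2^(N+1)\<close>, and at time \<open>1/2^N\<close> the smaller stages
    take over.\<close>
  define K where "K = rec_nat (\<lambda>(t::real, x::'v \<Rightarrow> real). x) (\<lambda>N k (t, x). if t \<le> 1/2^N
      then D N (max 0 (min 1 (t * 2^(N+1) - 1)), x) else k (t, D N (1, x)))"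
  have K0: "K 0 (t, x) = x" for t x by (simp add: K_def)
  have KS: "K (Suc N) (t, x) = (if t \<le> 1/2^N then D N (max 0 (min 1 (t * 2^(N+1) - 1)), x) else K N (t, D N (1, x)))" for N t x
    by (simp add: K_def)
  have Kid: "K N (t, x) = x" if "t \<le> 1/2^N" for N t x
  proof (cases N)
    case (Suc M)
    have "t * 2 ^ (M+1) \<le> 1" using that Suc by (simp add: field_simps)
    moreover have "1 / 2^N \<le> (1::real) / 2^M" unfolding Suc by (simp add: divide_simps)
    then have "t \<le> 1 / 2^M" using that by linarith
    ultimately show ?thesis using D(2) Suc KS[of M t x] by simp
  qed (simp add: K0)
  have Kcont: "continuous_map (prod_topology ?I (?G N)) (?G N) (K N)" for N
  proof (induction N)
    case 0
    have "K 0 = snd" by (auto simp: K0)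
    then show ?case by (simp add: continuous_map_snd)
  next
    case (Suc N)
    let ?X = "prod_topology ?I (?G (Suc N))"
    have cf: "continuous_map ?X euclideanreal fst"
      using continuous_map_fst[of ?I "?G (Suc N)"] continuous_map_in_subtopology by blast
    have a1: "continuous_map ?X ?I (\<lambda>z. max 0 (min 1 (fst z * 2^(N+1) - 1)))"
      by (subst continuous_map_in_subtopology) (auto intro!: continuous_intros cf)
    have a2: "continuous_map ?X ?X (\<lambda>z. (max 0 (min 1 (fst z * 2^(N+1) - 1)), snd z))"
      using a1 continuous_map_snd[of ?I "?G (Suc N)"] by (simp add: continuous_map_paired)
    have A: "continuous_map ?X (?G (Suc N)) (\<lambda>z. D N (max 0 (min 1 (fst z * 2^(N+1) - 1)), snd z))"
      using continuous_map_compose[OF a2 D(1)[of N]] by (simp add: o_def)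
    have b1: "continuous_map ?X (?G N) (\<lambda>z. D N (1, snd z))"
      using continuous_map_compose[OF continuous_map_snd[of ?I "?G (Suc N)"] D(3)[of N]] by (simp add: o_def)
    have b2: "continuous_map ?X (prod_topology ?I (?G N)) (\<lambda>z. (fst z, D N (1, snd z)))"
      using b1 continuous_map_fst[of ?I "?G (Suc N)"] by (simp add: continuous_map_paired)
    have B: "continuous_map ?X (?G (Suc N)) (\<lambda>z. K N (fst z, D N (1, snd z)))"
      using continuous_map_compose[OF continuous_map_compose[OF b2 Suc] continuous_map_realization_inclusion[OF mono]]
      by (simp add: o_def)
    have "continuous_map ?X (?G (Suc N)) (\<lambda>z. if fst z \<le> 1/2^N then D N (max 0 (min 1 (fst z * 2^(N+1) - 1)), snd z)
          else K N (fst z, D N (1, snd z)))"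
    proof (rule continuous_map_cases_le)
      fix z :: "real \<times> ('v \<Rightarrow> real)" assume "fst z = 1/2^N"
      then show "D N (max 0 (min 1 (fst z * 2^(N+1) - 1)), snd z) = K N (fst z, D N (1, snd z))"
        using Kid[of "fst z" N] by simp
    qed (use cf A B in \<open>auto intro: continuous_map_from_subtopology\<close>)
    moreover have "K (Suc N) = (\<lambda>z. if fst z \<le> 1/2^N then D N (max 0 (min 1 (fst z * 2^(N+1) - 1)), snd z)
          else K N (fst z, D N (1, snd z)))"
      by (auto simp: KS)
    ultimately show ?case by simp
  qed
  \<comment> \<open>Points of the smaller stage are fixed by the outer retraction, so the
    contractions agree and glue to \<open>L\<close>.\<close>
  have Kstep: "K (Suc N) (t, x) = K N (t, x)" if "x \<in> ?R N" for N t x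
    using that KS[of N t x] Kid[of t N x] D(4)[of _ x N] by auto
  have Rmono: "?R N \<subseteq> ?R (N + j)" for N j
    by (rule realization_mono) (simp add: lift_Suc_mono_le[of Y N "N+j"] mono)
  have Kadd: "K (N + j) (t, x) = K N (t, x)" if "x \<in> ?R N" for N j t x
  proof (induction j)
    case (Suc j)
    have "x \<in> ?R (N + j)" using that Rmono by blast
    then show ?case using Suc Kstep by simp
  qed simp
  have Keq: "K M (t, x) = K N (t, x)" if "x \<in> ?R N" "x \<in> ?R M" for M N t x
    using Kadd[OF that(1), of "M - N" t] Kadd[OF that(2), of "N - M" t]
    by (metis le_add_diff_inverse nat_le_linear)
  have K1: "K N (1, x) \<in> ?R 0" if "x \<in> ?R N" for N x
    using that
  proof (induction N arbitrary: x)
    case (Suc N)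
    have "D N (1, x) \<in> ?R N" using continuous_map_image_subset_topspace[OF D(3)[of N]] Suc.prems by auto
    moreover have "K (Suc N) (1, x) = K N (1, D N (1, x))" 
    proof (cases N)
      case (Suc k)
      have "(1::real) \<le> 2 ^ k" by simp
      then have "\<not> (2::real) * 2 ^ k \<le> 1" by linarith
      then have "\<not> (1::real) \<le> 1 / 2 ^ N" unfolding Suc by (simp add: divide_simps)
      then show ?thesis using KS[of N 1 x] by simp
    qed (simp add: KS K0)
    ultimately show ?case using Suc.IH by simp
  qed (simp add: K0)
  define L where "L = (\<lambda>(t::real, x). K (LEAST N. x \<in> ?R N) (t, x))"
  have LK: "L (t, x) = K N (t, x)" if "x \<in> ?R N" for N t x
    unfolding L_def using Keq[OF that] LeastI[of "\<lambda>N. x \<in> ?R N", OF that] by simp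
  have ex: "\<exists>N. \<sigma> \<subseteq> Y N" if "is_chain_in P lq \<sigma>" for \<sigma>
  proof -
    have "finite \<sigma>" "\<sigma> \<subseteq> (\<Union>N. Y N)" using that un by (auto simp: is_chain_in_def)
    then show ?thesis
    proof (induction)
      case (insert v F)
      then obtain N M where "F \<subseteq> Y N" "v \<in> Y M" by auto
      moreover have "Y N \<subseteq> Y (max N M)" "Y M \<subseteq> Y (max N M)" using lift_Suc_mono_le[of Y] mono by simp_all
      ultimately show ?case by (intro exI[of _ "max N M"]) auto
    qed simp
  qed
  have ch: "is_chain_in (Y N) lq \<sigma>" if "is_chain_in P lq \<sigma>" "\<sigma> \<subseteq> Y N" for \<sigma> N
    using that by (auto simp: is_chain_in_def)
  have YP: "Y N \<subseteq> P" for N using un by auto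
  have "continuous_map (prod_topology ?I (geometric_realization P lq)) (geometric_realization P lq) L"
  proof (rule continuous_map_from_prisms)
    fix \<sigma> assume s: "is_chain_in P lq \<sigma>"
    obtain N where N: "\<sigma> \<subseteq> Y N" using ex[OF s] by auto
    have sN: "is_chain_in (Y N) lq \<sigma>" using ch[OF s N] .
    have fs: "finite \<sigma>" using s by (simp add: is_chain_in_def)
    let ?S = "prod_topology ?I (top_of_set (closed_simplex \<sigma>))"
    have inc: "continuous_map (top_of_set (closed_simplex \<sigma>)) (?G N) (\<lambda>x. x)"
      by (rule continuous_map_into_realization[OF _ fs])
        (use simplex_in_realization[OF sN] simplex_supp(1)[OF _ fs] in auto)
    have "continuous_map ?S (prod_topology ?I (?G N)) (\<lambda>z. (fst z, snd z))"
    proof (rule continuous_map_paired[THEN iffD2], rule conjI)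
      show "continuous_map ?S ?I fst" by (rule continuous_map_fst)
      show "continuous_map ?S (?G N) snd"
        using continuous_map_compose[OF continuous_map_snd inc, of ?I] by (simp only: o_def)
    qed
    from continuous_map_compose[OF continuous_map_compose[OF this Kcont[of N]] continuous_map_realization_inclusion[OF YP]]
    have "continuous_map ?S (geometric_realization P lq) (\<lambda>z. K N z)" by (simp only: o_def prod.collapse)
    then show "continuous_map ?S (geometric_realization P lq) L"
    proof (rule continuous_map_eq)
      fix z assume "z \<in> topspace ?S"
      then have "snd z \<in> ?R N" using simplex_in_realization[OF sN, of "snd z"] by auto
      then show "K N z = L z" using LK[of "snd z" N "fst z"] by simp
    qed
  qed
  moreover have ex': "\<exists>N. x \<in> ?R N" if "x \<in> realization_space P lq" for x
  proof -
    obtain \<sigma> where s: "is_chain_in P lq \<sigma>" "x \<in> closed_simplex \<sigma>" using \<open>x \<in> realization_space P lq\<close> by (auto simp: realization_space_def)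
    obtain N where "\<sigma> \<subseteq> Y N" using ex[OF s(1)] by auto
    then show ?thesis using simplex_in_realization[OF ch[OF s(1)] s(2)] by blast
  qed
  have L0: "L (0, x) = x" if xP: "x \<in> realization_space P lq" for x
  proof -
    obtain N where "x \<in> ?R N" using ex'[OF xP] by auto
    then show ?thesis using LK[of x N 0] Kid[of 0 N x] by simp
  qed
  have pt: "x = y" if xy: "x \<in> ?R 0" "y \<in> ?R 0" for x y
  proof -
    have w: "x v = (if v = m then 1 else 0)" if x: "x \<in> ?R 0" for x v
    proof -
      obtain \<sigma> where "is_chain_in {m} lq \<sigma>" "x \<in> closed_simplex \<sigma>"
        using x Y0 by (auto simp: realization_space_def)
      moreover then have "\<sigma> = {m}" by (auto simp: is_chain_in_def)
      ultimately show ?thesis by (auto simp: closed_simplex_def)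
    qed
    show ?thesis using w[OF xy(1)] w[OF xy(2)] by (simp add: fun_eq_iff)
  qed
  have mR: "(\<lambda>v. if v = m then 1 else 0) \<in> ?R 0"
    unfolding Y0 by (rule simplex_in_realization[of _ _ "{m}"])
      (use lemm in \<open>auto simp: is_chain_in_def closed_simplex_def\<close>)
  moreover have L1: "L (1, x) = (\<lambda>v. if v = m then 1 else 0)" if xP: "x \<in> realization_space P lq" for x
  proof -
    obtain N where N: "x \<in> ?R N" using ex'[OF xP] by auto
    then show ?thesis using K1[OF N] LK[OF N] pt[OF _ mR] by simp
  qed
  ultimately have "homotopic_with (\<lambda>h. True) (geometric_realization P lq) (geometric_realization P lq) id
      (\<lambda>x. (\<lambda>v. if v = m then 1 else 0))"
    by (subst homotopic_with, simp) (use L0 L1 in \<open>auto intro!: exI[of _ L]\<close>)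
  then show ?thesis unfolding contractible_space_def by blast
qed

section \<open>Pushing mass along a monotone map\<close>

definition above :: "('v \<Rightarrow> 'v \<Rightarrow> bool) \<Rightarrow> 'v set \<Rightarrow> ('v \<Rightarrow> real) \<Rightarrow> 'v \<Rightarrow> real" where
  "above lq \<sigma> t v = (\<Sum>w\<in>{w\<in>\<sigma>. lq v w \<and> w \<noteq> v}. t w)"

text \<open>The share of the vertex \<open>v\<close> in the top \<open>u\<close> units of mass: the
  mass above it is served first, and the remainder is clipped between \<open>0\<close> and
  \<open>t v\<close>.\<close>

definition moved :: "('v \<Rightarrow> 'v \<Rightarrow> bool) \<Rightarrow> 'v set \<Rightarrow> real \<Rightarrow> ('v \<Rightarrow> real) \<Rightarrow> 'v \<Rightarrow> real" where
  "moved lq \<sigma> u t v = max 0 (min (t v) (u - above lq \<sigma> t v))"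

text \<open>The topmost part of mass \<open>u\<close> of the point \<open>t\<close> is moved along \<open>p\<close>. A straight line from \<open>t\<close>
  to its push-forward would leave the order complex; moving the mass from the top down does not.\<close>

definition shift :: "('v \<Rightarrow> 'v \<Rightarrow> bool) \<Rightarrow> 'v set \<Rightarrow> ('v \<Rightarrow> 'v) \<Rightarrow> real \<Rightarrow> ('v \<Rightarrow> real) \<Rightarrow> 'v \<Rightarrow> real" where
  "shift lq \<sigma> p u t w = t w - moved lq \<sigma> u t w + (\<Sum>v\<in>{v\<in>\<sigma>. p v = w}. moved lq \<sigma> u t v)"

lemma above_nonneg: "t \<in> closed_simplex \<sigma> \<Longrightarrow> 0 \<le> above lq \<tau> t v"
  by (auto simp: above_def closed_simplex_def intro: sum_nonneg)

lemma moved_bounds: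
  assumes "t \<in> closed_simplex \<sigma>" shows "0 \<le> moved lq \<tau> u t v" "moved lq \<tau> u t v \<le> t v"
  using assms by (auto simp: moved_def closed_simplex_def)

lemma moved_zero: "t v = 0 \<Longrightarrow> moved lq \<tau> u t v = 0"
  by (simp add: moved_def)

lemma above_supp:
  assumes "t \<in> closed_simplex \<sigma>" "finite \<sigma>"
  shows "above lq (supp t) t v = above lq \<sigma> t v"
  unfolding above_def
  by (rule sum.mono_neutral_left) (use assms simplex_supp(1)[OF assms] in \<open>auto simp: supp_def\<close>)

lemma shift_supp:
  assumes "t \<in> closed_simplex \<sigma>" "finite \<sigma>"
  shows "shift lq (supp t) p u t = shift lq \<sigma> p u t"
proof
  fix w
  have m: "moved lq (supp t) u t v = moved lq \<sigma> u t v" for v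
    by (simp add: moved_def above_supp[OF assms])
  have "(\<Sum>v\<in>{v\<in>supp t. p v = w}. moved lq \<sigma> u t v) = (\<Sum>v\<in>{v\<in>\<sigma>. p v = w}. moved lq \<sigma> u t v)"
    by (rule sum.mono_neutral_left) (use assms simplex_supp(1)[OF assms] in \<open>auto simp: supp_def moved_zero\<close>)
  then show "shift lq (supp t) p u t w = shift lq \<sigma> p u t w" by (simp add: shift_def m)
qed

lemma shift_0: "t \<in> closed_simplex \<sigma> \<Longrightarrow> shift lq \<tau> p 0 t = t"
proof -
  assume t: "t \<in> closed_simplex \<sigma>"
  have "moved lq \<tau> 0 t v = 0" for v using above_nonneg[OF t, of lq \<tau> v] by (simp add: moved_def)
  then show ?thesis by (auto simp: shift_def)
qed

lemma shift_fixed: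
  assumes t: "t \<in> closed_simplex \<sigma>" and fin: "finite \<sigma>" and pf: "\<And>v. v \<in> supp t \<Longrightarrow> p v = v"
  shows "shift lq \<sigma> p u t = t"
proof
  fix w
  have "(\<Sum>v\<in>{v\<in>supp t. p v = w}. moved lq (supp t) u t v) = moved lq (supp t) u t w"
  proof (cases "w \<in> supp t")
    case True
    then have "{v\<in>supp t. p v = w} = {w}" using pf by auto
    then show ?thesis by simp
  next
    case False
    then have "{v\<in>supp t. p v = w} = {}" using pf by auto
    then have "(\<Sum>v\<in>{v\<in>supp t. p v = w}. moved lq (supp t) u t v) = 0" by (simp only: sum.empty)
    moreover have "t w = 0" using False by (simp add: supp_def)
    ultimately show ?thesis by (simp add: moved_zero)
  qed
  then show "shift lq \<sigma> p u t w = t w"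
    using shift_supp[OF t fin, of lq p u, symmetric] by (simp add: shift_def)
qed

lemma shift_continuous:
  assumes "finite \<sigma>" "continuous_on S g" "continuous_on S f"
  shows "continuous_on S (\<lambda>z. shift lq \<sigma> p (g z) (f z))"
proof (rule continuous_on_coordinatewise_then_product)
  fix w
  have c: "continuous_on S (\<lambda>z. f z v)" for v
    using assms(3) by (rule continuous_on_product_then_coordinatewise)
  have m: "continuous_on S (\<lambda>z. moved lq \<sigma> (g z) (f z) v)" for v
    unfolding moved_def above_def
    by (intro continuous_intros c assms)
  show "continuous_on S (\<lambda>z. shift lq \<sigma> p (g z) (f z) w)"
    unfolding shift_def by (intro continuous_intros c m)
qed

lemma shift_1:
  assumes "is_chain_in P lq \<sigma>" "t \<in> closed_simplex \<sigma>"
  shows "shift lq \<sigma> p 1 t w = (\<Sum>v\<in>{v\<in>\<sigma>. p v = w}. t v)"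
proof -
  have fin: "finite \<sigma>" using assms by (simp add: is_chain_in_def)
  have "moved lq \<sigma> 1 t v = t v" for v
  proof (cases "v \<in> \<sigma>")
    case True
    have "above lq \<sigma> t v + t v = sum t (insert v {w\<in>\<sigma>. lq v w \<and> w \<noteq> v})"
      using fin by (simp add: above_def)
    also have "\<dots> \<le> sum t \<sigma>"
      by (rule sum_mono2) (use fin True assms(2) in \<open>auto simp: closed_simplex_def\<close>)
    finally show ?thesis using assms(2) by (auto simp: moved_def closed_simplex_def)
  qed (use assms in \<open>auto simp: moved_def closed_simplex_def\<close>)
  then show ?thesis by (simp add: shift_def)
qed

locale order_on_set =
  fixes P :: "'v set" and lq :: "'v \<Rightarrow> 'v \<Rightarrow> bool"
  assumes refl_lq: "x \<in> P \<Longrightarrow> lq x x"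
    and antisym_lq: "x \<in> P \<Longrightarrow> y \<in> P \<Longrightarrow> lq x y \<Longrightarrow> lq y x \<Longrightarrow> x = y"
    and trans_lq: "x \<in> P \<Longrightarrow> y \<in> P \<Longrightarrow> z \<in> P \<Longrightarrow> lq x y \<Longrightarrow> lq y z \<Longrightarrow> lq x z"
begin

text \<open>\<open>A\<close> consists of the vertices with mass still in place, \<open>B\<close> of
  those whose mass has begun to move. Mass moves from the top down, so each element of
  \<open>A\<close> is below each element of \<open>B\<close> and hence below its image; thus
  \<open>A\<close> and the images of \<open>B\<close> form a chain.\<close>

lemma shift_realization:
  assumes s: "is_chain_in P lq \<sigma>" and t: "t \<in> closed_simplex \<sigma>"
    and p: "\<And>v. v \<in> \<sigma> \<Longrightarrow> p v \<in> P \<and> lq v (p v)"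
    and mono: "\<And>v w. v \<in> \<sigma> \<Longrightarrow> w \<in> \<sigma> \<Longrightarrow> lq v w \<Longrightarrow> lq (p v) (p w)"
  shows "shift lq \<sigma> p u t \<in> realization_space P lq" "supp (shift lq \<sigma> p u t) \<subseteq> \<sigma> \<union> p ` \<sigma>"
proof -
  let ?m = "moved lq \<sigma> u t" and ?z = "shift lq \<sigma> p u t"
  have fin: "finite \<sigma>" and sP: "\<sigma> \<subseteq> P" and tot: "\<And>a b. a \<in> \<sigma> \<Longrightarrow> b \<in> \<sigma> \<Longrightarrow> lq a b \<or> lq b a"
    using s by (auto simp: is_chain_in_def)
  define A where "A = {v\<in>\<sigma>. ?m v < t v}"
  define B where "B = {v\<in>\<sigma>. 0 < ?m v}"
  have t0: "t v = 0" if "v \<notin> \<sigma>" for v using t that by (auto simp: closed_simplex_def)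
  have key: "lq v w" if vw: "v \<in> A" "w \<in> B" for v w
  proof (rule ccontr)
    assume n: "\<not> lq v w"
    have ms: "v \<in> \<sigma>" "w \<in> \<sigma>" using vw by (auto simp: A_def B_def)
    have wv: "lq w v" using tot[OF ms] n by simp
    have wv': "w \<noteq> v" using n refl_lq[of v] ms sP by auto
    have "t v + above lq \<sigma> t v = sum t (insert v {x\<in>\<sigma>. lq v x \<and> x \<noteq> v})"
      using fin by (simp add: above_def)
    also have "\<dots> \<le> above lq \<sigma> t w"
      unfolding above_def
    proof (rule sum_mono2)
      show "insert v {x \<in> \<sigma>. lq v x \<and> x \<noteq> v} \<subseteq> {x \<in> \<sigma>. lq w x \<and> x \<noteq> w}"
      proof
        fix x assume x: "x \<in> insert v {x \<in> \<sigma>. lq v x \<and> x \<noteq> v}"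
        then have xs: "x \<in> \<sigma>" "lq v x" using ms refl_lq[of v] sP by auto
        have P: "w \<in> P" "v \<in> P" "x \<in> P" using ms xs sP by auto
        have "lq w x" using trans_lq[OF P wv xs(2)] .
        moreover have "x \<noteq> w" using antisym_lq[OF P(1,2) wv] xs(2) wv' by auto
        ultimately show "x \<in> {x \<in> \<sigma>. lq w x \<and> x \<noteq> w}" using xs by simp
      qed
    qed (use fin t in \<open>auto simp: closed_simplex_def\<close>)
    finally have "t v + above lq \<sigma> t v \<le> above lq \<sigma> t w" .
    moreover have "above lq \<sigma> t w < u" using vw by (auto simp: B_def moved_def split: if_splits)
    ultimately have "?m v = t v" using moved_bounds[OF t, of lq \<sigma> u v] t by (auto simp: moved_def closed_simplex_def)
    then show False using vw by (simp add: A_def)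
  qed
  have sub: "supp ?z \<subseteq> A \<union> p ` B"
  proof
    fix w assume w: "w \<in> supp ?z"
    show "w \<in> A \<union> p ` B"
    proof (rule ccontr)
      assume n: "w \<notin> A \<union> p ` B"
      have "t w = ?m w" using n moved_bounds[OF t, of lq \<sigma> u w] t0 by (cases "w \<in> \<sigma>") (auto simp: A_def moved_zero)
      moreover have "?m v = 0" if "v \<in> \<sigma>" "p v = w" for v
        using n that moved_bounds(1)[OF t, of lq \<sigma> u v] by (force simp: B_def)
      ultimately have "?z w = 0" by (simp add: shift_def)
      then show False using w by (simp add: supp_def)
    qed
  qed
  then show "supp ?z \<subseteq> \<sigma> \<union> p ` \<sigma>" by (auto simp: A_def B_def)
  have ch: "lq a b \<or> lq b a" if "a \<in> A \<union> p ` B" "b \<in> A \<union> p ` B" for a b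
  proof -
    have AB: "lq v (p w)" if "v \<in> A" "w \<in> B" for v w
      using key[OF that] p[of w] that sP trans_lq[of v w "p w"] by (auto simp: A_def B_def)
    have BB: "lq (p v) (p w) \<or> lq (p w) (p v)" if "v \<in> B" "w \<in> B" for v w
      using tot[of v w] mono that by (auto simp: B_def)
    have AA: "lq v w \<or> lq w v" if "v \<in> A" "w \<in> A" for v w using tot that by (auto simp: A_def)
    show ?thesis using that AB BB AA by blast
  qed
  define F where "F = \<sigma> \<union> p ` \<sigma>"
  have F: "finite F" "\<sigma> \<subseteq> F" "p ` \<sigma> \<subseteq> F" using fin by (auto simp: F_def)
  have nonneg: "0 \<le> ?z w" for w
  proof -
    have "0 \<le> (\<Sum>v\<in>{v\<in>\<sigma>. p v = w}. ?m v)" by (rule sum_nonneg) (rule moved_bounds(1)[OF t])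
    then show ?thesis using moved_bounds(2)[OF t, of lq \<sigma> u w] unfolding shift_def by linarith
  qed
  have z0: "?z w = 0" if "w \<notin> F" for w using sub that by (auto simp: supp_def F_def A_def B_def)
  have "sum ?z F = (\<Sum>w\<in>F. t w - ?m w) + (\<Sum>w\<in>F. \<Sum>v\<in>{v\<in>\<sigma>. p v = w}. ?m v)"
    by (simp add: shift_def sum.distrib)
  also have "(\<Sum>w\<in>F. \<Sum>v\<in>{v\<in>\<sigma>. p v = w}. ?m v) = sum ?m \<sigma>"
    by (rule sum.group) (use F fin in auto)
  also have "(\<Sum>w\<in>F. t w - ?m w) = (\<Sum>w\<in>\<sigma>. t w - ?m w)"
    by (rule sum.mono_neutral_right) (use F t0 in \<open>auto simp: moved_zero\<close>)
  finally have "sum ?z F = 1" using t by (simp add: sum_subtractf closed_simplex_def)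
  then have zF: "?z \<in> closed_simplex F" using nonneg z0 by (auto simp: closed_simplex_def)
  have z: "?z \<in> closed_simplex (supp ?z)" "supp ?z \<noteq> {}" using simplex_supp[OF zF F(1)] by auto
  have "finite (supp ?z)" using simplex_supp(1)[OF zF F(1)] F(1) finite_subset by blast
  moreover have "supp ?z \<subseteq> P" using sub sP p by (auto simp: A_def B_def)
  ultimately have "is_chain_in P lq (supp ?z)" unfolding is_chain_in_def using z sub ch by blast
  then show "?z \<in> realization_space P lq" using z by (auto simp: realization_iff)
qed

lemma order_subset: "Q \<subseteq> P \<Longrightarrow> order_on_set Q lq"
  unfolding order_on_set_def using refl_lq antisym_lq trans_lq by (meson subsetD)

end

lemma homotopic_relI:
  assumes "continuous_map (prod_topology (top_of_set {0..1::real}) X) Y h"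
    and "\<And>x. x \<in> topspace X \<Longrightarrow> h (0, x) = f x" "\<And>x. x \<in> topspace X \<Longrightarrow> h (1, x) = g x"
    and "A \<subseteq> topspace X" "\<And>u x. u \<in> {0..1} \<Longrightarrow> x \<in> A \<Longrightarrow> h (u, x) = x"
  shows "homotopic_with (\<lambda>h. \<forall>x\<in>A. h x = x) X Y f g"
proof (subst homotopic_with)
  show "(\<forall>x\<in>A. h x = x) \<longleftrightarrow> (\<forall>x\<in>A. k x = x)" if "\<And>x. x \<in> topspace X \<Longrightarrow> h x = k x" for h k
    using that assms(4) by (metis subsetD)
  show "\<exists>h. continuous_map (prod_topology (top_of_set {0..1::real}) X) Y h \<and> (\<forall>x\<in>topspace X. h (0, x) = f x) \<and>
      (\<forall>x\<in>topspace X. h (1, x) = g x) \<and> (\<forall>t\<in>{0..1}. \<forall>x\<in>A. h (t, x) = x)"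
    using assms by blast
qed

lemma def_retract_closure:
  assumes "order_on_set Q' lq" "Q \<subseteq> Q'"
    and r: "\<And>x. x \<in> Q' \<Longrightarrow> r x \<in> Q \<and> lq x (r x)" "\<And>x. x \<in> Q \<Longrightarrow> r x = x"
    and mono: "\<And>x y. x \<in> Q' \<Longrightarrow> y \<in> Q' \<Longrightarrow> lq x y \<Longrightarrow> lq (r x) (r y)"
  shows "def_retract lq Q' Q"
proof -
  interpret order_on_set Q' lq by fact
  interpret q: order_on_set Q lq using order_subset assms(2) .
  \<comment> \<open>With the support of the point in place of a simplex, one formula serves the
    whole realization; \<open>shift_supp\<close> compares it with the formula on each
    simplex.\<close>
  let ?h = "\<lambda>(u, t). shift lq (supp t) r u t"
  have eq: "?h (u, t) = shift lq \<sigma> r u t" if "is_chain_in Q' lq \<sigma>" "t \<in> closed_simplex \<sigma>" for u t \<sigma>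
    using shift_supp[OF that(2)] that(1) by (simp add: is_chain_in_def)
  have inQ: "?h (u, t) \<in> realization_space Q' lq \<and> supp (?h (u, t)) \<subseteq> \<sigma> \<union> r ` \<sigma>"
    if s: "is_chain_in Q' lq \<sigma>" and t: "t \<in> closed_simplex \<sigma>" for u t \<sigma>
  proof -
    have "\<sigma> \<subseteq> Q'" using s by (simp add: is_chain_in_def)
    then show ?thesis unfolding eq[OF s t] using shift_realization[OF s t, of r u] r mono assms(2) by blast
  qed
  have cont: "continuous_on ({0..1} \<times> closed_simplex \<sigma>) ?h" if s: "is_chain_in Q' lq \<sigma>" for \<sigma>
  proof -
    have "continuous_on ({0..1} \<times> closed_simplex \<sigma>) (\<lambda>z. shift lq \<sigma> r (fst z) (snd z))"
      by (rule shift_continuous) (use s in \<open>auto simp: is_chain_in_def intro: continuous_intros\<close>)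
    then show ?thesis by (rule continuous_on_eq) (use eq[OF s] in auto)
  qed
  have hc: "continuous_map (prod_topology (top_of_set {0..1}) (geometric_realization Q' lq)) (geometric_realization Q' lq) ?h"
  proof (rule homotopy_from_prisms[OF cont])
    fix \<sigma> assume s: "is_chain_in Q' lq \<sigma>"
    show "\<exists>F. finite F \<and> (\<forall>u\<in>{0..1}. \<forall>t\<in>closed_simplex \<sigma>. ?h (u, t) \<in> realization_space Q' lq \<and> supp (?h (u, t)) \<subseteq> F)"
      using inQ[OF s] s by (intro exI[of _ "\<sigma> \<union> r ` \<sigma>"]) (simp add: is_chain_in_def)
  qed
  have one: "?h (1, t) \<in> realization_space Q lq \<and> supp (?h (1, t)) \<subseteq> r ` \<sigma>"
    if s: "is_chain_in Q' lq \<sigma>" and t: "t \<in> closed_simplex \<sigma>" for t \<sigma>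
  proof -
    have sub: "supp (?h (1, t)) \<subseteq> r ` \<sigma>"
    proof
      fix w assume w: "w \<in> supp (?h (1, t))"
      show "w \<in> r ` \<sigma>"
      proof (rule ccontr)
        assume "w \<notin> r ` \<sigma>"
        then have "{v \<in> \<sigma>. r v = w} = {}" by auto
        then have "shift lq \<sigma> r 1 t w = 0" unfolding shift_1[OF s t] by (simp only: sum.empty)
        then show False using w unfolding eq[OF s t] by (simp add: supp_def)
      qed
    qed
    have "\<sigma> \<subseteq> Q'" using s by (simp add: is_chain_in_def)
    then have "supp (?h (1, t)) \<subseteq> Q" using sub r(1) by blast
    then show ?thesis using sub inQ[OF s t, of 1] unfolding realization_iff is_chain_in_def by blast
  qed
  have rc: "continuous_map (geometric_realization Q' lq) (geometric_realization Q lq) (\<lambda>t. ?h (1, t))"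
  proof (rule continuous_map_from_simplices)
    fix \<sigma> assume s: "is_chain_in Q' lq \<sigma>"
    show "continuous_on (closed_simplex \<sigma>) (\<lambda>t. ?h (1, t))"
      by (rule continuous_on_compose2[OF cont[OF s], of _ "\<lambda>t. (1, t)"]) (auto intro: continuous_intros)
    show "\<exists>F. finite F \<and> (\<forall>t\<in>closed_simplex \<sigma>. ?h (1, t) \<in> realization_space Q lq \<and> supp (?h (1, t)) \<subseteq> F)"
      using one[OF s] s by (intro exI[of _ "r ` \<sigma>"]) (simp add: is_chain_in_def)
  qed
  have "homotopic_with (\<lambda>h. \<forall>x\<in>realization_space Q lq. h x = x)
       (geometric_realization Q' lq) (geometric_realization Q' lq) id (\<lambda>t. ?h (1, t))"
  proof (rule homotopic_relI[OF hc])
    show "?h (0, x) = id x" if "x \<in> topspace (geometric_realization Q' lq)" for x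
      using that shift_0[of x] by (auto simp: realization_iff)
    show "?h (u, x) = x" if "x \<in> realization_space Q lq" for u x
    proof -
      have x: "is_chain_in Q lq (supp x)" "x \<in> closed_simplex (supp x)" using that by (auto simp: realization_iff)
      then have "\<And>v. v \<in> supp x \<Longrightarrow> r v = v" using r(2) by (auto simp: is_chain_in_def)
      then show ?thesis using shift_fixed[OF x(2), of r lq u] x(1) by (simp add: is_chain_in_def)
    qed
  qed (use realization_mono[OF assms(2)] in auto)
  then show ?thesis using rc unfolding def_retract_def by blast
qed

section \<open>Attaching maximal elements with contractible lower links\<close>

text \<open>In \<open>cone_stage\<close> a chain contains at most one element of \<open>M\<close>,
  so the homotopies \<open>H m\<close> of the different cones combine; points without mass on
  \<open>M\<close> stay fixed.\<close>

definition glob :: "'v set \<Rightarrow> ('v \<Rightarrow> real \<times> ('v \<Rightarrow> real) \<Rightarrow> 'v \<Rightarrow> real) \<Rightarrow> real \<times> ('v \<Rightarrow> real) \<Rightarrow> 'v \<Rightarrow> real" where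
  "glob M H = (\<lambda>(u, t). if \<exists>m\<in>M. t m \<noteq> 0 then H (SOME m. m \<in> M \<and> t m \<noteq> 0) (u, t) else t)"

lemma glob_off: "t \<in> realization_space Q lq \<Longrightarrow> Q \<inter> M = {} \<Longrightarrow> glob M H (u, t) = t"
  by (auto simp: glob_def realization_iff is_chain_in_def supp_def)

lemma convex_simplex:
  assumes "x \<in> closed_simplex Z" "y \<in> closed_simplex Z" "0 \<le> c" "c \<le> 1"
  shows "(\<lambda>v. (1 - c) * x v + c * y v) \<in> closed_simplex Z"
  using assms by (auto simp: closed_simplex_def sum.distrib sum_distrib_left[symmetric])

text \<open>Attaching \<open>m\<close> puts a cone over its lower link in \<open>Q\<close>. The
  relations \<open>lq b (\<pi> m b)\<close> and \<open>lq (a m) (\<pi> m b)\<close> contract that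
  link: push every \<open>b\<close> up to \<open>\<pi> m b\<close>, then slide down to
  \<open>a m\<close>.\<close>

locale cone_stage = order_on_set "Q \<union> M" lq for Q M :: "'v set" and lq +
  fixes \<pi> :: "'v \<Rightarrow> 'v \<Rightarrow> 'v" and a :: "'v \<Rightarrow> 'v"
  assumes disj: "Q \<inter> M = {}"
    and top: "m \<in> M \<Longrightarrow> x \<in> Q \<union> M \<Longrightarrow> lq m x \<Longrightarrow> x = m"
    and pi: "m \<in> M \<Longrightarrow> b \<in> Q \<Longrightarrow> lq b m \<Longrightarrow> \<pi> m b \<in> Q \<and> lq (\<pi> m b) m \<and> lq b (\<pi> m b) \<and> lq (a m) (\<pi> m b)"
    and pi_mono: "m \<in> M \<Longrightarrow> b \<in> Q \<Longrightarrow> c \<in> Q \<Longrightarrow> lq b c \<Longrightarrow> lq c m \<Longrightarrow> lq (\<pi> m b) (\<pi> m c)"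
    and a: "m \<in> M \<Longrightarrow> a m \<in> Q \<and> lq (a m) m"
begin

abbreviation "G' \<equiv> geometric_realization (Q \<union> M) lq"

lemma chain_below:
  assumes "is_chain_in (Q \<union> M) lq \<sigma>" "m \<in> \<sigma>" "m \<in> M" "b \<in> \<sigma>" "b \<noteq> m"
  shows "b \<in> Q" "lq b m"
proof -
  have s: "lq b m \<or> lq m b" "b \<in> Q \<union> M" "m \<in> Q \<union> M" using assms by (auto simp: is_chain_in_def)
  then show l: "lq b m" using top[OF assms(3) s(2)] assms(5) by blast
  then show "b \<in> Q" using top[of b m] s assms by blast
qed

lemma glob_eq:
  assumes s: "is_chain_in (Q \<union> M) lq \<sigma>" "m \<in> \<sigma>" "m \<in> M" and t: "t \<in> closed_simplex \<sigma>"
    and st: "t m = 0 \<Longrightarrow> H m (u, t) = t"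
  shows "glob M H (u, t) = H m (u, t)"
proof -
  have other: "t m' = 0" if "m' \<in> M" "m' \<noteq> m" for m'
    using that chain_below(1)[OF s, of m'] disj t by (auto simp: closed_simplex_def)
  show ?thesis
  proof (cases "t m = 0")
    case True
    then have "\<not> (\<exists>m\<in>M. t m \<noteq> 0)" using other by metis
    then show ?thesis using st True by (simp add: glob_def)
  next
    case False
    then have "(SOME m. m \<in> M \<and> t m \<noteq> 0) = m" using other s(3) by (intro some_equality) blast+
    then show ?thesis using False s(3) by (auto simp: glob_def)
  qed
qed

lemma glob_continuous:
  assumes T: "Q \<subseteq> T"
    and H: "\<And>\<sigma> m. is_chain_in (Q \<union> M) lq \<sigma> \<Longrightarrow> m \<in> \<sigma> \<Longrightarrow> m \<in> M \<Longrightarrow>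
       continuous_on ({0..1} \<times> closed_simplex \<sigma>) (H m) \<and> (\<exists>F. finite F \<and> (\<forall>u\<in>{0..1}. \<forall>t\<in>closed_simplex \<sigma>.
          H m (u, t) \<in> realization_space T lq \<and> supp (H m (u, t)) \<subseteq> F)) \<and>
       (\<forall>u\<in>{0..1}. \<forall>t\<in>closed_simplex \<sigma>. t m = 0 \<longrightarrow> H m (u, t) = t)"
  shows "continuous_map (prod_topology (top_of_set {0..1}) G') (geometric_realization T lq) (glob M H)"
proof -
  have eqH: "\<forall>u\<in>{0..1}. \<forall>t\<in>closed_simplex \<sigma>. glob M H (u, t) = H m (u, t)"
    if "is_chain_in (Q \<union> M) lq \<sigma>" "m \<in> \<sigma>" "m \<in> M" for \<sigma> m
    using glob_eq[OF that] H[OF that] by blast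
  have eqQ: "\<forall>u\<in>{0..1}. \<forall>t\<in>closed_simplex \<sigma>. glob M H (u, t) = t \<and> t \<in> realization_space T lq"
    if s: "is_chain_in (Q \<union> M) lq \<sigma>" "\<sigma> \<inter> M = {}" for \<sigma>
  proof -
    have c: "is_chain_in Q lq \<sigma>" using s by (auto simp: is_chain_in_def)
    show ?thesis using simplex_in_realization[OF c] glob_off[OF _ disj] realization_mono[OF T, of lq] by blast
  qed
  show ?thesis
  proof (rule homotopy_from_prisms)
    fix \<sigma> assume s: "is_chain_in (Q \<union> M) lq \<sigma>"
    show "continuous_on ({0..1} \<times> closed_simplex \<sigma>) (glob M H)"
    proof (cases "\<sigma> \<inter> M = {}")
      case True
      have "continuous_on ({0..1::real} \<times> closed_simplex \<sigma>) snd" by (intro continuous_intros)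
      then show ?thesis by (rule continuous_on_eq) (use eqQ[OF s True] in auto)
    next
      case False
      then obtain m where m: "m \<in> \<sigma>" "m \<in> M" by auto
      have "continuous_on ({0..1} \<times> closed_simplex \<sigma>) (H m)" using H[OF s m] by blast
      then show ?thesis by (rule continuous_on_eq) (use eqH[OF s m] in auto)
    qed
    show "\<exists>F. finite F \<and> (\<forall>u\<in>{0..1}. \<forall>t\<in>closed_simplex \<sigma>. glob M H (u, t) \<in> realization_space T lq \<and> supp (glob M H (u, t)) \<subseteq> F)"
    proof (cases "\<sigma> \<inter> M = {}")
      case True
      have f: "finite \<sigma>" using s by (simp add: is_chain_in_def)
      show ?thesis by (rule exI[of _ \<sigma>]) (use f eqQ[OF s True] simplex_supp(1)[OF _ f] in simp)
    next
      case False
      then obtain m where m: "m \<in> \<sigma>" "m \<in> M" by auto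
      obtain F where "finite F" "\<forall>u\<in>{0..1}. \<forall>t\<in>closed_simplex \<sigma>. H m (u, t) \<in> realization_space T lq \<and> supp (H m (u, t)) \<subseteq> F"
        using H[OF s m] by blast
      then show ?thesis using eqH[OF s m] by (intro exI[of _ F]) simp
    qed
  qed
qed

text \<open>The parameter \<open>s\<close> is the mass at \<open>m\<close>. The push along
  \<open>pm\<close> is complete from mass \<open>1/3\<close> on; only there the slide to
  \<open>a m\<close> begins, which is complete from \<open>2/3\<close> on. At mass \<open>0\<close>
  nothing moves, so the homotopies match the identity on \<open>Q\<close>.\<close>

definition "\<tau>1 s = min 1 (3 * s)" for s :: real
definition "\<tau>2 s = max 0 (min 1 (3 * s - 1))" for s :: real
text \<open>Up to the factor \<open>1 - \<tau>2 s\<close> this rescales the mass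
  \<open>1 - s\<close> outside \<open>m\<close>. The maximum avoids division by zero at
  \<open>s = 1\<close>; it takes effect only for \<open>s > 2/3\<close>, where the numerator
  vanishes.\<close>

definition "\<kappa> s = (1 - \<tau>2 s) / max (1 - s) (1/3)" for s :: real
definition "pm m v = (if v = m then m else \<pi> m v)" for m v
definition "dl x v = (if v = x then 1 else 0 :: real)" for x v :: 'v
definition "HA m = (\<lambda>(u, t). shift lq (supp t) (pm m) (u * \<tau>1 (t m)) t)" for m
definition "F1 m t = HA m (1, t)" for m t
definition "HB m = (\<lambda>(u, t) v. (1 - u * \<tau>2 (t m)) * F1 m t v + u * \<tau>2 (t m) * (t m * dl m v + (1 - t m) * dl (a m) v))" for m
definition "F2 m t = HB m (1, t)" for m t
text \<open>The point \<open>F2 m t\<close> projected from the vertex \<open>m\<close> to the lower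
  link: the mass at \<open>m\<close> is removed and the rest rescaled to total mass
  \<open>1\<close>. Written with \<open>\<kappa>\<close>, it is continuous also where all mass sits
  at \<open>m\<close>.\<close>

definition "F3 m t = (\<lambda>v. \<kappa> (t m) * (F1 m t v - t m * dl m v) + \<tau>2 (t m) * dl (a m) v)" for m t
definition "HC m = (\<lambda>(u, t) v. (1 - u) * F2 m t v + u * F3 m t v)" for m

lemma tau_bounds: "0 \<le> \<tau>2 s" "\<tau>2 s \<le> 1" "\<tau>1 s \<le> 1" "0 \<le> s \<Longrightarrow> 0 \<le> \<tau>1 s" "\<tau>2 s > 0 \<Longrightarrow> \<tau>1 s = 1"
  "s \<le> 1 \<Longrightarrow> \<kappa> s * (1 - s) + \<tau>2 s = 1" "0 \<le> \<kappa> s" "\<tau>1 0 = 0" "\<tau>2 0 = 0" "\<kappa> 0 = 1" "\<kappa> 1 = 0" "\<tau>2 1 = 1"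
  by (auto simp: \<tau>1_def \<tau>2_def \<kappa>_def max_def min_def field_simps split: if_splits)

lemma cont_tau: "continuous_on S f \<Longrightarrow> continuous_on S (\<lambda>z. \<tau>1 (f z))"
  "continuous_on S f \<Longrightarrow> continuous_on S (\<lambda>z. \<tau>2 (f z))" "continuous_on S f \<Longrightarrow> continuous_on S (\<lambda>z. \<kappa> (f z))"
  unfolding \<tau>1_def \<tau>2_def \<kappa>_def by (intro continuous_intros; simp add: max_def)+

context
  fixes \<sigma> m assumes s: "is_chain_in (Q \<union> M) lq \<sigma>" and m: "m \<in> \<sigma>" "m \<in> M"
begin

lemma fin_s: "finite \<sigma>" using s by (simp add: is_chain_in_def)

lemma coord_cont: "continuous_on S (\<lambda>z. snd z v)" for S :: "(real \<times> ('v \<Rightarrow> real)) set"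
  by (rule continuous_on_product_then_coordinatewise) (intro continuous_intros)

lemma tm: "t \<in> closed_simplex \<sigma> \<Longrightarrow> 0 \<le> t m \<and> t m \<le> 1"
proof -
  assume t: "t \<in> closed_simplex \<sigma>"
  have "t m \<le> sum t \<sigma>" by (rule member_le_sum) (use t m fin_s in \<open>auto simp: closed_simplex_def\<close>)
  then show ?thesis using t by (auto simp: closed_simplex_def)
qed

lemma pm_props:
  "v \<in> \<sigma> \<Longrightarrow> pm m v \<in> Q \<union> M \<and> lq v (pm m v)"
  "v \<in> \<sigma> \<Longrightarrow> w \<in> \<sigma> \<Longrightarrow> lq v w \<Longrightarrow> lq (pm m v) (pm m w)"
proof -
  have below: "b \<in> Q \<and> lq b m" if "b \<in> \<sigma>" "b \<noteq> m" for b using chain_below[OF s m that] by simp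
  show "v \<in> \<sigma> \<Longrightarrow> pm m v \<in> Q \<union> M \<and> lq v (pm m v)"
    using below[of v] pi[OF m(2), of v] refl_lq[of m] m by (auto simp: pm_def)
  assume vw: "v \<in> \<sigma>" "w \<in> \<sigma>" "lq v w"
  have "w \<in> Q \<union> M" using s vw by (auto simp: is_chain_in_def)
  then show "lq (pm m v) (pm m w)"
    using below[of v] below[of w] pi[OF m(2), of v] pi_mono[OF m(2), of v w] refl_lq[of m] m vw top[OF m(2), of w]
    by (auto simp: pm_def)
qed

lemma HA_eq: "t \<in> closed_simplex \<sigma> \<Longrightarrow> HA m (u, t) = shift lq \<sigma> (pm m) (u * \<tau>1 (t m)) t"
  using shift_supp[OF _ fin_s] by (simp add: HA_def)

lemma HA_cont: "continuous_on ({0..1} \<times> closed_simplex \<sigma>) (HA m)"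
proof -
  have "continuous_on ({0..1} \<times> closed_simplex \<sigma>) (\<lambda>z. shift lq \<sigma> (pm m) (fst z * \<tau>1 (snd z m)) (snd z))"
    by (rule shift_continuous[OF fin_s]) (intro continuous_intros cont_tau coord_cont)+
  then show ?thesis by (rule continuous_on_eq) (use HA_eq in auto)
qed

lemma HA_real: "t \<in> closed_simplex \<sigma> \<Longrightarrow> HA m (u, t) \<in> realization_space (Q \<union> M) lq \<and> supp (HA m (u, t)) \<subseteq> \<sigma> \<union> pm m ` \<sigma>"
  using shift_realization[OF s, of t "pm m" "u * \<tau>1 (t m)"] pm_props by (simp add: HA_eq)

lemma HA_off: "t \<in> closed_simplex \<sigma> \<Longrightarrow> t m = 0 \<Longrightarrow> HA m (u, t) = t"
  using shift_0 by (simp add: HA_eq tau_bounds)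

text \<open>The vertices of the simplex in which the slide takes place: \<open>a m\<close> is below
  all \<open>\<pi> m b\<close>, and these are below \<open>m\<close>.\<close>

definition "Z = insert m (insert (a m) (\<pi> m ` (\<sigma> - {m})))"

lemma Z_chain: "is_chain_in (Q \<union> M) lq Z"
proof -
  have below: "b \<in> Q \<and> lq b m" if "b \<in> \<sigma>" "b \<noteq> m" for b using chain_below[OF s m that] by simp
  have tot: "lq x y \<or> lq y x" if "x \<in> \<sigma>" "y \<in> \<sigma>" for x y using s that by (auto simp: is_chain_in_def)
  have am: "a m \<in> Q" "lq (a m) m" "lq (a m) (a m)" "lq m m" using a[OF m(2)] refl_lq m by auto
  have pb: "\<pi> m b \<in> Q" "lq (\<pi> m b) m" "lq (a m) (\<pi> m b)" if "b \<in> \<sigma>" "b \<noteq> m" for b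
    using pi[OF m(2), of b] below[OF that] by auto
  have pp: "lq (\<pi> m b) (\<pi> m c) \<or> lq (\<pi> m c) (\<pi> m b)" if "b \<in> \<sigma>" "b \<noteq> m" "c \<in> \<sigma>" "c \<noteq> m" for b c
    using tot[of b c] pi_mono[OF m(2), of b c] pi_mono[OF m(2), of c b] below that by blast
  show ?thesis unfolding is_chain_in_def Z_def
    using fin_s am pb pp m by auto
qed

lemma Z_props: "finite Z" "m \<in> Z" "a m \<in> Z" "Z - {m} \<subseteq> Q" "a m \<noteq> m"
  using fin_s pi[OF m(2)] a[OF m(2)] chain_below[OF s m] m disj by (auto simp: Z_def)

lemma F1_m: "t \<in> closed_simplex \<sigma> \<Longrightarrow> F1 m t m = t m"
proof -
  assume t: "t \<in> closed_simplex \<sigma>"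
  have "\<pi> m v \<noteq> m" if "v \<in> \<sigma>" "v \<noteq> m" for v
    using pi[OF m(2), of v] chain_below[OF s m that] m disj by auto
  then have "{v \<in> \<sigma>. pm m v = m} = {m}" using m by (auto simp: pm_def)
  then show ?thesis by (simp add: F1_def HA_eq[OF t] shift_def)
qed

text \<open>A positive \<open>\<tau>2\<close> forces \<open>\<tau>1 = 1\<close>, so all mass has
  been pushed along \<open>pm\<close> before \<open>a m\<close> enters; the original vertices might
  be incomparable with \<open>a m\<close>.\<close>

lemma F1_Z: assumes t: "t \<in> closed_simplex \<sigma>" and p: "\<tau>2 (t m) > 0" shows "F1 m t \<in> closed_simplex Z"
proof -
  have e: "F1 m t w = (\<Sum>v\<in>{v\<in>\<sigma>. pm m v = w}. t v)" for w
    using shift_1[OF s t] by (simp add: F1_def HA_eq[OF t] tau_bounds(5)[OF p])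
  have sub: "supp (F1 m t) \<subseteq> Z"
  proof
    fix w assume w: "w \<in> supp (F1 m t)"
    show "w \<in> Z"
    proof (rule ccontr)
      assume n: "w \<notin> Z"
      have "{v\<in>\<sigma>. pm m v = w} = {}" using n by (auto simp: Z_def pm_def)
      then have "F1 m t w = 0" unfolding e by (simp only: sum.empty)
      then show False using w by (simp add: supp_def)
    qed
  qed
  have "F1 m t \<in> closed_simplex (supp (F1 m t))" using HA_real[OF t, of 1] by (auto simp: F1_def realization_iff)
  then show ?thesis using simplex_mono[OF sub Z_props(1)] by blast
qed

lemma vertex_Z: assumes t: "t \<in> closed_simplex \<sigma>"
  shows "(\<lambda>v. t m * dl m v + (1 - t m) * dl (a m) v) \<in> closed_simplex Z"
proof -
  have "(\<Sum>v\<in>Z. dl m v) = 1" "(\<Sum>v\<in>Z. dl (a m) v) = 1" using Z_props by (auto simp: dl_def)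
  then show ?thesis using tm[OF t] Z_props
    by (auto simp: closed_simplex_def sum.distrib sum_distrib_left[symmetric]) (auto simp: dl_def)
qed

lemma HB_Z: assumes t: "t \<in> closed_simplex \<sigma>" and p: "\<tau>2 (t m) > 0" and u: "u \<in> {0..1}"
  shows "HB m (u, t) \<in> closed_simplex Z"
proof -
  have "u * \<tau>2 (t m) \<le> 1" "0 \<le> u * \<tau>2 (t m)" using u tau_bounds(1,2)[of "t m"] by (auto intro: mult_le_one)
  then show ?thesis using convex_simplex[OF F1_Z[OF t p] vertex_Z[OF t], of "u * \<tau>2 (t m)"] by (simp add: HB_def)
qed

lemma HB_F1: "\<tau>2 (t m) = 0 \<Longrightarrow> HB m (u, t) = F1 m t"
  by (auto simp: HB_def)

lemma tau2_cases: "\<tau>2 (t m) > 0 \<or> \<tau>2 (t m) = 0" for t :: "'v \<Rightarrow> real"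
  using tau_bounds(1)[of "t m"] by linarith

lemma HB_real: assumes t: "t \<in> closed_simplex \<sigma>" and u: "u \<in> {0..1}"
  shows "HB m (u, t) \<in> realization_space (Q \<union> M) lq \<and> supp (HB m (u, t)) \<subseteq> Z \<union> \<sigma> \<union> pm m ` \<sigma>"
  using tau2_cases[of t]
proof
  assume "\<tau>2 (t m) > 0"
  from HB_Z[OF t this u] show ?thesis
    using simplex_in_realization[OF Z_chain] simplex_supp(1)[OF _ Z_props(1)] by blast
next
  assume "\<tau>2 (t m) = 0"
  then show ?thesis using HB_F1[of t u] HA_real[OF t, of 1] by (auto simp: F1_def)
qed

lemma F1_cont: "continuous_on ({0..1::real} \<times> closed_simplex \<sigma>) (\<lambda>z. F1 m (snd z) v)"
proof -
  have "continuous_on ({0..1::real} \<times> closed_simplex \<sigma>) (\<lambda>z. HA m (1, snd z))"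
    by (rule continuous_on_compose2[OF HA_cont]) (auto intro!: continuous_on_Pair continuous_on_const continuous_on_snd continuous_on_id)
  then show ?thesis unfolding F1_def by (rule continuous_on_product_then_coordinatewise)
qed

lemma HB_cont: "continuous_on ({0..1} \<times> closed_simplex \<sigma>) (HB m)"
  unfolding HB_def case_prod_unfold
  by (rule continuous_on_coordinatewise_then_product)
    (intro continuous_intros cont_tau coord_cont F1_cont)

lemma F2_cont: "continuous_on ({0..1::real} \<times> closed_simplex \<sigma>) (\<lambda>z. F2 m (snd z) v)"
proof -
  have "continuous_on ({0..1::real} \<times> closed_simplex \<sigma>) (\<lambda>z. HB m (1, snd z))"
    by (rule continuous_on_compose2[OF HB_cont]) (auto intro!: continuous_on_Pair continuous_on_const continuous_on_snd continuous_on_id)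
  then show ?thesis unfolding F2_def by (rule continuous_on_product_then_coordinatewise)
qed

lemma HC_cont: "continuous_on ({0..1} \<times> closed_simplex \<sigma>) (HC m)"
  unfolding HC_def case_prod_unfold F3_def
  by (rule continuous_on_coordinatewise_then_product)
    (intro continuous_intros cont_tau coord_cont F1_cont F2_cont)

lemma F3_simplex:
  assumes t: "t \<in> closed_simplex \<sigma>" and Y: "F1 m t \<in> closed_simplex Y" "finite Y" "m \<in> Y \<or> t m = 0"
    "\<tau>2 (t m) > 0 \<Longrightarrow> a m \<in> Y"
  shows "F3 m t \<in> closed_simplex Y" "F3 m t m = 0"
proof -
  have b: "0 \<le> t m" "t m \<le> 1" using tm[OF t] by auto
  have nn: "0 \<le> F1 m t v - t m * dl m v" for v
    using F1_m[OF t] Y(1) by (cases "v = m") (auto simp: dl_def closed_simplex_def)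
  have "(\<Sum>v\<in>Y. t m * dl m v) = t m" using Y by (auto simp: dl_def sum_distrib_left[symmetric])
  moreover have "(\<Sum>v\<in>Y. \<tau>2 (t m) * dl (a m) v) = \<tau>2 (t m)"
    using tau2_cases[of t] Y by (auto simp: dl_def sum_distrib_left[symmetric])
  moreover have "sum (F1 m t) Y = 1" using Y by (simp add: closed_simplex_def)
  moreover have "sum (F3 m t) Y = \<kappa> (t m) * (sum (F1 m t) Y - (\<Sum>v\<in>Y. t m * dl m v)) + (\<Sum>v\<in>Y. \<tau>2 (t m) * dl (a m) v)"
    by (simp only: F3_def sum.distrib sum_subtractf sum_distrib_left right_diff_distrib)
  ultimately have "sum (F3 m t) Y = \<kappa> (t m) * (1 - t m) + \<tau>2 (t m)" by (simp only:)
  then have 1: "sum (F3 m t) Y = 1" using tau_bounds(6) b by simp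
  have 2: "0 \<le> F3 m t v" for v
    unfolding F3_def using nn[of v] tau_bounds(1,7)[of "t m"] by (auto simp: dl_def)
  have 3: "F3 m t v = 0" if "v \<notin> Y" for v
    using that Y tau2_cases[of t] unfolding F3_def by (auto simp: dl_def closed_simplex_def)
  show "F3 m t \<in> closed_simplex Y" using 1 2 3 by (auto simp: closed_simplex_def)
  show "F3 m t m = 0" using F1_m[OF t] Z_props(5) by (simp add: F3_def dl_def)
qed

lemma HC_real: assumes t: "t \<in> closed_simplex \<sigma>" and u: "u \<in> {0..1}"
  shows "HC m (u, t) \<in> realization_space (Q \<union> M) lq \<and> supp (HC m (u, t)) \<subseteq> Z \<union> \<sigma> \<union> pm m ` \<sigma>"
    and "F3 m t \<in> realization_space Q lq"
proof -
  \<comment> \<open>Both ends of the segment must lie in one simplex: \<open>Z\<close> once the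
    slide has begun, the support of \<open>F1 m t\<close> before.\<close>
  obtain Y where Y: "is_chain_in (Q \<union> M) lq Y" "F1 m t \<in> closed_simplex Y" "F2 m t \<in> closed_simplex Y"
    "m \<in> Y \<or> t m = 0" "\<tau>2 (t m) > 0 \<Longrightarrow> a m \<in> Y" "Y \<subseteq> Z \<union> \<sigma> \<union> pm m ` \<sigma>"
  proof (cases "\<tau>2 (t m) > 0")
    case True
    then show ?thesis using that[of Z] Z_chain F1_Z[OF t True] HB_Z[OF t True, of 1] Z_props by (auto simp: F2_def)
  next
    case False
    then have "F2 m t = F1 m t" using HB_F1[of t 1] tau2_cases[of t] by (auto simp: F2_def)
    moreover have "F1 m t \<in> realization_space (Q \<union> M) lq" "supp (F1 m t) \<subseteq> \<sigma> \<union> pm m ` \<sigma>"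
      using HA_real[OF t, of 1] by (auto simp: F1_def)
    moreover have "m \<in> supp (F1 m t) \<or> t m = 0" using F1_m[OF t] by (auto simp: supp_def)
    ultimately show ?thesis using that[of "supp (F1 m t)"] False by (auto simp: realization_iff)
  qed
  have fY: "finite Y" using Y by (simp add: is_chain_in_def)
  have f3: "F3 m t \<in> closed_simplex Y" "F3 m t m = 0" using F3_simplex[OF t Y(2) fY Y(4,5)] by auto
  have "HC m (u, t) \<in> closed_simplex Y"
    using convex_simplex[OF Y(3) f3(1), of u] u by (simp add: HC_def)
  then show "HC m (u, t) \<in> realization_space (Q \<union> M) lq \<and> supp (HC m (u, t)) \<subseteq> Z \<union> \<sigma> \<union> pm m ` \<sigma>"
    using simplex_in_realization[OF Y(1)] simplex_supp(1)[OF _ fY] Y(6) by blast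
  have "F3 m t \<in> realization_space (Q \<union> M) lq" using simplex_in_realization[OF Y(1) f3(1)] .
  moreover have "supp (F3 m t) \<subseteq> Q"
  proof
    fix v assume v: "v \<in> supp (F3 m t)"
    then have "v \<noteq> m" using f3 by (auto simp: supp_def)
    have "v \<in> Z \<union> \<sigma> \<union> pm m ` \<sigma>" using v simplex_supp(1)[OF f3(1) fY] Y(6) by blast
    then show "v \<in> Q" using \<open>v \<noteq> m\<close> Z_props(4) chain_below(1)[OF s m] pi[OF m(2)] chain_below(2)[OF s m]
      by (auto simp: pm_def split: if_splits)
  qed
  ultimately show "F3 m t \<in> realization_space Q lq" by (auto simp: realization_iff is_chain_in_def)
qed

lemma off: assumes t: "t \<in> closed_simplex \<sigma>" "t m = 0"
  shows "HB m (u, t) = t" "HC m (u, t) = t" "F3 m t = t"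
proof -
  have f1: "F1 m t = t" using HA_off[OF t] by (simp add: F1_def)
  then show b: "HB m (u, t) = t" for u using t by (auto simp: HB_def tau_bounds)
  show c: "F3 m t = t" using f1 t by (auto simp: F3_def tau_bounds)
  show "HC m (u, t) = t" using b[of 1] c by (auto simp: HC_def F2_def algebra_simps)
qed

end

lemma def_retract_cone: "def_retract lq (Q \<union> M) Q"
proof -
  let ?R = "realization_space Q lq"
  have fin: "finite (Z \<sigma> m \<union> \<sigma> \<union> pm m ` \<sigma>)" if "is_chain_in (Q \<union> M) lq \<sigma>" "m \<in> \<sigma>" "m \<in> M" for \<sigma> m
    using fin_s[OF that] Z_props(1)[OF that] by simp
  have cA: "continuous_map (prod_topology (top_of_set {0..1}) G') G' (glob M HA)"
  proof (rule glob_continuous, goal_cases)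
    case (2 \<sigma> m)
    then show ?case using HA_cont HA_real HA_off fin[OF 2]
      by (intro conjI exI[of _ "Z \<sigma> m \<union> \<sigma> \<union> pm m ` \<sigma>"]) blast+
  qed simp
  have cB: "continuous_map (prod_topology (top_of_set {0..1}) G') G' (glob M HB)"
  proof (rule glob_continuous, goal_cases)
    case (2 \<sigma> m)
    then show ?case using HB_cont[OF 2] HB_real[OF 2] off(1)[OF 2] fin[OF 2]
      by (intro conjI exI[of _ "Z \<sigma> m \<union> \<sigma> \<union> pm m ` \<sigma>"]) blast+
  qed simp
  have cC: "continuous_map (prod_topology (top_of_set {0..1}) G') G' (glob M HC)"
  proof (rule glob_continuous, goal_cases)
    case (2 \<sigma> m)
    then show ?case using HC_cont[OF 2] HC_real(1)[OF 2] off(2)[OF 2] fin[OF 2]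
      by (intro conjI exI[of _ "Z \<sigma> m \<union> \<sigma> \<union> pm m ` \<sigma>"]) blast+
  qed simp
  have HC1: "HC m (1, t) = F3 m t" for m t by (auto simp: HC_def)
  \<comment> \<open>The final map is treated as a homotopy constant in \<open>u\<close>, so that
    \<open>glob_continuous\<close> gives its continuity into the smaller realization.\<close>
  have cF: "continuous_map (prod_topology (top_of_set {0..1}) G') (geometric_realization Q lq)
      (glob M (\<lambda>m (u, t). HC m (1, t)))"
  proof (rule glob_continuous, goal_cases)
    case (2 \<sigma> m)
    have "continuous_on ({0..1} \<times> closed_simplex \<sigma>) (\<lambda>(u::real, t). HC m (1, t))"
      unfolding case_prod_unfold
      by (rule continuous_on_compose2[OF HC_cont[OF 2]]) (auto intro!: continuous_on_Pair continuous_on_const continuous_on_snd continuous_on_id)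
    moreover have "supp (F3 m t) \<subseteq> Z \<sigma> m \<union> \<sigma> \<union> pm m ` \<sigma>" if "t \<in> closed_simplex \<sigma>" for t
      using HC_real(1)[OF 2 that, of 1] HC1 by simp
    ultimately show ?case using HC_real(2)[OF 2] off(3)[OF 2] fin[OF 2] unfolding HC1
      by (intro conjI exI[of _ "Z \<sigma> m \<union> \<sigma> \<union> pm m ` \<sigma>"]) auto
  qed simp
  define f1 where "f1 t = glob M HA (1, t)" for t
  define f2 where "f2 t = glob M HB (1, t)" for t
  define f3 where "f3 t = glob M HC (1, t)" for t
  have sub: "?R \<subseteq> topspace G'" using realization_mono[of Q "Q \<union> M" lq] by simp
  have offQ: "glob M H (u, x) = x" if "x \<in> ?R" for H u x using glob_off[OF that disj] .
  have "homotopic_with (\<lambda>h. \<forall>x\<in>?R. h x = x) G' G' id f1"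
  proof (rule homotopic_relI[OF cA _ _ sub])
    fix x assume "x \<in> topspace G'"
    then have x: "is_chain_in (Q \<union> M) lq (supp x)" "x \<in> closed_simplex (supp x)" by (auto simp: realization_iff)
    have "HA m (0, x) = x" for m using shift_0[OF x(2)] by (simp add: HA_def)
    then show "glob M HA (0, x) = id x" by (simp add: glob_def)
  qed (use offQ f1_def in auto)
  moreover have "homotopic_with (\<lambda>h. \<forall>x\<in>?R. h x = x) G' G' f1 f2"
  proof (rule homotopic_relI[OF cB _ _ sub])
    fix x
    have "HB m (0, x) = HA m (1, x)" for m by (auto simp: HB_def F1_def)
    then show "glob M HB (0, x) = f1 x" by (simp add: glob_def f1_def)
  qed (use offQ f2_def in auto)
  moreover have "homotopic_with (\<lambda>h. \<forall>x\<in>?R. h x = x) G' G' f2 f3"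
  proof (rule homotopic_relI[OF cC _ _ sub])
    fix x
    have "HC m (0, x) = HB m (1, x)" for m by (auto simp: HC_def F2_def)
    then show "glob M HC (0, x) = f2 x" by (simp add: glob_def f2_def)
  qed (use offQ f3_def in auto)
  ultimately have "homotopic_with (\<lambda>h. \<forall>x\<in>?R. h x = x) G' G' id f3"
    using homotopic_with_trans by blast
  moreover have "continuous_map G' (geometric_realization Q lq) f3"
  proof -
    have p: "continuous_map G' (prod_topology (top_of_set {0..1::real}) G') (\<lambda>x. (1, x))"
      by (auto simp: continuous_map_paired continuous_map_id[unfolded id_def])
    have e: "glob M (\<lambda>m (u, t). HC m (1, t)) (1, t) = f3 t" for t by (simp add: glob_def f3_def)
    show ?thesis using continuous_map_compose[OF p cF] by (simp add: o_def e)
  qed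
  ultimately show ?thesis unfolding def_retract_def by blast
qed

end

text \<open>Each level is attached in two steps: the elements fixed by \<open>pl\<close> are coned
  off over contractible lower links, and the rest of the level retracts upwards onto them along
  \<open>pl\<close>.\<close>

theorem contractible_by_levels:
  fixes lev :: "'v \<Rightarrow> nat"
  assumes ord: "order_on_set P lq"
    and lev: "\<And>x y. x \<in> P \<Longrightarrow> y \<in> P \<Longrightarrow> lq x y \<Longrightarrow> lev x \<le> lev y"
    and pl: "\<And>x. x \<in> P \<Longrightarrow> pl x \<in> P \<and> lq x (pl x) \<and> lev (pl x) = lev x"
    and pl_eq: "\<And>x y. x \<in> P \<Longrightarrow> y \<in> P \<Longrightarrow> lq x y \<Longrightarrow> lev x = lev y \<Longrightarrow> pl x = pl y"
    and m0: "m0 \<in> P" "pl m0 = m0" "\<And>x. x \<in> P \<Longrightarrow> lq x m0 \<Longrightarrow> x = m0"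
    and red: "\<And>m. m \<in> P \<Longrightarrow> pl m = m \<Longrightarrow> m \<noteq> m0 \<Longrightarrow> \<exists>\<pi> a. (a \<in> P \<and> lq a m \<and> lev a < lev m) \<and>
        (\<forall>b\<in>P. lq b m \<and> lev b < lev m \<longrightarrow> \<pi> b \<in> P \<and> lq (\<pi> b) m \<and> lev (\<pi> b) < lev m \<and> lq b (\<pi> b) \<and> lq a (\<pi> b)) \<and>
        (\<forall>b\<in>P. \<forall>c\<in>P. lq b c \<and> lq c m \<and> lev c < lev m \<longrightarrow> lq (\<pi> b) (\<pi> c))"
  shows "contractible_space (geometric_realization P lq)"
proof -
  interpret order_on_set P lq by fact
  \<comment> \<open>The minimal element \<open>m0\<close> is present from the beginning whatever its
    level, so that the filtration starts at a single point.\<close>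
  define Q where "Q N = {x\<in>P. lev x < N} \<union> {m0}" for N
  define M where "M N = {m\<in>P. lev m = N \<and> pl m = m \<and> m \<noteq> m0}" for N
  define Y where "Y i = (if even i then Q (i div 2) else Q (i div 2) \<union> M (i div 2))" for i
  have QP: "Q N \<subseteq> P" "M N \<subseteq> P" for N using m0 by (auto simp: Q_def M_def)
  define Rd where "Rd m \<pi> a \<longleftrightarrow> (a \<in> P \<and> lq a m \<and> lev a < lev m) \<and>
        (\<forall>b\<in>P. lq b m \<and> lev b < lev m \<longrightarrow> \<pi> b \<in> P \<and> lq (\<pi> b) m \<and> lev (\<pi> b) < lev m \<and> lq b (\<pi> b) \<and> lq a (\<pi> b)) \<and>
        (\<forall>b\<in>P. \<forall>c\<in>P. lq b c \<and> lq c m \<and> lev c < lev m \<longrightarrow> lq (\<pi> b) (\<pi> c))" for m \<pi> a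
  have "\<exists>\<pi> a. Rd m \<pi> a" if "m \<in> P" "pl m = m" "m \<noteq> m0" for m
    unfolding Rd_def using red[OF that] .
  then obtain \<pi> a where rd: "\<And>m. m \<in> P \<Longrightarrow> pl m = m \<Longrightarrow> m \<noteq> m0 \<Longrightarrow> Rd m (\<pi> m) (a m)" by metis
  note r = rd[unfolded Rd_def]
  have cone: "def_retract lq (Q N \<union> M N) (Q N)" for N
  proof -
    have low: "lev b < lev m \<and> b \<in> P" if "m \<in> M N" "b \<in> Q N" "lq b m" for b m
    proof -
      have m: "m \<in> P" "lev m = N" "pl m = m" "m \<noteq> m0" using that by (auto simp: M_def)
      show ?thesis
      proof (cases "b = m0")
        case True
        have "lev m0 \<le> lev m" using lev[OF m0(1) m(1)] that True by simp
        moreover have "lev m0 \<noteq> lev m" using pl_eq[OF m0(1) m(1)] that True m m0(2) by auto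
        ultimately show ?thesis using True m0 by simp
      qed (use that m in \<open>auto simp: Q_def\<close>)
    qed
    have inQ: "x \<in> Q N" if "x \<in> P" "lev x < lev m" "m \<in> M N" for x m using that by (auto simp: Q_def M_def)
    have MP: "m \<in> P \<and> pl m = m \<and> m \<noteq> m0" if "m \<in> M N" for m using that by (auto simp: M_def)
    interpret cone_stage "Q N" "M N" lq \<pi> a
    proof (intro cone_stage.intro cone_stage_axioms.intro)
      show "order_on_set (Q N \<union> M N) lq" using order_subset QP by simp
      show "Q N \<inter> M N = {}" by (auto simp: Q_def M_def)
      show "x = m" if h: "m \<in> M N" "x \<in> Q N \<union> M N" "lq m x" for m x
      proof -
        have m: "m \<in> P" "lev m = N" "pl m = m" "m \<noteq> m0" using h by (auto simp: M_def)
        have x: "x \<in> P" using h QP by auto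
        have "lev m \<le> lev x" using lev[OF m(1) x h(3)] .
        then have "x \<in> M N" using h m0(3)[OF m(1)] m by (auto simp: Q_def)
        then show ?thesis using pl_eq[OF m(1) x h(3)] m by (auto simp: M_def)
      qed
      show "\<pi> m b \<in> Q N \<and> lq (\<pi> m b) m \<and> lq b (\<pi> m b) \<and> lq (a m) (\<pi> m b)"
        if h: "m \<in> M N" "b \<in> Q N" "lq b m" for m b
        using r[of m] MP[OF h(1)] low[OF h] h inQ[of "\<pi> m b" m] by blast
      show "lq (\<pi> m b) (\<pi> m c)" if h: "m \<in> M N" "b \<in> Q N" "c \<in> Q N" "lq b c" "lq c m" for m b c
        using r[of m] MP[OF h(1)] low[OF h(1,3,5)] h QP by blast
      show "a m \<in> Q N \<and> lq (a m) m" if h: "m \<in> M N" for m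
        using r[of m] MP[OF h(1)] inQ[of "a m" m] h by blast
    qed
    show ?thesis by (rule def_retract_cone)
  qed
  have clos: "def_retract lq (Q (Suc N)) (Q N \<union> M N)" for N
  proof -
    define r' where "r' x = (if lev x = N \<and> x \<noteq> m0 then pl x else x)" for x
    have xP: "x \<in> P" if "x \<in> Q (Suc N)" for x using that QP by blast
    show ?thesis
    proof (rule def_retract_closure[of _ _ _ r'])
      show "order_on_set (Q (Suc N)) lq" using order_subset QP by simp
      show "Q N \<union> M N \<subseteq> Q (Suc N)" by (auto simp: Q_def M_def)
      show "r' x \<in> Q N \<union> M N \<and> lq x (r' x)" if "x \<in> Q (Suc N)" for x
      proof -
        have x: "x \<in> P" "lq x x" using xP[OF that] refl_lq by auto
        have "pl (pl x) = pl x" using pl_eq[of x "pl x"] pl[OF x(1)] x by simp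
        then show ?thesis using that x pl[OF x(1)] by (auto simp: r'_def Q_def M_def)
      qed
      show "r' x = x" if "x \<in> Q N \<union> M N" for x using that by (auto simp: r'_def Q_def M_def)
      show "lq (r' x) (r' y)" if h: "x \<in> Q (Suc N)" "y \<in> Q (Suc N)" "lq x y" for x y
      proof -
        have P: "x \<in> P" "y \<in> P" "pl y \<in> P" "lq y (pl y)" using xP h pl by auto
        have "lq x (pl y)" using trans_lq[OF P(1-3) h(3) P(4)] .
        moreover have "lq (pl y) (pl y)" using refl_lq P by simp
        moreover have "pl x = pl y" if "lev x = lev y" using pl_eq[OF P(1,2) h(3) that] .
        moreover have "lev x \<le> lev y" "y = m0 \<Longrightarrow> x = m0" using lev[OF P(1,2) h(3)] m0(3)[OF P(1)] h(3) by auto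
        moreover have "lev y \<le> N \<or> y = m0" using h by (auto simp: Q_def)
        ultimately show ?thesis using h(3) by (auto simp: r'_def)
      qed
    qed
  qed
  show ?thesis
  proof (rule contractible_filtration[of Y])
    show "Y i \<subseteq> Y (Suc i)" for i
    proof (cases "even i")
      case False
      then have "Suc i div 2 = Suc (i div 2)" by presburger
      moreover have "Q N \<union> M N \<subseteq> Q (Suc N)" for N by (auto simp: Q_def M_def)
      ultimately show ?thesis using False by (simp add: Y_def)
    qed (simp add: Y_def)
    show "P = (\<Union>i. Y i)"
    proof
      show "P \<subseteq> (\<Union>i. Y i)"
      proof
        fix x assume "x \<in> P"
        then have "x \<in> Y (2 * Suc (lev x))" by (simp add: Y_def Q_def)
        then show "x \<in> (\<Union>i. Y i)" by blast
      qed
      show "(\<Union>i. Y i) \<subseteq> P" using QP by (auto simp: Y_def split: if_splits)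
    qed
    show "Y 0 = {m0}" by (auto simp: Y_def Q_def)
    show "lq m0 m0" using refl_lq m0 by simp
    show "def_retract lq (Y (Suc i)) (Y i)" for i
    proof (cases "even i")
      case True
      then show ?thesis using cone[of "i div 2"] by (simp add: Y_def)
    next
      case False
      then have "Suc i div 2 = Suc (i div 2)" by presburger
      then show ?thesis using False clos[of "i div 2"] by (simp add: Y_def)
    qed
  qed
qed

section \<open>The filtration of the complex\<close>

context mm_setting
begin

section \<open>Classes, their order and their level\<close>

definition cls :: "(nat \<Rightarrow> 'a set) \<Rightarrow> nat set set \<Rightarrow> ((nat \<Rightarrow> 'a set) \<times> nat set set) set" where
  "cls H E = idt `` {(H, E)}"

abbreviation "LP \<equiv> L_elems G Gs n"
abbreviation "lqL \<equiv> L_le n :: ((nat \<Rightarrow> 'a set) \<times> nat set set) set \<Rightarrow> _"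

lemma idt_refl: "(x, x) \<in> idt" by (simp add: ident_def)
lemma idt_trans: "(x, y) \<in> idt \<Longrightarrow> (y, z) \<in> idt \<Longrightarrow> (x, z) \<in> idt" unfolding ident_def by (rule rtrancl_trans)
lemma idt_sym: "(x, y) \<in> idt \<Longrightarrow> (y, x) \<in> idt"
proof -
  have "sym (ident_step G Gs n \<union> (ident_step G Gs n)\<inverse>)" by (simp add: sym_Un_converse)
  then have "sym idt" unfolding ident_def by (rule sym_rtrancl)
  then show "(x, y) \<in> idt \<Longrightarrow> (y, x) \<in> idt" by (rule symD)
qed

lemma LP_iff: "c \<in> LP \<longleftrightarrow> (\<exists>H E. basis H \<and> pl_tree n E \<and> c = cls H E)"
  unfolding L_elems_def quotient_def cls_def valid_pairs_def by auto

lemma cls_LP: "basis H \<Longrightarrow> pl_tree n E \<Longrightarrow> cls H E \<in> LP"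
  using LP_iff by blast

lemma cls_mem: "(H, E) \<in> cls H E" by (simp add: cls_def idt_refl)

lemma cls_eqI: "((H, E), (H', E')) \<in> idt \<Longrightarrow> cls H E = cls H' E'"
  unfolding cls_def using idt_trans idt_sym by blast

lemma LP_mem:
  assumes "c \<in> LP" "(H, E) \<in> c"
  shows "basis H" "pl_tree n E" "c = cls H E"
proof -
  obtain H0 E0 where h: "basis H0" "pl_tree n E0" "c = cls H0 E0" using assms LP_iff by blast
  then have i: "((H0, E0), (H, E)) \<in> idt" using assms(2) by (simp add: cls_def)
  show "basis H" "pl_tree n E" using ident_local[OF i h(1,2)] h by auto
  show "c = cls H E" using cls_eqI[OF i] h(3) by simp
qed

lemma LP_mem2:
  assumes "c \<in> LP" "(H, E) \<in> c" "(H', E') \<in> c"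
  shows "E' = E" "loc (psep n E) H H'" "((H, E), (H', E)) \<in> idt"
proof -
  note m = LP_mem[OF assms(1,2)]
  have i: "((H, E), (H', E')) \<in> idt" using assms(3) m(3) by (simp add: cls_def)
  show e: "E' = E" and "loc (psep n E) H H'" using ident_local[OF i m(1,2)] by auto
  show "((H, E), (H', E)) \<in> idt" using i e by simp
qed

lemma cls_finer:
  assumes c: "c \<in> LP" "(H, E) \<in> c" "(H', E) \<in> c" and E2: "pl_tree n E2" "sep_refine n (psep n E) (psep n E2)"
  shows "cls H E2 = cls H' E2"
  using cls_eqI[OF ident_mono[OF LP_mem2(3)[OF c] LP_mem(1,2)[OF c(1,2)] E2]] .

lemma sep_refine_refl: "sep_family n R \<Longrightarrow> sep_refine n R R"
  by (simp add: sep_refine_def sep_refine_axioms_def)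

lemma sep_refine_trans: "sep_refine n R S \<Longrightarrow> sep_refine n S T \<Longrightarrow> sep_refine n R T"
  by (simp add: sep_refine_def sep_refine_axioms_def)

lemma L_le_I:
  assumes "basis H" "pl_tree n A" "pl_tree n B" "sep_refine n (psep n A) (psep n B)"
  shows "lqL (cls H A) (cls H B)"
  unfolding L_le_def using cls_mem tree_le_iff[OF assms(2,3)] assms(4) by blast

text \<open>The order provides some common basis; by \<open>ident_mono\<close> it may be replaced by
  any basis representing the lower class.\<close>

lemma L_le_rep:
  assumes c: "c \<in> LP" "d \<in> LP" and le: "lqL c d" and m: "(H, A) \<in> c"
  obtains B where "(H, B) \<in> d" "pl_tree n B" "sep_refine n (psep n A) (psep n B)"
proof -
  obtain H0 A0 B where h: "(H0, A0) \<in> c" "(H0, B) \<in> d" "tree_le n A0 B" using le unfolding L_le_def by blast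
  have A0: "A0 = A" using LP_mem2(1)[OF c(1) m h(1)] .
  have B: "pl_tree n B" "d = cls H0 B" using LP_mem[OF c(2) h(2)] by auto
  have A: "pl_tree n A" using LP_mem[OF c(1) m] by simp
  have r: "sep_refine n (psep n A) (psep n B)" using h(3) tree_le_iff[OF A B(1)] A0 by simp
  have "cls H0 B = cls H B" using cls_finer[OF c(1) _ m B(1) r] h(1) A0 by simp
  then have "(H, B) \<in> d" using B(2) cls_mem by simp
  then show ?thesis using that B(1) r by blast
qed

lemma L_order: "order_on_set LP lqL"
proof
  fix c assume c: "c \<in> LP"
  then obtain H E where h: "basis H" "pl_tree n E" "c = cls H E" using LP_iff by blast
  then show "lqL c c" using L_le_I sep_refine_refl[OF pl_tree_sep_family] by blast
next
  fix c d assume c: "c \<in> LP" "d \<in> LP" and le: "lqL c d" "lqL d c"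
  obtain H A where h: "basis H" "pl_tree n A" "c = cls H A" using c LP_iff by blast
  have m: "(H, A) \<in> c" using h cls_mem by simp
  obtain B where B: "(H, B) \<in> d" "pl_tree n B" "sep_refine n (psep n A) (psep n B)" using L_le_rep[OF c le(1) m] .
  obtain A' where A': "(H, A') \<in> c" "sep_refine n (psep n B) (psep n A')" using L_le_rep[OF c(2,1) le(2) B(1)] .
  have "A' = A" using LP_mem2(1)[OF c(1) m A'(1)] .
  then have "psep n A = psep n B" using B(3) A'(2) unfolding sep_refine_def sep_refine_axioms_def by blast
  then have "A = B" using pl_tree_eqI[OF h(2) B(2)] by simp
  then show "c = d" using LP_mem(3)[OF c(2) B(1)] h by simp
next
  fix c d e assume c: "c \<in> LP" "d \<in> LP" "e \<in> LP" and le: "lqL c d" "lqL d e"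
  obtain H A where h: "basis H" "pl_tree n A" "c = cls H A" using c LP_iff by blast
  have m: "(H, A) \<in> c" using h cls_mem by simp
  obtain B where B: "(H, B) \<in> d" "pl_tree n B" "sep_refine n (psep n A) (psep n B)" using L_le_rep[OF c(1,2) le(1) m] .
  obtain D where D: "(H, D) \<in> e" "pl_tree n D" "sep_refine n (psep n B) (psep n D)" using L_le_rep[OF c(2,3) le(2) B(1)] .
  show "lqL c e" using L_le_I[OF h(1,2) D(2) sep_refine_trans[OF B(3) D(3)]] h(3) LP_mem(3)[OF c(3) D(1)] by simp
qed

text \<open>An arbitrary choice; \<open>lev_eq\<close> and \<open>plc_eq\<close> show that level and
  maximal class do not depend on it.\<close>

definition rep :: "((nat \<Rightarrow> 'a set) \<times> nat set set) set \<Rightarrow> (nat \<Rightarrow> 'a set) \<times> nat set set" where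
  "rep c = (SOME p. p \<in> c)"

definition lev :: "((nat \<Rightarrow> 'a set) \<times> nat set set) set \<Rightarrow> nat" where
  "lev c = Lam (fst (rep c)) (psep n (snd (rep c)))"

definition plc :: "((nat \<Rightarrow> 'a set) \<times> nat set set) set \<Rightarrow> ((nat \<Rightarrow> 'a set) \<times> nat set set) set" where
  "plc c = cls (fst (rep c)) (hyperedges n (Mrel (fst (rep c)) (psep n (snd (rep c)))))"

lemma rep: assumes "c \<in> LP" shows "(fst (rep c), snd (rep c)) \<in> c"
proof -
  obtain H E where "c = cls H E" using assms LP_iff by blast
  then have "(H, E) \<in> c" using cls_mem by simp
  then show ?thesis unfolding rep_def prod.collapse by (rule someI)
qed

lemma lev_eq: assumes c: "c \<in> LP" "(H, E) \<in> c" shows "lev c = Lam H (psep n E)"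
proof -
  note r = rep[OF c(1)]
  have e: "snd (rep c) = E" "loc (psep n E) H (fst (rep c))" using LP_mem2(1,2)[OF c r] by auto
  have "Lam H (psep n E) = Lam (fst (rep c)) (psep n E)"
    using Lam_loc[OF basis_conj_sys basis_conj_sys pl_tree_sep_family e(2)] LP_mem(1,2)[OF c] LP_mem(1)[OF c(1) r] by simp
  then show ?thesis by (simp add: lev_def e)
qed

lemma tree_of: "sep_family n R \<Longrightarrow> pl_tree n (hyperedges n R)" "sep_family n R \<Longrightarrow> psep n (hyperedges n R) = R"
  using sep_family.pl_tree_of_sep[OF _ n1] by auto

lemma plc_eq: assumes c: "c \<in> LP" "(H, E) \<in> c" shows "plc c = cls H (hyperedges n (Mrel H (psep n E)))"
proof -
  note r = rep[OF c(1)]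
  note v = LP_mem[OF c]
  have e: "snd (rep c) = E" using LP_mem2(1)[OF c r] .
  have r': "(fst (rep c), E) \<in> c" using r e by simp
  have l: "loc (psep n E) H (fst (rep c))" using LP_mem2(2)[OF c r] .
  have cs: "conj_sys H" using basis_conj_sys v by simp
  have sf: "sep_family n (psep n E)" using pl_tree_sep_family v by simp
  have M: "Mrel (fst (rep c)) (psep n E) = Mrel H (psep n E)" using Mrel_loc[OF cs sf l] .
  note t = tree_of[OF Mrel_sep[OF cs sf]]
  have "cls (fst (rep c)) (hyperedges n (Mrel H (psep n E))) = cls H (hyperedges n (Mrel H (psep n E)))"
    using cls_finer[OF c(1) r' c(2) t(1)] Mrel_refine[OF cs sf] t(2) by simp
  then show ?thesis by (simp add: plc_def e M)
qed

lemma lev_mono: assumes c: "c \<in> LP" "d \<in> LP" and le: "lqL c d" shows "lev c \<le> lev d"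
proof -
  note m = rep[OF c(1)]
  obtain B where B: "(fst (rep c), B) \<in> d" "sep_refine n (psep n (snd (rep c))) (psep n B)" using L_le_rep[OF c le m] .
  show ?thesis unfolding lev_eq[OF c(1) m] lev_eq[OF c(2) B(1)]
    using Lam_mono[OF basis_conj_sys[OF LP_mem(1)[OF c(1) m]] B(2)] .
qed

lemma plc_props: assumes c: "c \<in> LP" shows "plc c \<in> LP \<and> lqL c (plc c) \<and> lev (plc c) = lev c"
proof -
  note m = rep[OF c]
  define H where "H = fst (rep c)"
  define E where "E = snd (rep c)"
  have m: "(H, E) \<in> c" using m by (simp add: H_def E_def)
  note v = LP_mem[OF c m]
  have cs: "conj_sys H" using basis_conj_sys v by simp
  have sf: "sep_family n (psep n E)" using pl_tree_sep_family v by simp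
  let ?T = "hyperedges n (Mrel H (psep n E))"
  note t = tree_of[OF Mrel_sep[OF cs sf]]
  have p: "plc c = cls H ?T" using plc_eq[OF c m] .
  have L: "plc c \<in> LP" unfolding p using cls_LP[OF v(1) t(1)] .
  moreover have "lqL c (plc c)" unfolding p using L_le_I[OF v(1,2) t(1)] Mrel_refine[OF cs sf] t(2) v(3) by simp
  moreover have "lev (plc c) = Lam H (psep n ?T)" using lev_eq[OF L] p cls_mem by simp
  ultimately show ?thesis
    using lev_eq[OF c m] Lam_eq[OF cs Mrel_refine[OF cs sf] Mrel_NA[OF cs sf]] t(2) by simp
qed

lemma plc_level:
  assumes c: "c \<in> LP" "d \<in> LP" and le: "lqL c d" and ev: "lev c = lev d"
  shows "plc c = plc d"
proof -
  define H where "H = fst (rep c)"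
  define A where "A = snd (rep c)"
  have m: "(H, A) \<in> c" using rep[OF c(1)] by (simp add: H_def A_def)
  obtain B where B: "(H, B) \<in> d" "pl_tree n B" "sep_refine n (psep n A) (psep n B)" using L_le_rep[OF c le m] .
  note v = LP_mem[OF c(1) m]
  have cs: "conj_sys H" using basis_conj_sys v by simp
  have sA: "sep_family n (psep n A)" and sB: "sep_family n (psep n B)" using pl_tree_sep_family v B by simp_all
  let ?MA = "Mrel H (psep n A)" and ?MB = "Mrel H (psep n B)"
  have lam: "Lam H (psep n A) = Lam H (psep n B)" using ev lev_eq[OF c(1) m] lev_eq[OF c(2) B(1)] by simp
  have lA: "Lam H (psep n A) = Lam H ?MA" using Lam_eq[OF cs Mrel_refine[OF cs sA] Mrel_NA[OF cs sA]] .
  have lB: "Lam H (psep n B) = Lam H ?MB" using Lam_eq[OF cs Mrel_refine[OF cs sB] Mrel_NA[OF cs sB]] .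
  have "?MA k i j = ?MB k i j" for k i j
  proof
    assume "?MA k i j"
    then show "?MB k i j"
      using Mrel_max[OF cs sep_refine_trans[OF B(3) Mrel_refine[OF cs sB]]] lam lB by simp
  next
    assume b: "?MB k i j"
    have "sep_refine n (psep n B) ?MA"
      using Mrel_max[OF cs B(3) lam] sB Mrel_sep[OF cs sA] by (auto simp: sep_refine_def sep_refine_axioms_def)
    from Mrel_max[OF cs this _ b] show "?MA k i j" using lam lA by simp
  qed
  then have "?MA = ?MB" by blast
  then show ?thesis using plc_eq[OF c(1) m] plc_eq[OF c(2) B(1)] by simp
qed

text \<open>Cut off outside \<open>{1..n}\<close> because a basis is required to be empty
  there.\<close>

definition Gs0 :: "nat \<Rightarrow> 'a set" where "Gs0 j = (if j \<in> {1..n} then Gs j else {})"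
text \<open>No label separates any others: the tree is a star with one unlabelled vertex.\<close>

definition Rt :: "nat \<Rightarrow> nat \<Rightarrow> nat \<Rightarrow> bool" where
  "Rt k i j \<longleftrightarrow> k \<le> n \<and> i \<le> n \<and> j \<le> n \<and> i \<noteq> k \<and> j \<noteq> k"
definition Et :: "nat set set" where "Et = hyperedges n Rt"
definition m0 where "m0 = cls Gs0 Et"

lemma Rt_sep: "sep_family n Rt" by unfold_locales (auto simp: Rt_def)

lemma Et: "pl_tree n Et" "psep n Et = Rt" using tree_of[OF Rt_sep] by (simp_all add: Et_def)

lemma Rt_coarsest: "sep_family n R \<Longrightarrow> sep_refine n Rt R"
  using Rt_sep sep_family.dom[of n R] unfolding sep_refine_def sep_refine_axioms_def Rt_def by blast

lemma Gs0_basis: "basis Gs0"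
proof -
  have "reduced_word G Gs0 n = reduced_word G Gs n"
    by (intro ext) (auto simp: reduced_word_def Gs0_def)
  then have "internal_free_product G Gs0 n"
    using ifp unfolding internal_free_product_def by (simp add: Gs0_def)
  moreover have "\<exists>g\<in>carrier G. Gs0 i = (\<lambda>h. g \<otimes> h \<otimes> inv g) ` Gs i" if "i \<in> {1..n}" for i
    using cjset_one[OF Gs_sub[OF that]] that unfolding cjset_def Gs0_def by (intro bexI[of _ \<one>]) simp_all
  ultimately show ?thesis by (simp add: is_basis_def Gs0_def)
qed

lemma Gs0_R0: assumes "k \<le> n" "i \<le> n" "j \<le> n" "i \<noteq> k" "j \<noteq> k" shows "R0 Gs0 k i j"
proof (cases "k = 0")
  case False
  then have k: "k \<in> {1..n}" using assms by simp
  have one: "\<one> \<in> pos Gs0 l" if "l \<le> n" for l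
  proof (cases "l = 0")
    case True then show ?thesis by (simp add: pos_def)
  next
    case False
    then have "l \<in> {1..n}" using that by simp
    then show ?thesis using cjset_one[OF Gs_sub, of l] False by (simp add: pos_def Gs0_def)
  qed
  have "dirn Gs0 k l = \<one>" if "l \<le> n" "l \<noteq> k" for l
    using dirn_eqI(1)[OF k that one[OF assms(1)] one[OF that(1)]] k by simp
  then show ?thesis using assms by (simp add: R0_def)
qed (use assms in \<open>simp add: R0_def\<close>)

lemma m0_props: "m0 \<in> LP" "plc m0 = m0" "x \<in> LP \<Longrightarrow> lqL x m0 \<Longrightarrow> x = m0"
proof -
  show L: "m0 \<in> LP" unfolding m0_def using cls_LP[OF Gs0_basis Et(1)] .
  have mem: "(Gs0, Et) \<in> m0" unfolding m0_def by (rule cls_mem)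
  have "flat Gs0 Rt" unfolding flat_def nbr_def using Gs0_R0 by auto
  then have M: "Mrel Gs0 Rt = Rt" using flat_Mrel[OF Rt_sep] by simp
  have "plc m0 = cls Gs0 (hyperedges n Rt)" using plc_eq[OF L mem] by (simp only: Et(2) M)
  then show "plc m0 = m0" unfolding Et_def[symmetric] m0_def[symmetric] .
  show "x = m0" if x: "x \<in> LP" "lqL x m0"
  proof -
    define H where "H = fst (rep x)"
    define A where "A = snd (rep x)"
    have m: "(H, A) \<in> x" using rep[OF x(1)] by (simp add: H_def A_def)
    obtain B where B: "(H, B) \<in> m0" "pl_tree n B" "sep_refine n (psep n A) (psep n B)" using L_le_rep[OF x(1) L x(2) m] .
    have "B = Et" using LP_mem2(1)[OF L mem B(1)] .
    then have r: "sep_refine n (psep n A) Rt" using B(3) Et by simp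
    have A: "pl_tree n A" "x = cls H A" using LP_mem[OF x(1) m] by auto
    have "sep_refine n Rt (psep n A)" using Rt_coarsest[OF pl_tree_sep_family[OF A(1)]] .
    then have "psep n A = psep n Et" using r Et unfolding sep_refine_def sep_refine_axioms_def by (intro ext) auto
    then have "A = Et" using pl_tree_eqI[OF A(1) Et(1)] by simp
    then show ?thesis using A(2) LP_mem(3)[OF L B(1)] \<open>B = Et\<close> by simp
  qed
qed

lemma basis_eqI:
  assumes "basis H" "basis H'" "\<And>j. j \<in> {1..n} \<Longrightarrow> H j = H' j"
  shows "H = H'"
proof
  fix j
  show "H j = H' j" using assms by (cases "j \<in> {1..n}") (auto simp: is_basis_def)
qed

text \<open>In the star all labels are adjacent, so flatness makes all directions at each label
  agree, as \<open>basis_unique_if_R0_total\<close> requires.\<close>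

lemma flat_trivial:
  assumes H: "basis H" and f: "flat H Rt" shows "H = Gs0"
proof (rule basis_eqI[OF H Gs0_basis])
  have cs: "conj_sys H" using basis_conj_sys[OF H] .
  have "R0 H k i j" if h: "k \<le> n" "i \<le> n" "j \<le> n" "i \<noteq> k" "j \<noteq> k" for k i j
  proof -
    have "nbr n Rt k i" "nbr n Rt k j" "Rt k i j" using h by (auto simp: nbr_def Rt_def)
    then show ?thesis using f unfolding flat_def by blast
  qed
  moreover have "internal_free_product G H n" using H by (simp add: is_basis_def)
  ultimately show "H j = Gs0 j" if "j \<in> {1..n}" for j
    using basis_unique_if_R0_total[OF cs _ _ that] that by (simp add: Gs0_def)
qed

lemma reduction:
  assumes m: "m \<in> LP" "plc m = m" "m \<noteq> m0"
  shows "\<exists>\<pi> a. (a \<in> LP \<and> lqL a m \<and> lev a < lev m) \<and>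
        (\<forall>b\<in>LP. lqL b m \<and> lev b < lev m \<longrightarrow> \<pi> b \<in> LP \<and> lqL (\<pi> b) m \<and> lev (\<pi> b) < lev m \<and> lqL b (\<pi> b) \<and> lqL a (\<pi> b)) \<and>
        (\<forall>b\<in>LP. \<forall>c\<in>LP. lqL b c \<and> lqL c m \<and> lev c < lev m \<longrightarrow> lqL (\<pi> b) (\<pi> c))"
proof -
  define H where "H = fst (rep m)"
  define E where "E = snd (rep m)"
  have mem: "(H, E) \<in> m" using rep[OF m(1)] by (simp add: H_def E_def)
  note v = LP_mem[OF m(1) mem]
  have cs: "conj_sys H" using basis_conj_sys v by simp
  define A where "A = psep n E"
  have sA: "sep_family n A" using pl_tree_sep_family v by (simp add: A_def)
  interpret a: sep_family n A by fact
  have EA: "E = hyperedges n A" using pl_tree_hyperedges[OF v(2)] by (simp add: A_def)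
  \<comment> \<open>Being the largest tree of its level means that no petal can be split further by
    directions.\<close>
  have fl: "flat H A"
  proof -
    have "(H, hyperedges n (Mrel H A)) \<in> m" using plc_eq[OF m(1) mem] m(2) cls_mem by (simp add: A_def)
    then have "hyperedges n (Mrel H A) = E" using LP_mem2(1)[OF m(1) mem] by simp
    then have "Mrel H A = A" using tree_of(2)[OF Mrel_sep[OF cs sA]] by (simp add: A_def)
    then show ?thesis using Mrel_flat[OF cs sA] by simp
  qed
  have mrep: "basis K \<and> conj_sys K \<and> loc A H K \<and> flat K A" if "(K, E) \<in> m" for K
  proof -
    have l: "loc A H K" using LP_mem2(2)[OF m(1) mem that] by (simp add: A_def)
    then show ?thesis using LP_mem(1)[OF m(1) that] basis_conj_sys flat_loc[OF cs sA l fl] by simp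
  qed
  have "A \<noteq> Rt"
  proof
    assume "A = Rt"
    then have "H = Gs0" "E = Et" using flat_trivial[OF v(1)] fl EA by (simp_all add: Et_def)
    then show False using v(3) m(3) by (simp add: m0_def)
  qed
  have "\<exists>k i j. Rt k i j \<and> \<not> A k i j"
  proof (rule ccontr)
    assume no: "\<not> (\<exists>k i j. Rt k i j \<and> \<not> A k i j)"
    have "A k i j = Rt k i j" for k i j
      using no a.dom[of k i j] by (auto simp: Rt_def)
    then show False using \<open>A \<noteq> Rt\<close> by (simp add: fun_eq_iff)
  qed
  then obtain k i j where kij: "Rt k i j" "\<not> A k i j" by blast
  have flA: "R0 K k (toward n A k i) (toward n A k j)" if "flat K A" "A k i j" for K k i j
  proof -
    note d = a.dom[OF that(2)]
    have t: "A k (toward n A k i) i" "A k (toward n A k j) j" "nbr n A k (toward n A k i)" "nbr n A k (toward n A k j)"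
      using a.toward_R[of k i] a.toward_R[of k j] a.toward(1)[of k i] a.toward(1)[of k j] d by simp_all
    have "A k (toward n A k i) (toward n A k j)" using a.trn[OF a.trn[OF t(1) that(2)] a.sm[OF t(2)]] .
    then show ?thesis using that(1)[unfolded flat_def, rule_format, OF conjI[OF t(3) conjI[OF t(4)]]] by simp
  qed
  \<comment> \<open>The target of the contraction must not depend on \<open>b\<close>, so one
    representative of \<open>m\<close> is fixed in which all directions at each label agree.\<close>
  obtain K where K: "((H, E), (K, E)) \<in> idt" "basis K" "aligned A K"
    using align_exists[OF v(1) sep_refine_refl[OF sA] EA flA[OF fl]] by blast
  have Km: "(K, E) \<in> m" using K(1) v(3) by (simp add: cls_def)
  have csK: "conj_sys K" using basis_conj_sys[OF K(2)] .
  define aa where "aa = cls K Et"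
  have aL: "aa \<in> LP" unfolding aa_def using cls_LP[OF K(2) Et(1)] .
  have am: "lqL aa m" unfolding aa_def LP_mem(3)[OF m(1) Km]
    using L_le_I[OF K(2) Et(1) v(2)] Rt_coarsest[OF sA] Et(2) by (simp add: A_def)
  have "lev aa = Lam K Rt" using lev_eq[OF aL, of K Et] cls_mem Et by (simp add: aa_def)
  moreover have "lev m = Lam K A" using lev_eq[OF m(1) Km] by (simp add: A_def)
  \<comment> \<open>A separation present in \<open>A\<close> is undone in the star, and over the
    aligned basis the corresponding fold is aligned.\<close>
  moreover have "Lam K Rt < Lam K A"
  proof (rule Lam_strict[OF csK Rt_coarsest[OF sA]])
    have d: "k \<le> n" "i \<le> n" "i \<noteq> k" "j \<le> n" "j \<noteq> k" using kij by (auto simp: Rt_def)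
    let ?a = "toward n A k i" and ?b = "toward n A k j"
    have n: "nbr n A k ?a" "nbr n A k ?b" using a.toward(1) d by auto
    have "\<not> A k ?a ?b"
      using a.trn[OF a.sm[OF a.toward_R[OF d(1-3)]] a.trn[OF _ a.toward_R[OF d(1,4,5)]]] kij(2) by blast
    moreover have "R0 K k ?a ?b" using K(3) d unfolding aligned_def by blast
    moreover have "Rt k ?a ?b" using n by (auto simp: nbr_def Rt_def)
    ultimately show "\<not> NA K Rt A" using n unfolding NA_def by blast
  qed
  ultimately have alev: "lev aa < lev m" by simp
  define P where "P H' B = cls H' (hyperedges n (proj H' A (psep n B)))" for H' B
  define pf where "pf b = P (fst (rep b)) (snd (rep b))" for b
  have below: "(K', E) \<in> m \<and> sep_refine n (psep n B) A" if b: "b \<in> LP" "lqL b m" "(K', B) \<in> b" for b K' B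
  proof -
    obtain E' where "(K', E') \<in> m" "sep_refine n (psep n B) (psep n E')" using L_le_rep[OF b(1) m(1) b(2,3)] by blast
    then show ?thesis using LP_mem2(1)[OF m(1) mem] by (auto simp: A_def)
  qed
  have pr: "sep_family n (proj K' A (psep n B))" "sep_refine n (proj K' A (psep n B)) A" "sep_refine n (psep n B) (proj K' A (psep n B))"
    if "(K', E) \<in> m" "sep_refine n (psep n B) A" for K' B
  proof -
    show r: "sep_refine n (proj K' A (psep n B)) A" "sep_refine n (psep n B) (proj K' A (psep n B))"
      using proj_refine[of K' "psep n B" A] mrep[OF that(1)] that(2) by auto
    show "sep_family n (proj K' A (psep n B))" using r(1) by (simp add: sep_refine_def)
  qed
  have pf_eq: "pf b = P K' B" if b: "b \<in> LP" "lqL b m" "(K', B) \<in> b" for b K' B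
  proof -
    note rb = rep[OF b(1)]
    have e: "snd (rep b) = B" using LP_mem2(1)[OF b(1,3) rb] .
    have rb': "(fst (rep b), B) \<in> b" using rb e by simp
    have l: "loc (psep n B) K' (fst (rep b))" using LP_mem2(2)[OF b(1,3) rb] .
    note bl = below[OF b]
    have "proj (fst (rep b)) A (psep n B) = proj K' A (psep n B)"
      using proj_loc[OF _ conjunct2[OF bl] l] mrep[OF conjunct1[OF bl]] by simp
    moreover have "cls (fst (rep b)) (hyperedges n (proj K' A (psep n B))) = cls K' (hyperedges n (proj K' A (psep n B)))"
      using cls_finer[OF b(1) rb' b(3)] tree_of[OF pr(1)[OF conjunct1[OF bl] conjunct2[OF bl]]]
        pr(3)[OF conjunct1[OF bl] conjunct2[OF bl]] by simp
    ultimately show ?thesis by (simp add: pf_def P_def e)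
  qed
  have first: "pf b \<in> LP \<and> lqL (pf b) m \<and> lev (pf b) < lev m \<and> lqL b (pf b) \<and> lqL aa (pf b)"
    if b: "b \<in> LP" "lqL b m" "lev b < lev m" for b
  proof -
    define K' where "K' = fst (rep b)"
    define B where "B = snd (rep b)"
    have mb: "(K', B) \<in> b" using rep[OF b(1)] by (simp add: K'_def B_def)
    note vb = LP_mem[OF b(1) mb]
    note bl = below[OF b(1,2) mb]
    note q = pr[OF conjunct1[OF bl] conjunct2[OF bl]]
    note mk = mrep[OF conjunct1[OF bl]]
    define C where "C = proj K' A (psep n B)"
    note t = tree_of[OF q(1), folded C_def]
    define T where "T = hyperedges n C"
    have T: "pl_tree n T" "psep n T = C" using t by (simp_all add: T_def)
    have e: "pf b = cls K' T" using pf_eq[OF b(1,2) mb] by (simp add: P_def C_def T_def)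
    have L: "pf b \<in> LP" unfolding e using cls_LP[OF vb(1) T(1)] .
    have "lqL (pf b) m" unfolding e LP_mem(3)[OF m(1) conjunct1[OF bl]]
      using L_le_I[OF vb(1) T(1) v(2)] q(2) T(2) by (simp add: A_def C_def)
    moreover have "lqL b (pf b)"
    proof -
      have "lqL (cls K' B) (cls K' T)" using L_le_I[OF vb(1,2) T(1)] q(3) T(2) by (simp add: C_def)
      then show ?thesis unfolding e vb(3)[symmetric] .
    qed
    moreover have "lev (pf b) < lev m"
    proof -
      have "lev (pf b) = Lam K' C" using lev_eq[OF L, of K' T] e cls_mem T by simp
      moreover have "lev m = Lam K' A" using lev_eq[OF m(1) conjunct1[OF bl]] by (simp add: A_def)
      moreover have "lev b = Lam K' (psep n B)" using lev_eq[OF b(1) mb] .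
      ultimately show ?thesis using proj_Lam[of K' "psep n B" A] mk conjunct2[OF bl] b(3) by (simp add: C_def)
    qed
    \<comment> \<open>The representative is rotated into an aligned one within the class
      \<open>pf b\<close>. The result also represents \<open>m\<close>, so it is \<open>K\<close> by
      uniqueness, and the star over \<open>K\<close> lies below.\<close>
    moreover have "lqL aa (pf b)"
    proof -
      have Cc: "R0 K' k (toward n A k i) (toward n A k j)" if "C k i j" for k i j using that by (simp add: C_def proj_def)
      have rA: "sep_refine n C A" using q(2) by (simp add: C_def)
      obtain K2 where K2: "((K', T), (K2, T)) \<in> idt" "basis K2" "aligned A K2"
        using align_exists[OF vb(1) rA T_def Cc] by blast
      have "((K', E), (K2, E)) \<in> idt" using ident_mono[OF K2(1) vb(1) T(1) v(2)] rA T(2) by (simp add: A_def)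
      then have K2m: "(K2, E) \<in> m" using LP_mem(3)[OF m(1) conjunct1[OF bl]] by (simp add: cls_def)
      have l: "loc A K K2" using LP_mem2(2)[OF m(1) Km K2m] by (simp add: A_def)
      have "K2 = K"
      proof (rule basis_eqI[OF K2(2) K(2)])
        fix l assume l1: "l \<in> {1..n}"
        have "pos K2 l = pos K l" using aligned_unique[OF csK sA l K(3) K2(3)] l1 by simp
        moreover obtain c where "c \<in> pos K l" using pos_nonempty[OF csK, of l] l1 by auto
        ultimately have "c \<in> pos K2 l" "c \<in> pos K l" by simp_all
        then show "K2 l = K l" using l1 by (simp add: pos_def)
      qed
      then have "pf b = cls K T" using cls_eqI[OF K2(1)] e by simp
      then show ?thesis unfolding aa_def using L_le_I[OF K(2) Et(1) T(1)] Rt_coarsest T(2) Et(2) q(1) by (simp add: C_def)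
    qed
    ultimately show ?thesis using L by simp
  qed
  \<comment> \<open>Over a common basis \<open>proj\<close> is monotone in its last
    argument.\<close>
  have second: "lqL (pf b) (pf c)" if b: "b \<in> LP" "c \<in> LP" "lqL b c" "lqL c m" for b c
  proof -
    have bm: "lqL b m" using order_on_set.trans_lq[OF L_order b(1,2) m(1) b(3,4)] .
    define K' where "K' = fst (rep b)"
    define B where "B = snd (rep b)"
    have mb: "(K', B) \<in> b" using rep[OF b(1)] by (simp add: K'_def B_def)
    obtain C where C: "(K', C) \<in> c" "sep_refine n (psep n B) (psep n C)" using L_le_rep[OF b(1-3) mb] .
    note bb = below[OF b(1) bm mb] and bc = below[OF b(2,4) C(1)]
    note qb = pr[OF conjunct1[OF bb] conjunct2[OF bb]] and qc = pr[OF conjunct1[OF bc] conjunct2[OF bc]]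
    note tb = tree_of[OF qb(1)] and tc = tree_of[OF qc(1)]
    have "sep_refine n (proj K' A (psep n B)) (proj K' A (psep n C))"
      using C(2) qb(1) qc(1) unfolding sep_refine_def sep_refine_axioms_def proj_def by blast
    then show ?thesis unfolding pf_eq[OF b(1) bm mb] pf_eq[OF b(2,4) C(1)] P_def
      using L_le_I[OF LP_mem(1)[OF b(1) mb] tb(1) tc(1)] tb(2) tc(2) by simp
  qed
  show ?thesis
  proof (intro exI[of _ pf] exI[of _ aa] conjI ballI impI)
    show "aa \<in> LP" "lqL aa m" "lev aa < lev m" by fact+
  qed (use first second in blast)+
qed

end

theorem theorem3p1:
  fixes G :: "('a, 'b) monoid_scheme" and Gs :: "nat \<Rightarrow> 'a set" and n :: nat
  assumes "group G"
    and "1 \<le> n"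
    and "internal_free_product G Gs n"
    and "\<forall>i\<in>{1..n}. finite (Gs i) \<and> Gs i \<noteq> {\<one>\<^bsub>G\<^esub>}"
  shows "contractible_space (L_complex G Gs n)"
proof -
  interpret mm: mm_setting G Gs n
    using assms by (simp add: mm_setting_def mm_setting_axioms_def reference_product_def
        reference_product_axioms_def free_product_def free_product_axioms_def)
  show ?thesis
    unfolding L_complex_def
  proof (rule contractible_by_levels[where lev = mm.lev and pl = mm.plc and ?m0.0 = mm.m0])
    show "order_on_set mm.LP mm.lqL" by (rule mm.L_order)
    show "mm.lev x \<le> mm.lev y" if "x \<in> mm.LP" "y \<in> mm.LP" "mm.lqL x y" for x y
      using mm.lev_mono[OF that] .
    show "mm.plc x \<in> mm.LP \<and> mm.lqL x (mm.plc x) \<and> mm.lev (mm.plc x) = mm.lev x" if "x \<in> mm.LP" for x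
      using mm.plc_props[OF that] .
    show "mm.plc x = mm.plc y" if "x \<in> mm.LP" "y \<in> mm.LP" "mm.lqL x y" "mm.lev x = mm.lev y" for x y
      using mm.plc_level[OF that] .
    show "mm.m0 \<in> mm.LP" "mm.plc mm.m0 = mm.m0" by (rule mm.m0_props)+
    show "x = mm.m0" if "x \<in> mm.LP" "mm.lqL x mm.m0" for x
      using mm.m0_props(3)[OF that] .
  qed (rule mm.reduction)
qed

end
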